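(* Let a root datum of finite type be given and let $\mathcal{A}=\mathbb{Z}[v,v^{-1}]$. Let $\theta:\mathbf{U}\to\widehat{\mathbf{U}}$ be the unique $\mathbb{Q}(v)$-algebra homomorphism with $\widehat{p}_\pi\circ\theta=p_\pi$ for every finite saturated $\pi\subset X^+$. Then $\theta$ restricts to an injective $\mathcal{A}$-algebra homomorphism ${}_{\mathcal{A}}\mathbf{U}\to{}_{\mathcal{A}}\widehat{\mathbf{U}}$ sending $E_{\pm i}^{(m)}$ to $\widehat{E}_{\pm i}^{(m)}$ and $K_h$ to $\widehat{K}_h$ for all $i\in I$, $m\ge0$, $h\in Y$. Hence ${}_{\mathcal{A}}\mathbf{U}$ is isomorphic to the $\mathcal{A}$-subalgebra of ${}_{\mathcal{A}}\widehat{\mathbf{U}}$ generated by all $\widehat{E}_{\pm i}^{(m)}$, $\widehat{K}_h$ ($i\in I$, $m\ge0$, $h\in Y$).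
   Context: **Root datum.** A Cartan datum is a finite set $I$ with a symmetric $\mathbb{Z}$-valued bilinear form $(\ ,\ )$ on $\mathbb{Z}[I]$ such that $(i,i)\in\{2,4,6,\dots\}$ for $i\in I$ and $2(i,j)/(i,i)\in\{0,-1,-2,\dots\}$ for $i\neq j$. It is of finite type if the matrix $((i,j))_{i,j\in I}$ is positive definite. A root datum for it consists of finitely generated free abelian groups $X,Y$, a perfect pairing $\langle\ ,\ \rangle:Y\times X\to\mathbb{Z}$, and embeddings $I\to Y$ ($i\mapsto h_i$), $I\to X$ ($i\mapsto\alpha_i$) with $\langle h_i,\alpha_j\rangle=2(i,j)/(i,i)$. Throughout it is of finite type. Put $d_i=(i,i)/2$; $\mathbb{N}=\{0,1,2,\dots\}$; $X^+=\{\lambda\in X:\langle h_i,\lambda\rangle\in\mathbb{N}\ \forall i\in I\}$; $\lambda\le\lambda'$ iff $\lambda'-\lambda\in\sum_i\mathbb{N}\alpha_i$. $W$ is the (finite) Weyl group acting on $X$, generated by $\lambda\mapsto\lambda-\langle h_i,\lambda\rangle\alpha_i$. **Quantum numbers.** $v$ is an indeterminate, $v_i=v^{d_i}$; for $P\in\mathbb{Q}(v)$, $P_i$ is $P$ with $v$ replaced by $v_i$. $[n]=(v^n-v^{-n})/(v-v^{-1})$ for $n\in\mathbb{Z}$, $[n]^!=[1][2]\cdots[n]$ for $n\in\mathbb{N}$. Divided powers: $E_{\pm i}^{(m)}=E_{\pm i}^m/[m]_i^!$, and likewise $\widehat{E}_{\pm i}^{(m)}=\widehat{E}_{\pm i}^m/[m]_i^!$.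 **The algebra $\mathbf{U}$** is the unital associative $\mathbb{Q}(v)$-algebra with generators $E_i,E_{-i}$ ($i\in I$), $K_h$ ($h\in Y$) and relations: $K_hK_{h'}=K_{h+h'}$, $K_0=1$; $K_hE_{\pm i}=v^{\pm\langle h,\alpha_i\rangle}E_{\pm i}K_h$; $E_iE_{-j}-E_{-j}E_i=\delta_{ij}\frac{K_{d_ih_i}-K_{-d_ih_i}}{v_i-v_i^{-1}}$; $\sum_{s+s'=1-\langle h_i,\alpha_j\rangle}(-1)^{s'}E_{\pm i}^{(s)}E_{\pm j}E_{\pm i}^{(s')}=0$ for $i\ne j$. **The algebras $\mathbf{S}(\pi)$.** A nonempty subset $\pi\subset X^+$ is saturated if $\lambda\in X^+$, $\mu\in\pi$, $\lambda\le\mu$ imply $\lambda\in\pi$. For finite saturated $\pi$, $\mathbf{S}(\pi)$ is the unital associative $\mathbb{Q}(v)$-algebra with generators $E_i,E_{-i}$ ($i\in I$), $1_\lambda$ ($\lambda\in W\pi$) and, with the convention $1_\lambda=0$ for $\lambda\in X\setminus W\pi$, relations (for all $i,j\in I$, $\lambda,\lambda'\in X$): $1_\lambda1_{\lambda'}=\delta_{\lambda,\lambda'}1_\lambda$, $\sum_{\lambda\in X}1_\lambda=1$; $E_{\pm i}1_\lambda=1_{\lambda\pm\alpha_i}E_{\pm i}$; $E_iE_{-j}-E_{-j}E_i=\delta_{ij}\sum_{\lambda\in X}[\langle h_i,\lambda\rangle]_i1_\lambda$; $\sum_{s+s'=1-\langle h_i,\alpha_j\rangle}(-1)^{s'}E_{\pm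 i}^{(s)}E_{\pm j}E_{\pm i}^{(s')}=0$ for $i\neq j$. It is finite dimensional. In $\mathbf{S}(\pi)$ put $K_h=\sum_{\lambda\in W\pi}v^{\langle h,\lambda\rangle}1_\lambda$ ($h\in Y$). **Inverse limit.** For $\pi\subset\pi'$, $f_{\pi,\pi'}:\mathbf{S}(\pi')\to\mathbf{S}(\pi)$ is the surjective algebra map $E_{\pm i}\mapsto E_{\pm i}$, $1_\lambda\mapsto1_\lambda$. $\widehat{\mathbf{U}}=\varprojlim\mathbf{S}(\pi)=\{(a_\pi)_\pi\in\prod_\pi\mathbf{S}(\pi): a_\pi=f_{\pi,\pi'}(a_{\pi'})\text{ for }\pi\subset\pi'\}$, over all finite saturated $\pi\subset X^+$, with componentwise operations; $\widehat{p}_\pi:\widehat{\mathbf{U}}\to\mathbf{S}(\pi)$ is the projection. Put $\widehat{E}_{\pm i}=(E_{\pm i})_\pi$, $\widehat{K}_h=(K_h)_\pi$. **The maps $p_\pi$.** $p_\pi:\mathbf{U}\to\mathbf{S}(\pi)$ is the surjective algebra map $E_{\pm i}\mapsto E_{\pm i}$, $K_h\mapsto K_h$. Its kernel is the ideal of all $u\in\mathbf{U}$ annihilating $\Delta(\lambda)$ for every $\lambda\in\pi$, where $\Delta(\lambda)$ is the simple $\mathbf{U}$-module of highest weight $\lambda$ (type 1, i.e. the direct sum of its weight spaces $\{m:K_hm=v^{\langle h,\mu\rangle}m\ \forall h\in Y\}$, $\mu\in X$). **Integral forms.** ${}_{\mathcal{A}}\mathbf{U}$ is the $\mathcal{A}$-subalgebra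 of $\mathbf{U}$ generated by all $E_{\pm i}^{(m)}$ ($i\in I$, $m\ge0$) and $K_h$ ($h\in Y$). ${}_{\mathcal{A}}\mathbf{S}(\pi)$ is the $\mathcal{A}$-subalgebra of $\mathbf{S}(\pi)$ generated by all $E_{\pm i}^{(m)}$ ($i\in I$, $m\ge0$) and $1_\lambda$ ($\lambda\in W\pi$). ${}_{\mathcal{A}}\widehat{\mathbf{U}}$ is the $\mathcal{A}$-subalgebra of $\widehat{\mathbf{U}}$ consisting of all $(a_\pi)_\pi\in\widehat{\mathbf{U}}$ with $a_\pi\in{}_{\mathcal{A}}\mathbf{S}(\pi)$ for all $\pi$ (it is $\varprojlim{}_{\mathcal{A}}\mathbf{S}(\pi)$). *)

theory Defs
  imports
    "HOL-Library.Poly_Mapping"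
    "HOL-Library.FuncSet"
    "HOL-Computational_Algebra.Polynomial"
    "HOL-Computational_Algebra.Fraction_Field"
    "HOL-Algebra.QuotRing"
    "HOL-Algebra.Subrings"
    "HOL-Algebra.Generated_Groups"
    "HOL-Algebra.Bij"
begin

section \<open>Root data\<close>

definition zscale :: "int \<Rightarrow> 'a::ab_group_add \<Rightarrow> 'a" where
  "zscale n x = (\<Sum>_<nat n. x) - (\<Sum>_<nat (- n). x)"

lemma zscale_of_nat: "zscale (int n) x = (\<Sum>_<n. x)"
  by (simp add: zscale_def)

lemma zscale_minus: "zscale (- n) x = - zscale n x"
  by (simp add: zscale_def)

lemma zscale_succ: "zscale (n + 1) x = zscale n x + x"
proof (cases "n \<ge> 0")
  case True
  then show ?thesis by (simp add: zscale_def nat_add_distrib)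
next
  case False
  then obtain k where k: "n = - int (Suc k)"
    by (metis add.inverse_inverse int_cases not_le of_nat_0_le_iff)
  have "n + 1 = - int k" using k by simp
  then have "zscale (n + 1) x = - (\<Sum>_<k. x)"
    by (simp only: zscale_minus zscale_of_nat)
  moreover have "zscale n x = - (\<Sum>_<Suc k. x)"
    by (simp only: k zscale_minus zscale_of_nat)
  ultimately show ?thesis by simp
qed

lemma zscale_add_left: "zscale (m + n) x = zscale m x + zscale n x"
proof (induction n rule: int_induct[where k = 0])
  case base
  show ?case by (simp add: zscale_def)
next
  case (step1 i)
  then show ?case
    using zscale_succ[of "m + i" x] zscale_succ[of i x] by (simp add: add.assoc)
next
  case (step2 i)
  then show ?case
    using zscale_succ[of "m + (i - 1)" x] zscale_succ[of "i - 1" x]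
    by (simp add: algebra_simps)
qed

lemma zscale_add_right: "zscale n (x + y) = zscale n x + zscale n y"
  by (simp add: zscale_def sum.distrib)

lemma zscale_mult: "zscale m (zscale n x) = zscale (m * n) x"
proof (induction m rule: int_induct[where k = 0])
  case base
  show ?case by (simp add: zscale_def)
next
  case (step1 i)
  then show ?case by (simp only: zscale_succ distrib_right zscale_add_left[of "i * n"] mult_1)
next
  case (step2 i)
  then show ?case
    using zscale_succ[of "i - 1" "zscale n x"] zscale_add_left[of "(i - 1) * n" n x]
    by (simp add: algebra_simps)
qed

interpretation zmod: Modules.module "zscale :: int \<Rightarrow> 'a::ab_group_add \<Rightarrow> 'a"
proof
  fix x :: 'a
  show "zscale 1 x = x" by (simp add: zscale_def)
qed (simp_all add: zscale_add_left zscale_add_right zscale_mult)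

text \<open>
  A \<open>\<int>\<close>-valued symmetric bilinear form on \<open>\<int>[I]\<close> is recorded by its values on the basis \<open>I\<close>.
  The index set \<open>I\<close> may be empty; the values of the fields outside \<open>I\<close> are irrelevant.
\<close>

record ('i, 'x, 'y) root_datum =
  index :: "'i set"
  form :: "'i \<Rightarrow> 'i \<Rightarrow> int"
  pair :: "'y \<Rightarrow> 'x \<Rightarrow> int"
  coroot :: "'i \<Rightarrow> 'y"
  root :: "'i \<Rightarrow> 'x"

definition cartan_datum :: "'i set \<Rightarrow> ('i \<Rightarrow> 'i \<Rightarrow> int) \<Rightarrow> bool" where
  "cartan_datum I f \<longleftrightarrow> finite I
     \<and> (\<forall>i\<in>I. \<forall>j\<in>I. f i j = f j i)
     \<and> (\<forall>i\<in>I. even (f i i) \<and> 0 < f i i)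
     \<and> (\<forall>i\<in>I. \<forall>j\<in>I. i \<noteq> j \<longrightarrow> f i i dvd 2 * f i j \<and> 2 * f i j div f i i \<le> 0)"

definition finite_type :: "'i set \<Rightarrow> ('i \<Rightarrow> 'i \<Rightarrow> int) \<Rightarrow> bool" where
  "finite_type I f \<longleftrightarrow>
     (\<forall>c :: 'i \<Rightarrow> real. (\<exists>i\<in>I. c i \<noteq> 0) \<longrightarrow> 0 < (\<Sum>i\<in>I. \<Sum>j\<in>I. c i * of_int (f i j) * c j))"

definition fg_free :: "'a::ab_group_add itself \<Rightarrow> bool" where
  "fg_free _ \<longleftrightarrow>
     (\<exists>B :: 'a set. finite B \<and> \<not> zmod.dependent B \<and> zmod.span B = UNIV)"

definition perfect_pairing :: "('y::ab_group_add \<Rightarrow> 'x::ab_group_add \<Rightarrow> int) \<Rightarrow> bool" where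
  "perfect_pairing p \<longleftrightarrow>
     (\<forall>x. additive (\<lambda>y. p y x)) \<and> (\<forall>y. additive (p y))
     \<and> bij_betw p UNIV {f. additive f}
     \<and> bij_betw (\<lambda>x y. p y x) UNIV {f. additive f}"

definition root_datum_finite_type ::
    "('i, 'x::ab_group_add, 'y::ab_group_add) root_datum \<Rightarrow> bool" where
  "root_datum_finite_type D \<longleftrightarrow>
     cartan_datum (index D) (form D) \<and> finite_type (index D) (form D)
     \<and> fg_free TYPE('x) \<and> fg_free TYPE('y) \<and> perfect_pairing (pair D)
     \<and> inj_on (coroot D) (index D) \<and> inj_on (root D) (index D)
     \<and> (\<forall>i\<in>index D. \<forall>j\<in>index D.
          (of_int (pair D (coroot D i) (root D j)) :: rat)
            = 2 * of_int (form D i j) / of_int (form D i i))"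

definition dominant :: "('i, 'x, 'y) root_datum \<Rightarrow> 'x set" where
  "dominant D = {\<nu>. \<forall>i\<in>index D. 0 \<le> pair D (coroot D i) \<nu>}"

definition weight_le :: "('i, 'x::ab_group_add, 'y) root_datum \<Rightarrow> 'x \<Rightarrow> 'x \<Rightarrow> bool" where
  "weight_le D \<nu> \<nu>' \<longleftrightarrow>
     (\<exists>c :: 'i \<Rightarrow> nat. \<nu>' - \<nu> = (\<Sum>i\<in>index D. zscale (int (c i)) (root D i)))"

definition reflection :: "('i, 'x::ab_group_add, 'y) root_datum \<Rightarrow> 'i \<Rightarrow> 'x \<Rightarrow> 'x" where
  "reflection D i \<nu> = \<nu> - zscale (pair D (coroot D i) \<nu>) (root D i)"

definition weyl_group :: "('i, 'x::ab_group_add, 'y) root_datum \<Rightarrow> ('x \<Rightarrow> 'x) set" where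
  "weyl_group D = generate (BijGroup UNIV) (reflection D ` index D)"

definition weyl_orbit :: "('i, 'x::ab_group_add, 'y) root_datum \<Rightarrow> 'x set \<Rightarrow> 'x set" where
  "weyl_orbit D \<pi> = {w \<nu> | w \<nu>. w \<in> weyl_group D \<and> \<nu> \<in> \<pi>}"

definition saturated :: "('i, 'x::ab_group_add, 'y) root_datum \<Rightarrow> 'x set \<Rightarrow> bool" where
  "saturated D \<pi> \<longleftrightarrow> \<pi> \<noteq> {} \<and> \<pi> \<subseteq> dominant D
     \<and> (\<forall>\<nu>\<in>dominant D. \<forall>\<mu>\<in>\<pi>. weight_le D \<nu> \<mu> \<longrightarrow> \<nu> \<in> \<pi>)"

definition finite_saturated :: "('i, 'x::ab_group_add, 'y) root_datum \<Rightarrow> 'x set set" where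
  "finite_saturated D = {\<pi>. finite \<pi> \<and> saturated D \<pi>}"

section \<open>Quantum numbers\<close>

type_synonym qv = "rat poly fract"

definition vv :: qv where
  "vv = Fract [:0, 1:] 1"

definition laurent :: "qv set" where
  "laurent = {x. \<exists>(K :: int set) (a :: int \<Rightarrow> int).
     finite K \<and> x = (\<Sum>k\<in>K. of_int (a k) * vv powi k)}"

text \<open>\<open>[n]\<close> and \<open>[m]\<^sup>!\<close> with \<open>v\<close> replaced by \<open>q\<close>, so that \<open>[n]\<^sub>i\<close> is \<open>qint (v_at D i) n\<close>.\<close>

definition qint :: "qv \<Rightarrow> int \<Rightarrow> qv" where
  "qint q n = (q powi n - q powi (- n)) / (q - inverse q)"

definition qfact :: "qv \<Rightarrow> nat \<Rightarrow> qv" where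
  "qfact q m = (\<Prod>k=1..m. qint q (int k))"

definition d_at :: "('i, 'x, 'y) root_datum \<Rightarrow> 'i \<Rightarrow> int" where
  "d_at D i = form D i i div 2"

definition v_at :: "('i, 'x, 'y) root_datum \<Rightarrow> 'i \<Rightarrow> qv" where
  "v_at D i = vv powi d_at D i"

section \<open>Algebras, homomorphisms and subalgebras\<close>

text \<open>
  Algebras are \<open>module\<close> records (a ring together with a scalar multiplication). The first
  argument \<open>L\<close> below is the ring of scalars: \<open>UNIV\<close> for \<open>\<rat>(v)\<close>, \<open>laurent\<close> for \<open>\<int>[v, v\<^sup>-\<^sup>1]\<close>.
\<close>

definition alg_hom ::
    "qv set \<Rightarrow> (qv, 'a) module \<Rightarrow> (qv, 'b) module \<Rightarrow> ('a \<Rightarrow> 'b) set" where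
  "alg_hom L A B = {f \<in> ring_hom A B.
     \<forall>c\<in>L. \<forall>x\<in>carrier A. f (c \<odot>\<^bsub>A\<^esub> x) = c \<odot>\<^bsub>B\<^esub> f x}"

definition alg_iso ::
    "qv set \<Rightarrow> (qv, 'a) module \<Rightarrow> (qv, 'b) module \<Rightarrow> ('a \<Rightarrow> 'b) set" where
  "alg_iso L A B = {f \<in> alg_hom L A B. bij_betw f (carrier A) (carrier B)}"

definition subalgebra_over :: "qv set \<Rightarrow> (qv, 'a) module \<Rightarrow> 'a set \<Rightarrow> bool" where
  "subalgebra_over L A B \<longleftrightarrow> subring B A \<and> (\<forall>c\<in>L. \<forall>x\<in>B. c \<odot>\<^bsub>A\<^esub> x \<in> B)"

definition subalgebra_gen :: "qv set \<Rightarrow> (qv, 'a) module \<Rightarrow> 'a set \<Rightarrow> 'a set" where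
  "subalgebra_gen L A S = subalgebra_over L A hull S"

definition divpow :: "(qv, 'a) module \<Rightarrow> qv \<Rightarrow> 'a \<Rightarrow> nat \<Rightarrow> 'a" where
  "divpow A q x m = inverse (qfact q m) \<odot>\<^bsub>A\<^esub> (x [^]\<^bsub>A\<^esub> m)"

section \<open>Algebras given by generators and relations\<close>

text \<open>
  Words form a monoid under concatenation, written additively so that the finitely supported
  functions on words (type \<open>poly_mapping\<close>) carry the multiplication of the free algebra.
\<close>

datatype 'g word = Word (letters: "'g list")

instantiation word :: (type) monoid_add
begin

definition zero_word :: "'a word" where
  "0 = Word []"

definition plus_word :: "'a word \<Rightarrow> 'a word \<Rightarrow> 'a word" where
  "w + w' = Word (letters w @ letters w')"

instance
  by standard (simp_all add: zero_word_def plus_word_def)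

end

type_synonym 'g free_alg = "'g word \<Rightarrow>\<^sub>0 qv"

definition scal :: "qv \<Rightarrow> 'g free_alg" where
  "scal c = Poly_Mapping.single 0 c"

definition gen :: "'g \<Rightarrow> 'g free_alg" where
  "gen g = Poly_Mapping.single (Word [g]) 1"

definition free_algebra :: "'g set \<Rightarrow> 'g free_alg ring" where
  "free_algebra G =
     \<lparr>carrier = {a. \<forall>w\<in>Poly_Mapping.keys a. set (letters w) \<subseteq> G},
      mult = (*), one = 1, zero = 0, add = (+)\<rparr>"

text \<open>
  \<open>pclass G R a\<close> is the residue class of \<open>a\<close> modulo the two-sided ideal generated by the set \<open>R\<close>
  of relators.
\<close>

definition pclass :: "'g set \<Rightarrow> 'g free_alg set \<Rightarrow> 'g free_alg \<Rightarrow> 'g free_alg set" where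
  "pclass G R a = (Idl\<^bsub>free_algebra G\<^esub> R) +>\<^bsub>free_algebra G\<^esub> a"

definition presented_algebra ::
    "'g set \<Rightarrow> 'g free_alg set \<Rightarrow> (qv, 'g free_alg set) module" where
  "presented_algebra G R =
     ring.extend (free_algebra G Quot (Idl\<^bsub>free_algebra G\<^esub> R))
       \<lparr>smult = (\<lambda>c X. pclass G R (scal c)
          \<otimes>\<^bsub>free_algebra G Quot (Idl\<^bsub>free_algebra G\<^esub> R)\<^esub> X)\<rparr>"

text \<open>
  The \<open>\<rat>(v)\<close>-algebra homomorphism from a presented algebra with prescribed values on the
  generators. It is meaningful when the values satisfy the relations; it is then unique as a
  map on the carrier, and is made unique as a function by being undefined elsewhere.
\<close>

definition presented_hom ::
    "'g set \<Rightarrow> 'g free_alg set \<Rightarrow> (qv, 'b) module \<Rightarrow> ('g \<Rightarrow> 'b) \<Rightarrow> 'g free_alg set \<Rightarrow> 'b" where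
  "presented_hom G R B val = (THE f. f \<in> extensional (carrier (presented_algebra G R))
     \<and> f \<in> alg_hom UNIV (presented_algebra G R) B
     \<and> (\<forall>g\<in>G. f (pclass G R (gen g)) = val g))"

datatype sign = Plus | Minus

fun signed :: "sign \<Rightarrow> 'a::ab_group_add \<Rightarrow> 'a" where
  "signed Plus x = x"
| "signed Minus x = - x"

definition free_divpow :: "qv \<Rightarrow> 'g free_alg \<Rightarrow> nat \<Rightarrow> 'g free_alg" where
  "free_divpow q x m = scal (inverse (qfact q m)) * x ^ m"

text \<open>The quantum Serre relators; \<open>e \<epsilon> i\<close> stands for \<open>E\<^sub>\<plusminus>\<^sub>i\<close>.\<close>

definition serre_relators ::
    "('i, 'x, 'y) root_datum \<Rightarrow> (sign \<Rightarrow> 'i \<Rightarrow> 'g free_alg) \<Rightarrow> 'g free_alg set" where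
  "serre_relators D e =
     {\<Sum>(s, s')\<in>{(s, s'). int s + int s' = 1 - pair D (coroot D i) (root D j)}.
        (- 1) ^ s' * free_divpow (v_at D i) (e \<epsilon> i) s * e \<epsilon> j
          * free_divpow (v_at D i) (e \<epsilon> i) s'
      | \<epsilon> i j. i \<in> index D \<and> j \<in> index D \<and> i \<noteq> j}"

section \<open>The algebra \<open>U\<close>\<close>

datatype ('i, 'y) ugen = UGenE sign 'i | UGenK 'y

definition U_gens :: "('i, 'x, 'y) root_datum \<Rightarrow> ('i, 'y) ugen set" where
  "U_gens D = {UGenE \<epsilon> i | \<epsilon> i. i \<in> index D} \<union> range UGenK"

definition U_relators ::
    "('i, 'x::ab_group_add, 'y::ab_group_add) root_datum \<Rightarrow> ('i, 'y) ugen free_alg set" where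
  "U_relators D = (let E = (\<lambda>\<epsilon> i. gen (UGenE \<epsilon> i)); K = (\<lambda>h. gen (UGenK h)) in
     {K h * K h' - K (h + h') | h h'. True}
     \<union> {K 0 - 1}
     \<union> {K h * E \<epsilon> i - scal (vv powi signed \<epsilon> (pair D h (root D i))) * E \<epsilon> i * K h
         | h \<epsilon> i. i \<in> index D}
     \<union> {E Plus i * E Minus j - E Minus j * E Plus i
          - (if i = j then
               scal (inverse (v_at D i - inverse (v_at D i)))
                 * (K (zscale (d_at D i) (coroot D i)) - K (- zscale (d_at D i) (coroot D i)))
             else 0)
         | i j. i \<in> index D \<and> j \<in> index D}
     \<union> serre_relators D E)"

definition QU ::
    "('i, 'x::ab_group_add, 'y::ab_group_add) root_datum
      \<Rightarrow> (qv, ('i, 'y) ugen free_alg set) module" where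
  "QU D = presented_algebra (U_gens D) (U_relators D)"

definition U_E ::
    "('i, 'x::ab_group_add, 'y::ab_group_add) root_datum
      \<Rightarrow> sign \<Rightarrow> 'i \<Rightarrow> ('i, 'y) ugen free_alg set" where
  "U_E D \<epsilon> i = pclass (U_gens D) (U_relators D) (gen (UGenE \<epsilon> i))"

definition U_K ::
    "('i, 'x::ab_group_add, 'y::ab_group_add) root_datum
      \<Rightarrow> 'y \<Rightarrow> ('i, 'y) ugen free_alg set" where
  "U_K D h = pclass (U_gens D) (U_relators D) (gen (UGenK h))"

section \<open>The algebras \<open>S(\<pi>)\<close>\<close>

datatype ('i, 'x) sgen = SGenE sign 'i | SGenId 'x

definition S_gens :: "('i, 'x::ab_group_add, 'y) root_datum \<Rightarrow> 'x set \<Rightarrow> ('i, 'x) sgen set" where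
  "S_gens D \<pi> = {SGenE \<epsilon> i | \<epsilon> i. i \<in> index D} \<union> SGenId ` weyl_orbit D \<pi>"

text \<open>
  The convention \<open>1\<^sub>\<nu> = 0\<close> for \<open>\<nu>\<close> outside \<open>W\<pi>\<close> is built into \<open>idem\<close>; accordingly sums over
  all \<open>\<nu> \<in> X\<close> are sums over \<open>W\<pi>\<close>, which is finite for a finite \<open>\<pi>\<close>.
\<close>

definition S_relators ::
    "('i, 'x::ab_group_add, 'y) root_datum \<Rightarrow> 'x set \<Rightarrow> ('i, 'x) sgen free_alg set" where
  "S_relators D \<pi> = (let E = (\<lambda>\<epsilon> i. gen (SGenE \<epsilon> i));
       idem = (\<lambda>\<nu>. if \<nu> \<in> weyl_orbit D \<pi> then gen (SGenId \<nu>) else 0) in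
     {idem \<nu> * idem \<nu>' - (if \<nu> = \<nu>' then idem \<nu> else 0) | \<nu> \<nu>'. True}
     \<union> {(\<Sum>\<nu>\<in>weyl_orbit D \<pi>. idem \<nu>) - 1}
     \<union> {E \<epsilon> i * idem \<nu> - idem (\<nu> + signed \<epsilon> (root D i)) * E \<epsilon> i | \<epsilon> i \<nu>. i \<in> index D}
     \<union> {E Plus i * E Minus j - E Minus j * E Plus i
          - (if i = j then
               (\<Sum>\<nu>\<in>weyl_orbit D \<pi>.
                  scal (qint (v_at D i) (pair D (coroot D i) \<nu>)) * idem \<nu>)
             else 0)
         | i j. i \<in> index D \<and> j \<in> index D}
     \<union> serre_relators D E)"

definition QS ::
    "('i, 'x::ab_group_add, 'y) root_datum \<Rightarrow> 'x set
      \<Rightarrow> (qv, ('i, 'x) sgen free_alg set) module" where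
  "QS D \<pi> = presented_algebra (S_gens D \<pi>) (S_relators D \<pi>)"

definition S_E ::
    "('i, 'x::ab_group_add, 'y) root_datum \<Rightarrow> 'x set
      \<Rightarrow> sign \<Rightarrow> 'i \<Rightarrow> ('i, 'x) sgen free_alg set" where
  "S_E D \<pi> \<epsilon> i = pclass (S_gens D \<pi>) (S_relators D \<pi>) (gen (SGenE \<epsilon> i))"

definition S_id ::
    "('i, 'x::ab_group_add, 'y) root_datum \<Rightarrow> 'x set
      \<Rightarrow> 'x \<Rightarrow> ('i, 'x) sgen free_alg set" where
  "S_id D \<pi> \<nu> =
     (if \<nu> \<in> weyl_orbit D \<pi>
      then pclass (S_gens D \<pi>) (S_relators D \<pi>) (gen (SGenId \<nu>))
      else \<zero>\<^bsub>QS D \<pi>\<^esub>)"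

definition S_K ::
    "('i, 'x::ab_group_add, 'y) root_datum \<Rightarrow> 'x set
      \<Rightarrow> 'y \<Rightarrow> ('i, 'x) sgen free_alg set" where
  "S_K D \<pi> h = (\<Oplus>\<^bsub>QS D \<pi>\<^esub>\<nu>\<in>weyl_orbit D \<pi>.
     (vv powi pair D h \<nu>) \<odot>\<^bsub>QS D \<pi>\<^esub> S_id D \<pi> \<nu>)"

text \<open>\<open>S_map D \<pi> \<pi>'\<close> is the map \<open>f\<^sub>\<pi>\<^sub>,\<^sub>\<pi>\<^sub>'\<close> from \<open>S(\<pi>')\<close> to \<open>S(\<pi>)\<close>, for \<open>\<pi> \<subseteq> \<pi>'\<close>.\<close>

definition S_map ::
    "('i, 'x::ab_group_add, 'y) root_datum \<Rightarrow> 'x set \<Rightarrow> 'x set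
      \<Rightarrow> ('i, 'x) sgen free_alg set \<Rightarrow> ('i, 'x) sgen free_alg set" where
  "S_map D \<pi> \<pi>' = presented_hom (S_gens D \<pi>') (S_relators D \<pi>') (QS D \<pi>)
     (case_sgen (S_E D \<pi>) (S_id D \<pi>))"

definition U_to_S ::
    "('i, 'x::ab_group_add, 'y::ab_group_add) root_datum \<Rightarrow> 'x set
      \<Rightarrow> ('i, 'y) ugen free_alg set \<Rightarrow> ('i, 'x) sgen free_alg set" where
  "U_to_S D \<pi> = presented_hom (U_gens D) (U_relators D) (QS D \<pi>)
     (case_ugen (S_E D \<pi>) (S_K D \<pi>))"

section \<open>The inverse limit\<close>

type_synonym ('i, 'x) hat = "'x set \<Rightarrow> ('i, 'x) sgen free_alg set"

definition Uhat :: "('i, 'x::ab_group_add, 'y) root_datum \<Rightarrow> (qv, ('i, 'x) hat) module" where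
  "Uhat D =
     \<lparr>carrier = {a \<in> (\<Pi>\<^sub>E \<pi>\<in>finite_saturated D. carrier (QS D \<pi>)).
        \<forall>\<pi>\<in>finite_saturated D. \<forall>\<pi>'\<in>finite_saturated D.
          \<pi> \<subseteq> \<pi>' \<longrightarrow> a \<pi> = S_map D \<pi> \<pi>' (a \<pi>')},
      mult = (\<lambda>a b. \<lambda>\<pi>\<in>finite_saturated D. a \<pi> \<otimes>\<^bsub>QS D \<pi>\<^esub> b \<pi>),
      one = (\<lambda>\<pi>\<in>finite_saturated D. \<one>\<^bsub>QS D \<pi>\<^esub>),
      zero = (\<lambda>\<pi>\<in>finite_saturated D. \<zero>\<^bsub>QS D \<pi>\<^esub>),
      add = (\<lambda>a b. \<lambda>\<pi>\<in>finite_saturated D. a \<pi> \<oplus>\<^bsub>QS D \<pi>\<^esub> b \<pi>),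
      smult = (\<lambda>c a. \<lambda>\<pi>\<in>finite_saturated D. c \<odot>\<^bsub>QS D \<pi>\<^esub> a \<pi>)\<rparr>"

definition phat :: "'x set \<Rightarrow> ('i, 'x) hat \<Rightarrow> ('i, 'x) sgen free_alg set" where
  "phat \<pi> a = a \<pi>"

definition Ehat ::
    "('i, 'x::ab_group_add, 'y) root_datum \<Rightarrow> sign \<Rightarrow> 'i \<Rightarrow> ('i, 'x) hat" where
  "Ehat D \<epsilon> i = (\<lambda>\<pi>\<in>finite_saturated D. S_E D \<pi> \<epsilon> i)"

definition Khat :: "('i, 'x::ab_group_add, 'y) root_datum \<Rightarrow> 'y \<Rightarrow> ('i, 'x) hat" where
  "Khat D h = (\<lambda>\<pi>\<in>finite_saturated D. S_K D \<pi> h)"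

text \<open>The defining property of \<open>\<theta>\<close>; functions are taken to be undefined outside the carrier.\<close>

definition is_theta ::
    "('i, 'x::ab_group_add, 'y::ab_group_add) root_datum
      \<Rightarrow> (('i, 'y) ugen free_alg set \<Rightarrow> ('i, 'x) hat) \<Rightarrow> bool" where
  "is_theta D \<theta> \<longleftrightarrow> \<theta> \<in> extensional (carrier (QU D)) \<and> \<theta> \<in> alg_hom UNIV (QU D) (Uhat D)
     \<and> (\<forall>\<pi>\<in>finite_saturated D. \<forall>u\<in>carrier (QU D). phat \<pi> (\<theta> u) = U_to_S D \<pi> u)"

section \<open>Integral forms\<close>

definition AU ::
    "('i, 'x::ab_group_add, 'y::ab_group_add) root_datum
      \<Rightarrow> (qv, ('i, 'y) ugen free_alg set) module" where
  "AU D = (QU D)\<lparr>carrier := subalgebra_gen laurent (QU D)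
     ({divpow (QU D) (v_at D i) (U_E D \<epsilon> i) m | \<epsilon> i m. i \<in> index D} \<union> range (U_K D))\<rparr>"

definition AS ::
    "('i, 'x::ab_group_add, 'y) root_datum \<Rightarrow> 'x set
      \<Rightarrow> (qv, ('i, 'x) sgen free_alg set) module" where
  "AS D \<pi> = (QS D \<pi>)\<lparr>carrier := subalgebra_gen laurent (QS D \<pi>)
     ({divpow (QS D \<pi>) (v_at D i) (S_E D \<pi> \<epsilon> i) m | \<epsilon> i m. i \<in> index D}
      \<union> S_id D \<pi> ` weyl_orbit D \<pi>)\<rparr>"

definition AUhat :: "('i, 'x::ab_group_add, 'y) root_datum \<Rightarrow> (qv, ('i, 'x) hat) module" where
  "AUhat D = (Uhat D)\<lparr>carrier :=
     {a \<in> carrier (Uhat D). \<forall>\<pi>\<in>finite_saturated D. a \<pi> \<in> carrier (AS D \<pi>)}\<rparr>"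

definition AUhat_sub :: "('i, 'x::ab_group_add, 'y) root_datum \<Rightarrow> (qv, ('i, 'x) hat) module" where
  "AUhat_sub D = (AUhat D)\<lparr>carrier := subalgebra_gen laurent (AUhat D)
     ({divpow (Uhat D) (v_at D i) (Ehat D \<epsilon> i) m | \<epsilon> i m. i \<in> index D} \<union> range (Khat D))\<rparr>"

end

theory Submission
  imports Defs
begin

text \<open>
  The point is that an element of \<open>U\<close> killed by all maps to the algebras \<open>S(\<pi>)\<close> vanishes. Such an
  element acts as zero on the integrable quotient of every Verma module with dominant highest weight
  \<open>\<nu>\<close>: the weights of this quotient lie in Weyl group orbits of dominant weights below \<open>\<nu>\<close>, so it is
  a module over \<open>S(\<pi>)\<close> for the finite saturated set \<open>\<pi>\<close> of these weights. Verma modules are realised on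
  the free algebra in the \<open>F\<^sub>i\<close>, which makes the highest weight a free parameter.

  Write the element in triangular form, with \<open>E\<close>-parts taken from a basis of \<open>U\<^sup>+\<close>, and let it act on
  words in the \<open>F\<^sub>i\<close> that the shortest of these \<open>E\<close>-parts carry to the highest weight vector. For highest
  weights \<open>N \<xi>\<close> with \<open>\<xi>\<close> regular dominant and generic, the result is a Laurent polynomial in \<open>v\<^sup>N\<close>, whose leading
  coefficient is a value of the pairing of \<open>U\<^sup>+\<close> with \<open>U\<^sup>-\<close>. So everything rests on the non-degeneracy of that
  pairing, that is, on the fact that an element of \<open>U\<^sup>-\<close> of non-zero weight \<open>-\<nu>\<close> killed by all skew derivations
  is zero. By positive definiteness some \<open>h\<^sub>i\<close> pairs positively with \<open>\<nu>\<close>; in the quotient of the Verma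
  module of highest weight \<open>0\<close> on which \<open>F\<^sub>i\<close> is locally nilpotent, the element gives a vector of negative
  \<open>h\<^sub>i\<close>-weight killed by \<open>E\<^sub>i\<close>, hence zero, so it lies in \<open>U\<^sup>-F\<^sub>i\<close>, on which the skew derivation \<open>r\<^sub>i\<close> is injective.
\<close>

section \<open>Quantum numbers\<close>

text \<open>Two obstacles shape the argument. An identity found in an integrable quotient has to be
  lifted back to U^-, although the size of that quotient is not known: the vectors divided out
  beyond the Serre relations end in F_i to the power N \<langle>h_i, \<xi>\<rangle> + 1, so once N
  is large they are longer than the finitely many F-parts in play, and truncation by word length
  removes them. Next, summands with different K_h must be told apart: \<xi> avoids the hyperplanes
  on which two of the occurring h agree, so they carry different powers of v^N. A leading
  coefficient exists because E_i acts on the free algebra as (v_i^{\<lambda>_i} r -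
  v_i^{-\<lambda>_i} r') / (v_i - v_i^{-1}) with two skew derivations independent of \<lambda>; a
  product of E_i's is therefore led by a product of r's, up to a scalar fixed by the multidegree.
  The non-degeneracy step assumes vanishing for the operators r only, while being killed by E_i
  involves r' as well; the q-commutation of r and r' supplies this by induction on the
  degree.\<close>

definition not_root_of_unity :: "qv \<Rightarrow> bool" where
  "not_root_of_unity q \<longleftrightarrow> q \<noteq> 0 \<and> (\<forall>n::int. n \<noteq> 0 \<longrightarrow> q powi n \<noteq> 1)"

lemma vv_power: "vv ^ n = Fract (Polynomial.monom 1 n) 1"
proof (induction n)
  case (Suc n)
  then show ?case
    by (simp add: vv_def monom_Suc One_fract_def)
qed (simp add: One_fract_def)

lemma vv_nz: "vv \<noteq> 0"
  by (simp add: vv_def Zero_fract_def eq_fract)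

lemma not_root_of_unity_vv: "not_root_of_unity vv"
proof -
  have pos: "vv ^ n \<noteq> 1" if "n > 0" for n
    using that by (auto simp: vv_power One_fract_def eq_fract monom_eq_1_iff)
  have "vv powi n \<noteq> 1" if "n \<noteq> 0" for n
  proof (cases "n > 0")
    case True
    then show ?thesis using pos[of "nat n"] by (simp add: power_int_def)
  next
    case False
    then show ?thesis using pos[of "nat (-n)"] that by (simp add: power_int_def field_simps inverse_eq_1_iff)
  qed
  then show ?thesis using vv_nz by (simp add: not_root_of_unity_def)
qed

lemma not_root_of_unity_powi: "not_root_of_unity q \<Longrightarrow> d \<noteq> 0 \<Longrightarrow> not_root_of_unity (q powi d)"
  by (auto simp: not_root_of_unity_def simp flip: power_int_mult)

lemma not_root_of_unity_inverse: "not_root_of_unity q \<Longrightarrow> not_root_of_unity (inverse q)"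
  using not_root_of_unity_powi[of q "-1"] by (simp add: power_int_minus)

lemma not_root_of_unityD: "not_root_of_unity q \<Longrightarrow> q \<noteq> 0" "not_root_of_unity q \<Longrightarrow> n \<noteq> 0 \<Longrightarrow> q powi n \<noteq> 1"
  by (auto simp: not_root_of_unity_def)

lemma not_root_of_unity_inj:
  assumes "not_root_of_unity q" "q powi m = q powi n" shows "m = n"
proof (rule ccontr)
  assume "m \<noteq> n"
  moreover have "q powi (m - n) = 1"
    using assms not_root_of_unityD(1)[OF assms(1)] by (simp add: power_int_diff)
  ultimately show False using not_root_of_unityD(2)[OF assms(1), of "m - n"] by simp
qed

lemma not_root_of_unity_diff_nz:
  assumes "not_root_of_unity q" shows "q - inverse q \<noteq> 0"
proof
  assume "q - inverse q = 0"
  then have "q powi 1 = q powi (-1)" by (simp add: power_int_minus)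
  then show False using not_root_of_unity_inj[OF assms] by fastforce
qed

lemma qint_0 [simp]: "qint q 0 = 0"
  by (simp add: qint_def)

lemma qint_1: "not_root_of_unity q \<Longrightarrow> qint q 1 = 1"
  using not_root_of_unity_diff_nz[of q] by (simp add: qint_def power_int_minus)

lemma qint_minus: "qint q (- n) = - qint q n"
  by (simp add: qint_def minus_divide_left)

lemma qint_nz:
  assumes "not_root_of_unity q" "n \<noteq> 0" shows "qint q n \<noteq> 0"
proof
  assume "qint q n = 0"
  then have "q powi n = q powi (-n)"
    using not_root_of_unity_diff_nz[OF assms(1)] by (simp add: qint_def)
  then show False using not_root_of_unity_inj[OF assms(1)] assms(2) by fastforce
qed

lemma qint_alt: "qint q n = (q powi n - inverse (q powi n)) / (q - inverse q)"
  by (simp add: qint_def power_int_minus)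

lemma qint_inverse: "qint (inverse q) n = qint q n"
  unfolding qint_alt by (simp add: power_int_inverse) (metis minus_diff_eq minus_divide_divide)

lemma qint_add:
  assumes "not_root_of_unity q"
  shows "qint q (m + n) = q powi n * qint q m + q powi (- m) * qint q n"
proof -
  have "q \<noteq> 0" by (rule not_root_of_unityD(1)[OF assms])
  then show ?thesis
    by (simp add: qint_alt power_int_add power_int_minus add_divide_distrib[symmetric] algebra_simps)
qed

text \<open>The bookkeeping of the quantum sl_2 relations: when the commutator [n - 2s] on F^s x is
  added, the coefficient [s][n - s + 1] collected so far turns into [s + 1][n - s].\<close>

lemma qint_step:
  assumes "not_root_of_unity q"
  shows "qint q (s + 1) * qint q (n - s) = qint q s * qint q (n - s + 1) + qint q (n - 2 * s)"
proof -
  have q: "q \<noteq> 0" "q - inverse q \<noteq> 0" using not_root_of_unityD(1)[OF assms] not_root_of_unity_diff_nz[OF assms] by auto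
  define x where "x = q powi s"
  define y where "y = q powi (n - s)"
  have xy: "x \<noteq> 0" "y \<noteq> 0" using q by (auto simp: x_def y_def)
  have n2: "q powi (n - 2 * s) = y * inverse x"
  proof -
    have e: "n - 2 * s = (n - s) + (- s)" by simp
    show ?thesis unfolding e power_int_add[OF disjI1[OF q(1)]] by (simp add: power_int_minus x_def y_def)
  qed
  have *: "qint q (s + 1) = (x * q - inverse x * inverse q) / (q - inverse q)"
    "qint q (n - s) = (y - inverse y) / (q - inverse q)"
    "qint q s = (x - inverse x) / (q - inverse q)"
    "qint q (n - s + 1) = (y * q - inverse y * inverse q) / (q - inverse q)"
    "qint q (n - 2 * s) = (y * inverse x - inverse y * x) / (q - inverse q)"
    using q n2 unfolding qint_alt
    by (simp_all add: x_def[symmetric] y_def[symmetric] power_int_add[of q _ 1] mult.commute)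
  have "(x * q - inverse x * inverse q) * (y - inverse y) =
     (x - inverse x) * (y * q - inverse y * inverse q) + (y * inverse x - inverse y * x) * (q - inverse q)"
    using xy q by (simp add: algebra_simps)
  moreover have "A * B = C * E + F * d \<Longrightarrow> A / d * (B / d) = C / d * (E / d) + F / d" if "d \<noteq> 0" for A B C E F d :: qv
    using that by (simp add: divide_simps)
  ultimately show ?thesis unfolding * using q(2) by blast
qed

lemma qfact_0 [simp]: "qfact q 0 = 1"
  by (simp add: qfact_def)

lemma qfact_Suc: "qfact q (Suc n) = qint q (int (Suc n)) * qfact q n"
  by (simp add: qfact_def prod.atLeast_Suc_atMost mult.commute)

lemma qfact_nz: "not_root_of_unity q \<Longrightarrow> qfact q n \<noteq> 0"
  by (induction n) (auto simp: qfact_Suc qint_nz simp del: of_nat_Suc)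

lemma qfact_inverse: "qfact (inverse q) n = qfact q n"
  by (induction n) (simp_all add: qfact_Suc qint_inverse)

section \<open>Vanishing of alternating Gauss binomial sums\<close>

definition gauss_sum :: "qv \<Rightarrow> nat \<Rightarrow> qv" where
  "gauss_sum q m = (\<Sum>t\<le>m. (-1) ^ t * q powi (- (int t * (int m - 1))) * inverse (qfact q (m - t)) * inverse (qfact q t))"

text \<open>Splitting \<open>[m] = q\<^sup>t [m - t] + q\<^sup>t\<^sup>-\<^sup>m [t]\<close> in each summand relates the sums for \<open>m\<close> and \<open>m - 1\<close>.\<close>

lemma gauss_sum_Suc:
  assumes "not_root_of_unity q"
  shows "qint q (int (Suc m)) * gauss_sum q (Suc m) = (1 - q powi (- 2 * int m)) * gauss_sum q m"
proof -
  let ?f = "qfact q"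
  have q: "q \<noteq> 0" using assms by (rule not_root_of_unityD)
  note nz = qfact_nz[OF assms]
  define A where "A t = (-1) ^ t * q powi (- (int t * int m)) * q powi (int t) * qint q (int (Suc m) - int t)
    * inverse (?f (Suc m - t)) * inverse (?f t)" for t
  define B where "B t = (-1) ^ t * q powi (- (int t * int m)) * q powi (int t - int (Suc m)) * qint q (int t)
    * inverse (?f (Suc m - t)) * inverse (?f t)" for t
  have spl: "qint q (int (Suc m)) = q powi (int t) * qint q (int (Suc m) - int t)
      + q powi (int t - int (Suc m)) * qint q (int t)" for t
    using qint_add[OF assms, of "int (Suc m) - int t" "int t"] by simp
  have "qint q (int (Suc m)) * gauss_sum q (Suc m) = (\<Sum>t\<le>Suc m. A t + B t)"
    unfolding gauss_sum_def sum_distrib_left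
  proof (intro sum.cong refl)
    fix t
    show "qint q (int (Suc m)) * ((-1) ^ t * q powi (- (int t * (int (Suc m) - 1))) * inverse (?f (Suc m - t)) * inverse (?f t))
      = A t + B t"
      unfolding spl[of t] A_def B_def by (simp add: algebra_simps)
  qed
  also have "\<dots> = (\<Sum>t\<le>Suc m. A t) + (\<Sum>t\<le>Suc m. B t)"
    by (simp add: sum.distrib)
  also have "(\<Sum>t\<le>Suc m. A t) = (\<Sum>t\<le>m. A t)"
    by (simp add: A_def)
  also have "\<dots> = gauss_sum q m"
    unfolding gauss_sum_def
  proof (intro sum.cong refl)
    fix t assume t: "t \<in> {..m}"
    then have e: "Suc m - t = Suc (m - t)" and e2: "int (Suc m) - int t = int (Suc (m - t))" by auto
    have nzq: "qint q (int (Suc (m - t))) \<noteq> 0" by (rule qint_nz[OF assms]) simp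
    have "q powi (- (int t * int m)) * q powi (int t) = q powi (- (int t * (int m - 1)))"
      unfolding power_int_add[OF disjI1[OF q], symmetric] by (simp add: algebra_simps)
    then show "A t = (-1) ^ t * q powi (- (int t * (int m - 1))) * inverse (?f (m - t)) * inverse (?f t)"
      unfolding A_def e e2 qfact_Suc using nzq nz[of "m - t"] nz[of t] by (simp add: field_simps del: of_nat_Suc)
  qed
  also have "(\<Sum>t\<le>Suc m. B t) = (\<Sum>t\<le>m. B (Suc t))"
    unfolding sum.atMost_Suc_shift by (simp add: B_def)
  also have "\<dots> = - (q powi (- 2 * int m)) * gauss_sum q m"
    unfolding gauss_sum_def sum_distrib_left
  proof (intro sum.cong refl)
    fix t assume t: "t \<in> {..m}"
    have nzq: "qint q (int (Suc t)) \<noteq> 0" by (rule qint_nz[OF assms]) simp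
    have "q powi (- (int (Suc t) * int m)) * q powi (int (Suc t) - int (Suc m))
        = q powi (- 2 * int m) * q powi (- (int t * (int m - 1)))"
      unfolding power_int_add[OF disjI1[OF q], symmetric] by (simp add: algebra_simps)
    then show "B (Suc t) = - (q powi (- 2 * int m)) *
        ((-1) ^ t * q powi (- (int t * (int m - 1))) * inverse (?f (m - t)) * inverse (?f t))"
      unfolding B_def qfact_Suc using nzq nz[of "m - t"] nz[of t] by (simp add: field_simps del: of_nat_Suc)
  qed
  finally show ?thesis by (simp add: algebra_simps)
qed

text \<open>Times [m]^!, the sum is the product of 1 - q^(-2j) over 0 \<le> j < m by the q-binomial
  theorem: the recursion contributes one factor per step, and the factor at j = 0 vanishes.\<close>

lemma gauss_sum_0:
  assumes "not_root_of_unity q" "m \<ge> 1" shows "gauss_sum q m = 0"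
proof -
  have "gauss_sum q (Suc m) = 0" for m
  proof (induction m)
    case 0
    then show ?case using gauss_sum_Suc[OF assms(1), of 0] qint_nz[OF assms(1), of 1] by simp
  next
    case (Suc m)
    then show ?case
      using gauss_sum_Suc[OF assms(1), of "Suc m"] qint_nz[OF assms(1), of "int (Suc (Suc m))"] by auto
  qed
  then show ?thesis using assms(2) by (metis Suc_le_D One_nat_def)
qed

text \<open>The case \<sigma> = m - 1 is the case \<sigma> = 1 - m for q^(-1), because quantum
  factorials are invariant under inversion of q.\<close>

lemma gauss_sum_shift:
  assumes "not_root_of_unity q" "m \<ge> 1" and \<sigma>: "\<sigma> = 1 - int m \<or> \<sigma> = int m - 1"
  shows "(\<Sum>t\<le>m. (-1) ^ t * q powi (\<sigma> * int t) * inverse (qfact q (m - t)) * inverse (qfact q t)) = 0"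
proof -
  have 1: "(\<Sum>t\<le>m. (-1) ^ t * p powi ((1 - int m) * int t) * inverse (qfact p (m - t)) * inverse (qfact p t)) = 0"
    if "not_root_of_unity p" for p
  proof -
    have "- (int t * (int m - 1)) = (1 - int m) * int t" for t by (simp add: algebra_simps)
    then show ?thesis using gauss_sum_0[OF that assms(2)] by (simp add: gauss_sum_def)
  qed
  show ?thesis
  proof (cases "\<sigma> = 1 - int m")
    case True
    then show ?thesis using 1[OF assms(1)] by simp
  next
    case False
    then have "\<sigma> = - (1 - int m)" using \<sigma> by auto
    then have s: "\<sigma> * int t = - ((1 - int m) * int t)" for t by (simp only: mult_minus_left)
    show ?thesis
      using 1[OF not_root_of_unity_inverse[OF assms(1)]]
      by (simp add: s power_int_inverse power_int_minus qfact_inverse)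
  qed
qed

text \<open>The quantum integer is a difference of two exponentials in t, and by the assumption on
  p^a these are q^(\<sigma> t) and q^(-\<sigma> t) with \<sigma> = \<epsilon> (1 - m), the exponents
  covered by \<open>gauss_sum_shift\<close>. The assumption models v_j^(a_ji) = v_i^(a_ij), where 1
  - m = a_ij.\<close>

lemma gauss_sum_qint:
  assumes "not_root_of_unity q" "not_root_of_unity p" "m \<ge> 1" and p: "p powi a = q powi (1 - int m)"
    and \<epsilon>: "\<epsilon> = 1 \<or> \<epsilon> = (-1::int)"
  shows "(\<Sum>t\<le>m. (-1) ^ t * qint p (n + \<epsilon> * a * int t) * inverse (qfact q (m - t)) * inverse (qfact q t)) = 0"
proof -
  have p0: "p \<noteq> 0" by (rule not_root_of_unityD(1)[OF assms(2)])
  define S where "S \<sigma> = (\<Sum>t\<le>m. (-1) ^ t * q powi (\<sigma> * int t) * inverse (qfact q (m - t)) * inverse (qfact q t))" for \<sigma>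
  define \<sigma> where "\<sigma> = \<epsilon> * (1 - int m)"
  have S0: "S \<sigma> = 0" "S (-\<sigma>) = 0"
    unfolding S_def by (rule gauss_sum_shift[OF assms(1,3)]; use \<epsilon> in \<open>auto simp: \<sigma>_def\<close>)+
  have pa: "p powi (\<epsilon> * a * int t) = q powi (\<sigma> * int t)" for t
  proof -
    have "p powi (a * (\<epsilon> * int t)) = q powi ((1 - int m) * (\<epsilon> * int t))"
      unfolding power_int_mult p ..
    then show ?thesis by (simp add: \<sigma>_def mult.assoc mult.left_commute)
  qed
  have pb: "p powi (- (\<epsilon> * a * int t)) = q powi ((- \<sigma>) * int t)" for t
    using pa[of t] by (simp add: power_int_minus)
  have "p powi (n + \<epsilon> * a * int t) = p powi n * q powi (\<sigma> * int t)" for t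
    using p0 by (simp add: power_int_add pa)
  moreover have "p powi (- (n + \<epsilon> * a * int t)) = p powi (- n) * q powi ((- \<sigma>) * int t)" for t
    using p0 pb[of t] by (simp add: power_int_add power_int_diff field_simps power_int_minus)
  ultimately have "qint p (n + \<epsilon> * a * int t) = (p powi n * q powi (\<sigma> * int t) - p powi (- n) * q powi ((- \<sigma>) * int t)) / (p - inverse p)" for t
    unfolding qint_def by (simp del: mult_minus_left)
  then have "(\<Sum>t\<le>m. (-1) ^ t * qint p (n + \<epsilon> * a * int t) * inverse (qfact q (m - t)) * inverse (qfact q t))
    = (p powi n / (p - inverse p)) * S \<sigma> - (p powi (- n) / (p - inverse p)) * S (- \<sigma>)"
    unfolding S_def sum_distrib_left sum_subtractf[symmetric]
    by (intro sum.cong refl) (simp only: diff_divide_distrib right_diff_distrib left_diff_distrib times_divide_eq_left times_divide_eq_right mult_ac)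
  then show ?thesis by (simp add: S0)
qed

section \<open>Free algebras\<close>

abbreviation smul :: "qv \<Rightarrow> 'g free_alg \<Rightarrow> 'g free_alg" (infixr \<open>*\<^sub>q\<close> 75) where
  "c *\<^sub>q a \<equiv> scal c * a"

definition wd :: "'g list \<Rightarrow> 'g free_alg" where
  "wd l = Poly_Mapping.single (Word l) 1"

lemma wd_Nil [simp]: "wd [] = 1"
  by (simp add: wd_def flip: zero_word_def)

lemma wd_append: "wd (l @ l') = wd l * wd l'"
  by (simp add: wd_def mult_single plus_word_def)

lemma wd_Cons: "wd (g # l) = gen g * wd l"
  using wd_append[of "[g]" l] by (simp add: wd_def gen_def)

lemma wd_single: "wd [g] = gen g"
  by (simp add: wd_def gen_def)

lemma lookup_scal: "Poly_Mapping.lookup (c *\<^sub>q a) w = c * Poly_Mapping.lookup a w"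
  unfolding scal_def mult_map_scale_conv_mult[symmetric]
  by (simp add: Poly_Mapping.map.rep_eq when_def)

lemma scal_0 [simp]: "scal 0 = 0" and scal_1 [simp]: "scal 1 = 1"
  by (simp_all add: scal_def)

lemma scal_add: "scal (c + d) = scal c + scal d"
  by (simp add: scal_def single_add)

lemma scal_uminus: "scal (- c) = - scal c"
  by (simp add: scal_def single_uminus)

lemma scal_diff: "scal (c - d) = scal c - scal d"
  by (simp add: scal_def single_diff)

lemma scal_mult: "scal (c * d) = scal c * scal d"
  by (simp add: scal_def mult_single)

lemma scal_mult_assoc: "c *\<^sub>q d *\<^sub>q a = (c * d) *\<^sub>q a"
  by (simp add: scal_mult mult.assoc)

interpretation fa: vector_space "smul :: qv \<Rightarrow> 'g free_alg \<Rightarrow> 'g free_alg"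
  by unfold_locales (simp_all add: scal_add scal_mult algebra_simps)

lemma free_alg_expand:
  "a = (\<Sum>w\<in>Poly_Mapping.keys a. Poly_Mapping.lookup a w *\<^sub>q wd (letters w))"
proof (rule poly_mapping_eqI)
  fix v :: "'a word"
  have "Poly_Mapping.lookup (\<Sum>w\<in>Poly_Mapping.keys a. Poly_Mapping.lookup a w *\<^sub>q wd (letters w)) v
    = (\<Sum>w\<in>Poly_Mapping.keys a. if v = w then Poly_Mapping.lookup a w else 0)"
    unfolding lookup_sum by (intro sum.cong) (auto simp: lookup_scal wd_def lookup_single when_def)
  then show "Poly_Mapping.lookup a v =
    Poly_Mapping.lookup (\<Sum>w\<in>Poly_Mapping.keys a. Poly_Mapping.lookup a w *\<^sub>q wd (letters w)) v"
    by (simp add: in_keys_iff)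
qed

lemma span_wd: "fa.span (range wd) = (UNIV :: 'g free_alg set)"
proof -
  have "a \<in> fa.span (range wd)" for a :: "'g free_alg"
    by (subst free_alg_expand[of a]) (intro fa.span_sum fa.span_scale fa.span_base; simp)
  then show ?thesis by blast
qed

lemma scal_commute: "scal c * a = a * scal c"
proof -
  have w: "scal c * wd l = wd l * scal c" for l :: "'a list"
    by (simp add: scal_def wd_def mult_single)
  have *: "scal c * (d *\<^sub>q wd l) = (d *\<^sub>q wd l) * scal c" for d and l :: "'a list"
    by (simp only: mult.assoc w[symmetric]) (simp only: scal_mult_assoc mult.commute)
  show ?thesis
    by (subst (1 2) free_alg_expand[of a]) (simp only: sum_distrib_left sum_distrib_right *)
qed

lemma mult_scal_right: "a * (c *\<^sub>q b) = c *\<^sub>q (a * b)"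
  by (metis mult.assoc scal_commute)

lemma mult_scal_left: "(c *\<^sub>q a) * b = c *\<^sub>q (a * b)"
  by (simp add: mult.assoc)

section \<open>Linear maps between free algebras and their extension from words\<close>

definition lin :: "('g free_alg \<Rightarrow> 'h free_alg) \<Rightarrow> bool" where
  "lin f \<longleftrightarrow> (\<forall>x y. f (x + y) = f x + f y) \<and> (\<forall>c x. f (c *\<^sub>q x) = c *\<^sub>q f x)"

lemma linI: "(\<And>x y. f (x + y) = f x + f y) \<Longrightarrow> (\<And>c x. f (c *\<^sub>q x) = c *\<^sub>q f x) \<Longrightarrow> lin f"
  by (simp add: lin_def)

lemma lin_add: "lin f \<Longrightarrow> f (x + y) = f x + f y"
  and lin_scal: "lin f \<Longrightarrow> f (c *\<^sub>q x) = c *\<^sub>q f x"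
  by (simp_all add: lin_def)

lemma lin_0: "lin f \<Longrightarrow> f 0 = 0"
  using lin_scal[of f 0 0] by simp

lemma lin_minus: "lin f \<Longrightarrow> f (- x) = - f x"
  using lin_scal[of f "-1" x] by (simp add: scal_uminus)

lemma lin_diff: "lin f \<Longrightarrow> f (x - y) = f x - f y"
  using lin_add[of f x "- y"] lin_minus[of f y] by simp

lemma lin_sum: "lin f \<Longrightarrow> f (sum g A) = (\<Sum>x\<in>A. f (g x))"
  by (induction A rule: infinite_finite_induct) (simp_all add: lin_0 lin_add)

lemma lin_id: "lin (\<lambda>x. x)"
  by (simp add: lin_def)

lemma lin_zero: "lin (\<lambda>x. 0)"
  by (simp add: lin_def)

lemma lin_comp: "lin f \<Longrightarrow> lin g \<Longrightarrow> lin (\<lambda>x. f (g x))"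
  by (simp add: lin_def)

lemma lin_plus: "lin f \<Longrightarrow> lin g \<Longrightarrow> lin (\<lambda>x. f x + g x)"
  by (simp add: lin_def distrib_left)

lemma lin_minus_fun: "lin f \<Longrightarrow> lin g \<Longrightarrow> lin (\<lambda>x. f x - g x)"
  by (simp add: lin_def right_diff_distrib)

lemma lin_smul: "lin f \<Longrightarrow> lin (\<lambda>x. c *\<^sub>q f x)"
  by (simp add: lin_def distrib_left scal_mult_assoc mult.commute)

lemma lin_mult_left: "lin f \<Longrightarrow> lin (\<lambda>x. a * f x)"
  by (simp add: lin_def distrib_left mult_scal_right)

lemma lin_mult_right: "lin f \<Longrightarrow> lin (\<lambda>x. f x * a)"
  by (simp add: lin_def distrib_right mult_scal_left)

lemma lin_sum_fun: "(\<And>x. x \<in> A \<Longrightarrow> lin (f x)) \<Longrightarrow> lin (\<lambda>y. \<Sum>x\<in>A. f x y)"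
  by (simp add: lin_def sum.distrib sum_distrib_left)

lemma lin_funpow: fixes f :: "'g free_alg \<Rightarrow> 'g free_alg" shows "lin f \<Longrightarrow> lin (f ^^ n)"
proof (induction n)
  case (Suc n)
  then show ?case using lin_comp[of f "f ^^ n"] by (simp add: comp_def)
qed (simp add: lin_def)

lemma lin_into_subspace:
  assumes "lin f" "fa.subspace N" "\<And>l. f (wd l) \<in> N"
  shows "f a \<in> N"
  by (subst free_alg_expand[of a])
     (auto simp: lin_sum[OF assms(1)] lin_scal[OF assms(1)] assms(3)
       intro!: fa.subspace_sum[OF assms(2)] fa.subspace_scale[OF assms(2)])

lemma lin_eqI:
  assumes "lin f" "lin g" "\<And>l. f (wd l) = g (wd l)"
  shows "f a = g a"
  using lin_into_subspace[OF lin_minus_fun[OF assms(1,2)], of "{0}" a] assms(3)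
  by (simp add: fa.subspace_def)

lemma lin_span_subspace:
  assumes "lin f" "fa.subspace N" "a \<in> fa.span B" "\<And>x. x \<in> B \<Longrightarrow> f x \<in> N"
  shows "f a \<in> N"
  using assms(3)
proof (induction rule: fa.span_induct_alt)
  case base
  then show ?case using assms(1,2) by (simp add: lin_0 fa.subspace_0)
next
  case (step c x y)
  then show ?case
    using assms by (simp add: lin_add lin_scal fa.subspace_add fa.subspace_scale)
qed

definition lext :: "('g list \<Rightarrow> 'h free_alg) \<Rightarrow> 'g free_alg \<Rightarrow> 'h free_alg" where
  "lext f a = (\<Sum>w\<in>Poly_Mapping.keys a. Poly_Mapping.lookup a w *\<^sub>q f (letters w))"

lemma lext_superset:
  assumes "finite A" "Poly_Mapping.keys a \<subseteq> A"
  shows "lext f a = (\<Sum>w\<in>A. Poly_Mapping.lookup a w *\<^sub>q f (letters w))"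
  unfolding lext_def by (rule sum.mono_neutral_left) (use assms in \<open>auto simp: in_keys_iff\<close>)

lemma lin_lext: "lin (lext f)"
proof (rule linI)
  fix x y :: "'a free_alg" and c
  show "lext f (x + y) = lext f x + lext f y"
    using lext_superset[of "Poly_Mapping.keys x \<union> Poly_Mapping.keys y" "x + y" f]
      lext_superset[of "Poly_Mapping.keys x \<union> Poly_Mapping.keys y" x f]
      lext_superset[of "Poly_Mapping.keys x \<union> Poly_Mapping.keys y" y f] keys_add[of x y]
    by (simp add: lookup_add scal_add algebra_simps sum.distrib)
  have "Poly_Mapping.keys (c *\<^sub>q x) \<subseteq> Poly_Mapping.keys x"
    by (auto simp: in_keys_iff lookup_scal)
  then show "lext f (c *\<^sub>q x) = c *\<^sub>q lext f x"
    using lext_superset[of "Poly_Mapping.keys x" "c *\<^sub>q x" f]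
    by (simp add: lookup_scal scal_mult_assoc sum_distrib_left lext_def)
qed

lemma lext_wd [simp]: "lext f (wd l) = f l"
  by (simp add: lext_def wd_def)

section \<open>Substitution homomorphisms and modules given by operators\<close>

definition subst :: "('g \<Rightarrow> 'h free_alg) \<Rightarrow> 'g free_alg \<Rightarrow> 'h free_alg" where
  "subst val = lext (\<lambda>l. prod_list (map val l))"

lemma lin_subst: "lin (subst val)"
  by (simp add: subst_def lin_lext)

lemma subst_wd: "subst val (wd l) = prod_list (map val l)"
  by (simp add: subst_def)

lemma subst_gen [simp]: "subst val (gen g) = val g"
  using subst_wd[of val "[g]"] by (simp add: wd_single)

lemma subst_1 [simp]: "subst val 1 = 1"
  using subst_wd[of val "[]"] by simp

lemma subst_scal [simp]: "subst val (scal c) = scal c"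
  using lin_scal[OF lin_subst, of val c 1] by simp

lemma subst_mult: "subst val (a * b) = subst val a * subst val b"
proof -
  have "subst val (a * wd l') = subst val a * subst val (wd l')" for l'
    by (rule lin_eqI[OF lin_comp[OF lin_subst lin_mult_right[OF lin_id]] lin_mult_right[OF lin_subst]])
      (simp add: subst_wd flip: wd_append)
  then show ?thesis
    by (rule lin_eqI[OF lin_comp[OF lin_subst lin_mult_left[OF lin_id]] lin_mult_left[OF lin_subst]])
qed

lemma subst_power: "subst val (a ^ n) = subst val a ^ n"
  by (induction n) (simp_all add: subst_mult)

lemma subst_free_divpow: "subst val (free_divpow q x n) = free_divpow q (subst val x) n"
  by (simp add: free_divpow_def subst_mult subst_power)

text \<open>Letters act from the right end of a word, so that this is a left module structure once
  the operators are linear (\<open>act_mult\<close>).\<close>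

definition act :: "('g \<Rightarrow> 'h free_alg \<Rightarrow> 'h free_alg) \<Rightarrow> 'g free_alg \<Rightarrow> 'h free_alg \<Rightarrow> 'h free_alg" where
  "act ops a z = lext (\<lambda>l. foldr ops l z) a"

lemma lin_act_left: "lin (\<lambda>a. act ops a z)"
  by (simp add: act_def lin_lext)

lemma lin_foldr: "(\<And>g. lin (ops g)) \<Longrightarrow> lin (foldr ops l)"
  by (induction l) (auto simp: lin_def)

lemma lin_act:
  assumes "\<And>g. lin (ops g)" shows "lin (act ops a)"
  unfolding act_def lext_def
  by (intro lin_sum_fun lin_smul lin_foldr assms)

lemma act_wd: "act ops (wd l) z = foldr ops l z"
  by (simp add: act_def)

lemma act_gen [simp]: "act ops (gen g) z = ops g z"
  using act_wd[of ops "[g]"] by (simp add: wd_single)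

lemma act_1 [simp]: "act ops 1 z = z"
  using act_wd[of ops "[]"] by simp

lemma act_scal [simp]: "act ops (scal c) z = c *\<^sub>q z"
  using lin_scal[OF lin_act_left[where ops = ops and z = z], of c 1] by simp

lemma act_mult:
  assumes "\<And>g. lin (ops g)"
  shows "act ops (a * b) z = act ops a (act ops b z)"
proof -
  have "act ops (wd l * wd l') z = act ops (wd l) (act ops (wd l') z)" for l l'
    by (simp add: act_wd flip: wd_append)
  then have "act ops (a * wd l') z = act ops a (act ops (wd l') z)" for l'
    by (rule lin_eqI[OF lin_comp[OF lin_act_left lin_mult_right[OF lin_id]] lin_act_left])
  then show ?thesis
    by (rule lin_eqI[OF lin_comp[OF lin_act_left lin_mult_left[OF lin_id]] lin_comp[OF lin_act[OF assms] lin_act_left]])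
qed

lemma act_power: "(\<And>g. lin (ops g)) \<Longrightarrow> act ops (a ^ n) z = (act ops a ^^ n) z"
  by (induction n) (simp_all add: act_mult)

section \<open>Quantum Serre relations for operators\<close>

text \<open>
  The commutation computations below are used twice, with the roles of raising and lowering
  operators exchanged; \<open>W n\<close> singles out the vectors of weight \<open>n\<close>.
\<close>

definition dv :: "qv \<Rightarrow> ('g free_alg \<Rightarrow> 'g free_alg) \<Rightarrow> nat \<Rightarrow> 'g free_alg \<Rightarrow> 'g free_alg" where
  "dv q X s x = inverse (qfact q s) *\<^sub>q (X ^^ s) x"

definition serre_op ::
    "qv \<Rightarrow> nat \<Rightarrow> ('g free_alg \<Rightarrow> 'g free_alg) \<Rightarrow> ('g free_alg \<Rightarrow> 'g free_alg) \<Rightarrow> 'g free_alg \<Rightarrow> 'g free_alg" where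
  "serre_op q m X Y x = (\<Sum>t\<le>m. ((-1) ^ t) *\<^sub>q dv q X (m - t) (Y (dv q X t x)))"

lemma lin_dv: "lin X \<Longrightarrow> lin (dv q X s)"
  unfolding dv_def by (intro lin_smul lin_funpow)

lemma lin_serre_op: "lin X \<Longrightarrow> lin Y \<Longrightarrow> lin (serre_op q m X Y)"
  unfolding serre_op_def by (intro lin_sum_fun lin_smul) (rule lin_comp[OF lin_dv lin_comp[OF _ lin_dv]])

lemma dv_0 [simp]: "dv q X 0 x = x"
  by (simp add: dv_def)

lemma commute_funpow:
  assumes "\<And>x. Z (X x) = X (Z x)" shows "Z ((X ^^ s) x) = (X ^^ s) (Z x)"
  by (induction s) (simp_all add: assms)

lemma commute_dv:
  assumes "\<And>x. Z (X x) = X (Z x)" "lin Z" shows "Z (dv q X s x) = dv q X s (Z x)"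
  by (simp add: dv_def lin_scal[OF assms(2)] commute_funpow[of Z X, OF assms(1)])

lemma weight_funpow:
  assumes "\<And>n x. W n x \<Longrightarrow> W (n - b) (X x)" "W n x"
  shows "W (n - b * int s) ((X ^^ s) x)"
proof (induction s)
  case (Suc s)
  then have "W (n - b * int s - b) (X ((X ^^ s) x))" by (rule assms(1))
  then show ?case by (simp add: algebra_simps)
qed (simp add: assms(2))

lemma weight_dv:
  assumes "\<And>n x. W n x \<Longrightarrow> W (n - b) (X x)" "W n x" "\<And>n c x. W n x \<Longrightarrow> W n (c *\<^sub>q x)"
  shows "W (n - b * int s) (dv q X s x)"
  unfolding dv_def by (intro assms(3) weight_funpow[of W b X, OF assms(1)] assms(2))

text \<open>Induction on \<open>s\<close>: each further X contributes the commutator on a vector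
  whose weight has dropped by 2, and \<open>qint_step\<close> sums the contributions. With X = F and
  Z = E, or with exchanged roles and negated weights, this serves lowering and raising operators
  alike.\<close>

lemma sl2_funpow:
  assumes q: "not_root_of_unity q" and X: "lin X" and Z: "lin Z"
    and W: "\<And>n x. W n x \<Longrightarrow> W (n - 2) (X x)"
    and ZX: "\<And>n x. W n x \<Longrightarrow> Z (X x) = X (Z x) + qint q n *\<^sub>q x"
    and x: "W n x"
  shows "Z ((X ^^ Suc s) x) = (X ^^ Suc s) (Z x) + (qint q (int (Suc s)) * qint q (n - int s)) *\<^sub>q (X ^^ s) x"
proof (induction s)
  case 0
  then show ?case using ZX[OF x] qint_1[OF q] by simp
next
  case (Suc s)
  have W': "W (n - 2 * int (Suc s)) ((X ^^ Suc s) x)" by (rule weight_funpow[of W 2 X, OF W x])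
  have "Z ((X ^^ Suc (Suc s)) x) = X (Z ((X ^^ Suc s) x)) + qint q (n - 2 * int (Suc s)) *\<^sub>q (X ^^ Suc s) x"
    using ZX[OF W'] by simp
  also have "X (Z ((X ^^ Suc s) x)) = (X ^^ Suc (Suc s)) (Z x)
      + (qint q (int (Suc s)) * qint q (n - int s)) *\<^sub>q (X ^^ Suc s) x"
    unfolding Suc by (simp add: lin_add[OF X] lin_scal[OF X])
  also have "qint q (int (Suc s)) * qint q (n - int s) = qint q (int (Suc (Suc s))) * qint q (n - int (Suc s)) - qint q (n - 2 * int (Suc s))"
    using qint_step[OF q, of "int (Suc s)" n] by (simp add: algebra_simps)
  finally show ?case by (simp add: scal_diff algebra_simps)
qed

lemma sl2_dv:
  assumes q: "not_root_of_unity q" and X: "lin X" and Z: "lin Z"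
    and W: "\<And>n x. W n x \<Longrightarrow> W (n - 2) (X x)"
    and ZX: "\<And>n x. W n x \<Longrightarrow> Z (X x) = X (Z x) + qint q n *\<^sub>q x"
    and x: "W n x"
  shows "Z (dv q X s x) = dv q X s (Z x) + qint q (n - int s + 1) *\<^sub>q (if s = 0 then 0 else dv q X (s - 1) x)"
proof (cases s)
  case (Suc r)
  have nz: "qint q (int (Suc r)) \<noteq> 0" "qfact q r \<noteq> 0"
    using qint_nz[OF q] qfact_nz[OF q] by simp_all
  have fp: "Z ((X ^^ Suc r) x) = (X ^^ Suc r) (Z x) + (qint q (int (Suc r)) * qint q (n - int r)) *\<^sub>q (X ^^ r) x"
    by (rule sl2_funpow[where W = W]) fact+
  have "Z (dv q X s x) = dv q X s (Z x)
    + (inverse (qfact q s) * (qint q (int (Suc r)) * qint q (n - int r))) *\<^sub>q (X ^^ r) x"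
    unfolding dv_def Suc lin_scal[OF Z] fp
    by (simp only: distrib_left scal_mult_assoc)
  also have "inverse (qfact q s) * (qint q (int (Suc r)) * qint q (n - int r)) = qint q (n - int r) * inverse (qfact q r)"
    using nz by (simp add: Suc qfact_Suc del: of_nat_Suc)
  finally show ?thesis by (simp add: Suc dv_def scal_mult_assoc)
qed simp

text \<open>Moving Z through the summand at t leaves two extra terms, with coefficient [n - t + 1]
  from the inner and [n - t] from the outer divided power. The outer term at t and the inner term at
  t + 1 are the same operator word with opposite signs, so everything cancels; the coefficients
  match because Y changes the weight by m - 1.\<close>

lemma serre_commute_i:
  assumes q: "not_root_of_unity q" and X: "lin X" and Y: "lin Y" and Z: "lin Z"
    and W: "\<And>n x. W n x \<Longrightarrow> W (n - 2) (X x)"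
    and WY: "\<And>n x. W n x \<Longrightarrow> W (n - (1 - int m)) (Y x)"
    and Ws: "\<And>n c x. W n x \<Longrightarrow> W n (c *\<^sub>q x)"
    and ZX: "\<And>n x. W n x \<Longrightarrow> Z (X x) = X (Z x) + qint q n *\<^sub>q x"
    and ZY: "\<And>x. Z (Y x) = Y (Z x)"
    and x: "W n x" and m: "m \<ge> 1"
  shows "Z (serre_op q m X Y x) = serre_op q m X Y (Z x)"
proof -
  let ?d = "dv q X"
  let ?p = "\<lambda>s x. if s = 0 then 0 else dv q X (s - 1) x"
  note ld = lin_dv[OF X, of q]
  have sl: "Z (dv q X s x) = dv q X s (Z x) + qint q (n - int s + 1) *\<^sub>q ?p s x" if "W n x" for n x s
    by (rule sl2_dv[where W = W]) fact+
  have step: "Z (?d (m - t) (Y (?d t x))) = ?d (m - t) (Y (?d t (Z x)))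
      + qint q (n - int t + 1) *\<^sub>q ?d (m - t) (Y (?p t x)) + qint q (n - int t) *\<^sub>q ?p (m - t) (Y (?d t x))"
    if t: "t \<le> m" for t
  proof -
    have "W (n - 2 * int t - (1 - int m)) (Y (?d t x))"
      by (intro WY weight_dv[of W 2 X, OF W x Ws])
    from sl[OF this, of "m - t"]
    have "Z (?d (m - t) (Y (?d t x))) = ?d (m - t) (Z (Y (?d t x))) + qint q (n - int t) *\<^sub>q ?p (m - t) (Y (?d t x))"
      using t by (simp add: of_nat_diff)
    also have "Z (Y (?d t x)) = Y (?d t (Z x)) + qint q (n - int t + 1) *\<^sub>q Y (?p t x)"
      unfolding ZY sl[OF x] lin_add[OF Y] lin_scal[OF Y] ..
    finally show ?thesis unfolding lin_add[OF ld] lin_scal[OF ld] .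
  qed
  obtain k where k: "m = Suc k" using m by (cases m) auto
  let ?A = "\<lambda>t. ((-1) ^ t * qint q (n - int t + 1)) *\<^sub>q ?d (m - t) (Y (?p t x))"
  let ?B = "\<lambda>t. ((-1) ^ t * qint q (n - int t)) *\<^sub>q ?p (m - t) (Y (?d t x))"
  have "Z (serre_op q m X Y x) = serre_op q m X Y (Z x) + ((\<Sum>t\<le>m. ?A t) + (\<Sum>t\<le>m. ?B t))"
    unfolding serre_op_def lin_sum[OF Z] lin_scal[OF Z] sum.distrib[symmetric]
    by (intro sum.cong refl) (simp only: step atMost_iff distrib_left scal_mult_assoc add.assoc)
  also have "(\<Sum>t\<le>m. ?A t) = (\<Sum>t\<le>k. ?A (Suc t))"
    unfolding k sum.atMost_Suc_shift by (simp add: lin_0[OF Y] lin_0[OF ld])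
  also have "(\<Sum>t\<le>m. ?B t) = (\<Sum>t\<le>k. ?B t)"
    unfolding k sum.atMost_Suc by simp
  also have "(\<Sum>t\<le>k. ?A (Suc t)) + (\<Sum>t\<le>k. ?B t) = 0"
    unfolding sum.distrib[symmetric]
    by (intro sum.neutral ballI) (auto simp: k Suc_diff_le scal_uminus)
  finally show ?thesis by simp
qed

text \<open>Commuting Z with Y consumes Y, so each extra term collapses to a multiple of X^m; the
  multiples add up to the alternating sum in \<open>gauss_sum_qint\<close>.\<close>

lemma serre_commute_j:
  assumes q: "not_root_of_unity q" and p: "not_root_of_unity p" and X: "lin X" and Y: "lin Y" and Z: "lin Z"
    and W: "\<And>n x. W n x \<Longrightarrow> W (n - b) (X x)"
    and Ws: "\<And>n c x. W n x \<Longrightarrow> W n (c *\<^sub>q x)"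
    and ZY: "\<And>n x. W n x \<Longrightarrow> Z (Y x) = Y (Z x) + qint p n *\<^sub>q x"
    and ZX: "\<And>x. Z (X x) = X (Z x)"
    and b: "p powi b = q powi (1 - int m)"
    and x: "W n x" and m: "m \<ge> 1"
  shows "Z (serre_op q m X Y x) = serre_op q m X Y (Z x)"
proof -
  let ?d = "dv q X"
  note ld = lin_dv[OF X, of q]
  note cm = commute_dv[of Z X, OF ZX Z]
  have dd: "?d (m - t) (?d t x) = (inverse (qfact q (m - t)) * inverse (qfact q t)) *\<^sub>q (X ^^ m) x" if "t \<le> m" for t
    using that
    by (simp add: dv_def lin_scal[OF lin_funpow[OF X]] scal_mult_assoc funpow_add[of "m - t" t X, unfolded comp_def, THEN fun_cong, symmetric])
  have step: "Z (?d (m - t) (Y (?d t x))) = ?d (m - t) (Y (?d t (Z x)))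
      + (qint p (n - b * int t) * (inverse (qfact q (m - t)) * inverse (qfact q t))) *\<^sub>q (X ^^ m) x"
    if t: "t \<le> m" for t
  proof -
    have "W (n - b * int t) (?d t x)"
      by (intro weight_dv[of W b X, OF W x Ws])
    from ZY[OF this] show ?thesis
      unfolding cm using dd[OF t] by (simp add: lin_add[OF ld] lin_scal[OF ld] cm scal_mult_assoc)
  qed
  have "Z (serre_op q m X Y x) = serre_op q m X Y (Z x)
    + (\<Sum>t\<le>m. ((-1) ^ t * (qint p (n - b * int t) * (inverse (qfact q (m - t)) * inverse (qfact q t)))) *\<^sub>q (X ^^ m) x)"
    unfolding serre_op_def lin_sum[OF Z] lin_scal[OF Z] sum.distrib[symmetric]
    by (intro sum.cong refl) (simp only: step atMost_iff distrib_left scal_mult_assoc)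
  also have "(\<Sum>t\<le>m. ((-1) ^ t * (qint p (n - b * int t) * (inverse (qfact q (m - t)) * inverse (qfact q t)))) *\<^sub>q (X ^^ m) x)
    = (\<Sum>t\<le>m. (-1) ^ t * qint p (n + (-1) * b * int t) * inverse (qfact q (m - t)) * inverse (qfact q t)) *\<^sub>q (X ^^ m) x"
    unfolding fa.scale_sum_left by (simp add: mult.assoc)
  also have "\<dots> = 0"
    using gauss_sum_qint[OF q p m b, of "-1" n] by simp
  finally show ?thesis by simp
qed

lemma serre_commute_k:
  assumes Z: "lin Z" and ZY: "\<And>x. Z (Y x) = Y (Z x)" and ZX: "\<And>x. Z (X x) = X (Z x)"
  shows "Z (serre_op q m X Y x) = serre_op q m X Y (Z x)"
  by (simp add: serre_op_def lin_sum[OF Z] lin_scal[OF Z] commute_dv[of Z X, OF ZX Z] ZY)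

section \<open>The free algebra as a Verma module\<close>

lemma scal_minus1_power: "scal ((-1) ^ t) = (-1) ^ t"
  by (induction t) (simp_all add: scal_uminus)

lemma funpow_gen: "((\<lambda>x. g * x) ^^ n) x = g ^ n * (x :: 'b::monoid_mult)"
  by (induction n) (simp_all add: mult.assoc)

text \<open>Weight projections, the quantum integers in the action of E_i, the twists of the skew
  derivations, the constant term and truncation by length are all of this shape.\<close>

definition diag_op :: "('g list \<Rightarrow> qv) \<Rightarrow> 'g free_alg \<Rightarrow> 'g free_alg" where
  "diag_op g = lext (\<lambda>l. g l *\<^sub>q wd l)"

text \<open>The condition on words is left free: it expresses a multidegree, a weight, the pairing
  with one coroot, a length bound, or membership in the subalgebra on a set of generators.\<close>

definition homog :: "('g list \<Rightarrow> bool) \<Rightarrow> 'g free_alg set" where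
  "homog P = fa.span (wd ` {l. P l})"

lemma lin_diag_op: "lin (diag_op g)"
  by (simp add: diag_op_def lin_lext)

lemma diag_op_wd: "diag_op g (wd l) = g l *\<^sub>q wd l"
  by (simp add: diag_op_def)

lemma homog_wd: "P l \<Longrightarrow> wd l \<in> homog P"
  by (simp add: homog_def fa.span_base)

lemma homog_subspace: "fa.subspace (homog P)"
  by (simp add: homog_def)

lemma homog_smul: "x \<in> homog P \<Longrightarrow> c *\<^sub>q x \<in> homog P"
  by (simp add: homog_def fa.span_scale)

lemma homog_lin:
  assumes "lin f" "fa.subspace N" "\<And>l. P l \<Longrightarrow> f (wd l) \<in> N" "x \<in> homog P"
  shows "f x \<in> N"
  by (rule lin_span_subspace[OF assms(1,2) assms(4)[unfolded homog_def]]) (use assms(3) in auto)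

lemma homog_eq:
  assumes "lin f" "lin g" "\<And>l. P l \<Longrightarrow> f (wd l) = g (wd l)" "x \<in> homog P"
  shows "f x = g x"
proof -
  have "f x - g x \<in> {0}"
    by (rule homog_lin[OF lin_minus_fun[OF assms(1,2)] _ _ assms(4)]) (use assms(3) in auto)
  then show ?thesis by simp
qed

lemma diag_op_homog: "x \<in> homog (\<lambda>l. g l = c) \<Longrightarrow> diag_op g x = c *\<^sub>q x"
  by (rule homog_eq[OF lin_diag_op lin_smul[OF lin_id]]) (auto simp: diag_op_wd)

lemma homog_mono: "(\<And>l. P l \<Longrightarrow> Q l) \<Longrightarrow> x \<in> homog P \<Longrightarrow> x \<in> homog Q"
  unfolding homog_def by (rule subsetD[OF fa.span_mono]) auto

lemma homog_mult:
  assumes "x \<in> homog P" "y \<in> homog Q" "\<And>l l'. P l \<Longrightarrow> Q l' \<Longrightarrow> R (l @ l')"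
  shows "x * y \<in> homog R"
proof -
  have "wd l * y \<in> homog R" if "P l" for l
    by (rule homog_lin[OF lin_mult_left[OF lin_id] homog_subspace _ assms(2)])
       (use assms(3) that in \<open>auto simp: wd_append[symmetric] intro: homog_wd\<close>)
  then show ?thesis
    by (intro homog_lin[OF lin_mult_right[OF lin_id] homog_subspace _ assms(1)]) auto
qed

definition hm :: "'g multiset \<Rightarrow> 'g free_alg set" where
  "hm M = homog (\<lambda>l. mset l = M)"

lemma hm_mult: "x \<in> hm M \<Longrightarrow> y \<in> hm M' \<Longrightarrow> x * y \<in> hm (M + M')"
  unfolding hm_def by (erule (1) homog_mult) auto

lemma hm_wd: "wd l \<in> hm (mset l)"
  unfolding hm_def by (rule homog_wd) simp

lemma hm_gen: "gen g \<in> hm {#g#}"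
  using hm_wd[of "[g]"] by (simp add: wd_single)

lemma hm_1: "1 \<in> hm {#}"
  using hm_wd[of "[]"] by simp

lemma hm_smul: "x \<in> hm M \<Longrightarrow> c *\<^sub>q x \<in> hm M"
  unfolding hm_def by (rule homog_smul)

lemma hm_subspace: "fa.subspace (hm M)"
  unfolding hm_def by (rule homog_subspace)

lemma hm_power: "x \<in> hm M \<Longrightarrow> x ^ n \<in> hm (repeat_mset n M)"
  by (induction n) (auto intro: hm_1 hm_mult)

lemma hm_homog: "x \<in> hm M \<Longrightarrow> (\<And>l. mset l = M \<Longrightarrow> P l) \<Longrightarrow> x \<in> homog P"
  unfolding hm_def by (rule homog_mono)

text \<open>The Cartan matrix \<open>a\<close> and its symmetrising integers \<open>d\<close>,
  detached from the lattices X and Y: everything about U^- and its skew derivations depends on these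
  alone.\<close>

locale qdatum =
  fixes I :: "'i set" and a :: "'i \<Rightarrow> 'i \<Rightarrow> int" and d :: "'i \<Rightarrow> int"
  assumes finite_index_I: "finite I"
    and d_pos: "i \<in> I \<Longrightarrow> d i > 0"
    and a_ii: "i \<in> I \<Longrightarrow> a i i = 2"
    and a_ij: "i \<in> I \<Longrightarrow> j \<in> I \<Longrightarrow> i \<noteq> j \<Longrightarrow> a i j \<le> 0"
    and d_sym: "i \<in> I \<Longrightarrow> j \<in> I \<Longrightarrow> d i * a i j = d j * a j i"
    and pos_def: "(\<exists>i\<in>I. c i \<noteq> 0) \<Longrightarrow> 0 < (\<Sum>i\<in>I. \<Sum>j\<in>I. c i * (d i * a i j) * c j)"
begin

definition v :: "'i \<Rightarrow> qv" where
  "v i = vv powi d i"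

lemma not_root_of_unity_v: "i \<in> I \<Longrightarrow> not_root_of_unity (v i)"
  unfolding v_def using d_pos[of i] by (intro not_root_of_unity_powi not_root_of_unity_vv) auto

lemma v_sym: "i \<in> I \<Longrightarrow> j \<in> I \<Longrightarrow> v i powi a i j = v j powi a j i"
  by (simp add: v_def d_sym flip: power_int_mult)

definition wtp :: "'i \<Rightarrow> 'i list \<Rightarrow> int" where
  "wtp i l = (\<Sum>j\<leftarrow>l. a i j)"

lemma wtp_simps [simp]: "wtp i [] = 0" "wtp i (j # l) = a i j + wtp i l" "wtp i (l @ l') = wtp i l + wtp i l'"
  by (simp_all add: wtp_def)

lemma wtp_mset: "mset l = mset l' \<Longrightarrow> wtp i l = wtp i l'"
  unfolding wtp_def by (metis mset_map sum_mset_sum_list)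

text \<open>
  \<open>Eop \<lambda> i\<close> is the action of \<open>E\<^sub>i\<close> on the Verma module whose highest weight pairs to \<open>\<lambda> i\<close> with
  \<open>h\<^sub>i\<close>; \<open>F\<^sub>j\<close> acts by left multiplication by \<open>gen j\<close>. The Serre relations are not yet imposed.
\<close>

fun Ew :: "('i \<Rightarrow> int) \<Rightarrow> 'i \<Rightarrow> 'i list \<Rightarrow> 'i free_alg" where
  "Ew lam i [] = 0"
| "Ew lam i (j # l) = gen j * Ew lam i l + (if i = j then qint (v i) (lam i - wtp i l) *\<^sub>q wd l else 0)"

definition Eop :: "('i \<Rightarrow> int) \<Rightarrow> 'i \<Rightarrow> 'i free_alg \<Rightarrow> 'i free_alg" where
  "Eop lam i = lext (Ew lam i)"

lemma lin_Eop: "lin (Eop lam i)"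
  by (simp add: Eop_def lin_lext)

lemma Eop_wd: "Eop lam i (wd l) = Ew lam i l"
  by (simp add: Eop_def)

lemma Eop_1: "Eop lam i 1 = 0"
  using Eop_wd[of lam i "[]"] by simp

lemma Eop_gen_mult:
  "Eop lam i (gen j * x) = gen j * Eop lam i x + (if i = j then diag_op (\<lambda>l. qint (v i) (lam i - wtp i l)) x else 0)"
proof -
  have "lin (\<lambda>x. gen j * Eop lam i x + (if i = j then diag_op (\<lambda>l. qint (v i) (lam i - wtp i l)) x else 0))"
    by (cases "i = j") (simp_all add: lin_plus lin_mult_left lin_Eop lin_diag_op)
  then show ?thesis
    by (rule lin_eqI[OF lin_comp[OF lin_Eop lin_mult_left[OF lin_id]]])
       (auto simp: wd_Cons[symmetric] Eop_wd diag_op_wd)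
qed

definition Wt :: "('i \<Rightarrow> int) \<Rightarrow> 'i \<Rightarrow> int \<Rightarrow> 'i free_alg set" where
  "Wt lam i n = homog (\<lambda>l. lam i - wtp i l = n)"

lemma Wt_smul: "x \<in> Wt lam i n \<Longrightarrow> c *\<^sub>q x \<in> Wt lam i n"
  unfolding Wt_def by (rule homog_smul)

lemma Wt_wd: "wd l \<in> Wt lam i (lam i - wtp i l)"
  unfolding Wt_def by (rule homog_wd) simp

lemma Wt_gen_mult: "x \<in> Wt lam i n \<Longrightarrow> gen j * x \<in> Wt lam i (n - a i j)"
  unfolding Wt_def
  by (rule homog_mult[where P = "\<lambda>l. l = [j]"]) (auto simp: wd_single[symmetric] intro: homog_wd)

lemma Ew_homog: "Ew lam i l \<in> homog (\<lambda>l'. add_mset i (mset l') = mset l)"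
proof (induction l)
  case Nil
  then show ?case using homog_subspace by (auto intro: fa.subspace_0)
next
  case (Cons j l)
  have "gen j * Ew lam i l \<in> homog (\<lambda>l'. add_mset i (mset l') = mset (j # l))"
    by (rule homog_mult[where P = "\<lambda>l. l = [j]", OF _ Cons])
       (auto simp: wd_single[symmetric] intro: homog_wd)
  moreover have "(if i = j then qint (v i) (lam i - wtp i l) *\<^sub>q wd l else 0) \<in> homog (\<lambda>l'. add_mset i (mset l') = mset (j # l))"
    by (auto intro!: homog_smul homog_wd fa.subspace_0[OF homog_subspace])
  ultimately show ?case by (simp add: fa.subspace_add[OF homog_subspace])
qed

lemma Eop_hm: "x \<in> hm M \<Longrightarrow> Eop lam i x \<in> homog (\<lambda>l'. add_mset i (mset l') = M)"
  unfolding hm_def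
  by (rule homog_lin[OF lin_Eop homog_subspace]) (use Ew_homog in \<open>auto simp: Eop_wd\<close>)

lemma wtp_add_mset: "add_mset j (mset l') = mset l \<Longrightarrow> wtp i l = a i j + wtp i l'"
  using wtp_mset[of "j # l'" l i] by simp

lemma Wt_Eop: "x \<in> Wt lam i n \<Longrightarrow> Eop lam j x \<in> Wt lam i (n + a i j)"
  unfolding Wt_def
  by (rule homog_lin[OF lin_Eop homog_subspace])
     (auto simp: Eop_wd wtp_add_mset intro: homog_mono[OF _ Ew_homog])

lemma Eop_gen_Wt:
  assumes "x \<in> Wt lam i n"
  shows "Eop lam i (gen i * x) = gen i * Eop lam i x + qint (v i) n *\<^sub>q x"
proof -
  have "x \<in> homog (\<lambda>l. qint (v i) (lam i - wtp i l) = qint (v i) n)"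
    using assms unfolding Wt_def by (rule homog_mono[rotated]) simp
  then show ?thesis by (simp add: Eop_gen_mult diag_op_homog)
qed

lemma Eop_gen_other: "i \<noteq> j \<Longrightarrow> Eop lam i (gen j * x) = gen j * Eop lam i x"
  by (simp add: Eop_gen_mult)

definition serre_elt :: "'i \<Rightarrow> 'i \<Rightarrow> 'i free_alg" where
  "serre_elt i j = (\<Sum>t\<le>nat (1 - a i j). (-1) ^ t * free_divpow (v i) (gen i) (nat (1 - a i j) - t) * gen j
     * free_divpow (v i) (gen i) t)"

lemma serre_elt_op: "serre_elt i j * x = serre_op (v i) (nat (1 - a i j)) (\<lambda>x. gen i * x) (\<lambda>x. gen j * x) x"
  unfolding serre_elt_def serre_op_def dv_def funpow_gen free_divpow_def sum_distrib_right
  by (intro sum.cong refl) (simp only: mult.assoc scal_minus1_power)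

text \<open>Left multiplication by a Serre element is a Serre operator in the F's, and one of the
  three commutation lemmas applies, according as k is i, j or neither. This is why the E_k descend
  to the quotient by the Serre relations.\<close>

lemma Eop_serre_elt:
  assumes i: "i \<in> I" and j: "j \<in> I" and ij: "i \<noteq> j"
  shows "Eop lam k (serre_elt i j * x) = serre_elt i j * Eop lam k x"
proof -
  define m where "m = nat (1 - a i j)"
  have m: "m \<ge> 1" and m': "1 - int m = a i j" using a_ij[OF i j ij] by (auto simp: m_def)
  note l = lin_mult_left[OF lin_id]
  have "Eop lam k (serre_elt i j * wd l) = serre_elt i j * Eop lam k (wd l)" for l
  proof -
    consider "k = i" | "k = j" | "k \<noteq> i" "k \<noteq> j" by blast
    then show ?thesis
    proof cases
      case 1
      show ?thesis unfolding serre_elt_op m_def[symmetric] 1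
        by (rule serre_commute_i[where W = "\<lambda>n x. x \<in> Wt lam i n" and n = "lam i - wtp i l", OF not_root_of_unity_v[OF i] l l lin_Eop])
           (use ij m m' a_ii[OF i] Wt_gen_mult[of _ lam i _ i] Wt_gen_mult[of _ lam i _ j] in
             \<open>auto simp: Eop_gen_Wt Eop_gen_other intro: Wt_smul Wt_wd\<close>)
    next
      case 2
      show ?thesis unfolding serre_elt_op m_def[symmetric] 2
        by (rule serre_commute_j[where W = "\<lambda>n x. x \<in> Wt lam j n" and n = "lam j - wtp j l" and b = "a j i" and p = "v j",
             OF not_root_of_unity_v[OF i] not_root_of_unity_v[OF j] l l lin_Eop])
           (use ij m m' v_sym[OF i j] Wt_gen_mult[of _ lam j _ i] in
             \<open>auto simp: Eop_gen_Wt Eop_gen_other intro: Wt_smul Wt_wd\<close>)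
    next
      case 3
      show ?thesis unfolding serre_elt_op
        by (rule serre_commute_k[OF lin_Eop]) (use 3 in \<open>auto simp: Eop_gen_other\<close>)
    qed
  qed
  then show ?thesis
    by (rule lin_eqI[OF lin_comp[OF lin_Eop l] lin_mult_left[OF lin_Eop]])
qed

text \<open>The Serre operator in the E's commutes with every F_k and kills 1, from which the F_k
  generate all words; so the E's satisfy the Serre relations before any are imposed on the
  F's.\<close>

lemma Eop_serre:
  assumes i: "i \<in> I" and j: "j \<in> I" and ij: "i \<noteq> j"
  shows "serre_op (v i) (nat (1 - a i j)) (Eop lam i) (Eop lam j) x = 0"
proof -
  define m where "m = nat (1 - a i j)"
  have m: "m \<ge> 1" and m': "1 - int m = a i j" using a_ij[OF i j ij] by (auto simp: m_def)
  let ?S = "serre_op (v i) m (Eop lam i) (Eop lam j)"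
  note l = lin_mult_left[OF lin_id]
  have ls: "lin ?S" by (rule lin_serre_op[OF lin_Eop lin_Eop])
  \<comment> \<open>With the roles of E and F exchanged, weights are counted negatively, so that F E
    - E F on a vector labelled n is again [n].\<close>
  have w1: "x \<in> Wt lam k (- n) \<Longrightarrow> Eop lam k' x \<in> Wt lam k (a k k' - n)" for k k' n x
    using Wt_Eop[of x lam k "- n" k'] by simp
  have *: "gen k * ?S (wd l) = ?S (gen k * wd l)" for k l
  proof -
    consider "k = i" | "k = j" | "k \<noteq> i" "k \<noteq> j" by blast
    then show ?thesis
    proof cases
      case 1
      show ?thesis unfolding 1
        by (rule serre_commute_i[where W = "\<lambda>n x. x \<in> Wt lam i (-n)" and n = "-(lam i - wtp i l)", OF not_root_of_unity_v[OF i] lin_Eop lin_Eop l])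
           (use ij m m' a_ii[OF i] w1[of _ i _ i] w1[of _ i _ j] Wt_wd[of l lam i] in
             \<open>auto simp: Eop_gen_Wt Eop_gen_other qint_minus scal_uminus add.commute intro: Wt_smul\<close>)
    next
      case 2
      show ?thesis unfolding 2
        by (rule serre_commute_j[where W = "\<lambda>n x. x \<in> Wt lam j (-n)" and n = "-(lam j - wtp j l)" and b = "a j i" and p = "v j",
             OF not_root_of_unity_v[OF i] not_root_of_unity_v[OF j] lin_Eop lin_Eop l])
           (use ij m m' v_sym[OF i j] w1[of _ j _ i] Wt_wd[of l lam j] in
             \<open>auto simp: Eop_gen_Wt Eop_gen_other qint_minus scal_uminus add.commute intro: Wt_smul\<close>)
    next
      case 3
      show ?thesis
        by (rule serre_commute_k[OF l]) (use 3 in \<open>auto simp: Eop_gen_other\<close>)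
    qed
  qed
  have E0: "(Eop lam i ^^ Suc s) 1 = 0" for s
    by (induction s) (simp_all add: Eop_1 lin_0[OF lin_Eop])
  \<comment> \<open>For t > 0 the inner divided power kills 1, and for t = 0 already E_j
    does.\<close>
  have "dv (v i) (Eop lam i) (m - t) (Eop lam j (dv (v i) (Eop lam i) t 1)) = 0" for t
  proof (cases t)
    case 0
    then show ?thesis by (simp add: Eop_1 lin_0[OF lin_dv[OF lin_Eop]])
  next
    case (Suc s)
    have "dv (v i) (Eop lam i) t 1 = 0" using E0[of s] by (simp add: dv_def Suc)
    then show ?thesis by (simp add: lin_0[OF lin_dv[OF lin_Eop]] lin_0[OF lin_Eop])
  qed
  then have "?S 1 = 0" by (simp add: serre_op_def)
  then have "?S (wd l) = 0" for l
    by (induction l) (simp_all add: wd_Cons *[symmetric])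
  then show ?thesis unfolding m_def[symmetric]
    by (rule lin_eqI[OF ls lin_zero])
qed

end

section \<open>The Serre subspace\<close>

text \<open>The spanning vectors are multihomogeneous, and a factor depending only on the multiset
  of letters is constant on each of them.\<close>

lemma span_diag_op:
  assumes B: "\<And>b. b \<in> B \<Longrightarrow> \<exists>M. b \<in> hm M"
    and g: "\<And>l l'. mset l = mset l' \<Longrightarrow> g l = g l'" and x: "x \<in> fa.span B"
  shows "diag_op g x \<in> fa.span B"
proof (rule lin_span_subspace[OF lin_diag_op _ x])
  fix b assume b: "b \<in> B"
  then obtain M where M: "b \<in> hm M" using B by blast
  obtain l0 where l0: "mset l0 = M" using ex_mset by blast
  have "b \<in> homog (\<lambda>l. g l = g l0)" using M by (rule hm_homog) (use l0 in \<open>auto intro: g\<close>)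
  then show "diag_op g b \<in> fa.span B" using b by (simp add: diag_op_homog fa.span_scale fa.span_base)
qed simp

lemma homog_nonempty_zero: "(\<And>l. \<not> P l) \<Longrightarrow> x \<in> homog P \<Longrightarrow> x = 0"
  by (simp add: homog_def)

lemma hm_empty: "x \<in> hm {#} \<Longrightarrow> \<exists>c. x = scal c"
  unfolding hm_def homog_def by (auto simp: fa.span_singleton)

lemma hm_single: "x \<in> hm {#g#} \<Longrightarrow> \<exists>c. x = c *\<^sub>q gen g"
  unfolding hm_def homog_def by (auto simp: mset_single_iff fa.span_singleton wd_single)

lemma gen_scal: "gen j * (c *\<^sub>q x) = c *\<^sub>q (gen j * x)"
  by (rule mult_scal_right)

context qdatum
begin

definition SIgen :: "'i free_alg set" where
  "SIgen = {wd x * serre_elt i j * wd y | x y i j. i \<in> I \<and> j \<in> I \<and> i \<noteq> j} \<union> wd ` {l. \<not> set l \<subseteq> I}"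

text \<open>
  Words containing a letter outside \<open>I\<close> are put into the Serre subspace, so that \<open>U\<^sup>-\<close> becomes a
  quotient of the free algebra on the whole type of letters.
\<close>

definition serre_ideal :: "'i free_alg set" where
  "serre_ideal = fa.span SIgen"

lemma serre_ideal_subspace: "fa.subspace serre_ideal"
  by (simp add: serre_ideal_def)

lemmas serre_ideal_add = fa.subspace_add[OF serre_ideal_subspace] and serre_ideal_diff = fa.subspace_diff[OF serre_ideal_subspace]
  and serre_ideal_smul = fa.subspace_scale[OF serre_ideal_subspace] and serre_ideal_0 = fa.subspace_0[OF serre_ideal_subspace]

lemma serre_ideal_bad: "\<not> set l \<subseteq> I \<Longrightarrow> wd l \<in> serre_ideal"
  unfolding serre_ideal_def by (rule fa.span_base) (auto simp: SIgen_def)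

lemma serre_ideal_serre_elt: "i \<in> I \<Longrightarrow> j \<in> I \<Longrightarrow> i \<noteq> j \<Longrightarrow> wd x * serre_elt i j * wd y \<in> serre_ideal"
  unfolding serre_ideal_def by (rule fa.span_base) (auto simp: SIgen_def)

lemma serre_elt_mem: "i \<in> I \<Longrightarrow> j \<in> I \<Longrightarrow> i \<noteq> j \<Longrightarrow> serre_elt i j \<in> serre_ideal"
  using serre_ideal_serre_elt[of i j "[]" "[]"] by simp

lemma serre_ideal_mult_left: assumes "x \<in> serre_ideal" shows "b * x \<in> serre_ideal"
proof -
  have "wd l * x \<in> serre_ideal" for l
  proof (rule lin_span_subspace[OF lin_mult_left[OF lin_id] serre_ideal_subspace assms[unfolded serre_ideal_def]])
    fix g assume "g \<in> SIgen"
    then consider (1) x y i j where "g = wd x * serre_elt i j * wd y" "i \<in> I" "j \<in> I" "i \<noteq> j"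
      | (2) l' where "g = wd l'" "\<not> set l' \<subseteq> I"
      unfolding SIgen_def by blast
    then show "wd l * g \<in> serre_ideal"
    proof cases
      case 1
      then show ?thesis using serre_ideal_serre_elt[of i j "l @ x" y] by (simp add: wd_append mult.assoc)
    next
      case 2
      then show ?thesis using serre_ideal_bad[of "l @ l'"] by (simp add: wd_append)
    qed
  qed
  then show ?thesis by (rule lin_into_subspace[OF lin_mult_right[OF lin_id] serre_ideal_subspace])
qed

lemma serre_ideal_mult_right: assumes "x \<in> serre_ideal" shows "x * b \<in> serre_ideal"
proof -
  have "x * wd l \<in> serre_ideal" for l
  proof (rule lin_span_subspace[OF lin_mult_right[OF lin_id] serre_ideal_subspace assms[unfolded serre_ideal_def]])
    fix g assume "g \<in> SIgen"
    then consider (1) x y i j where "g = wd x * serre_elt i j * wd y" "i \<in> I" "j \<in> I" "i \<noteq> j"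
      | (2) l' where "g = wd l'" "\<not> set l' \<subseteq> I"
      unfolding SIgen_def by blast
    then show "g * wd l \<in> serre_ideal"
    proof cases
      case 1
      then show ?thesis using serre_ideal_serre_elt[of i j x "y @ l"] by (simp add: wd_append mult.assoc)
    next
      case 2
      then show ?thesis using serre_ideal_bad[of "l' @ l"] by (simp add: wd_append)
    qed
  qed
  then show ?thesis by (rule lin_into_subspace[OF lin_mult_left[OF lin_id] serre_ideal_subspace])
qed

lemma serre_elt_hm: "\<exists>M. serre_elt i j \<in> hm M"
proof -
  define m where "m = nat (1 - a i j)"
  have fd: "free_divpow q (gen i) t \<in> hm (replicate_mset t i)" for q t
    unfolding free_divpow_def using hm_power[OF hm_gen[of i], of t] by (intro hm_smul) simp
  have "(-1) ^ t * free_divpow (v i) (gen i) (m - t) * gen j * free_divpow (v i) (gen i) t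
    \<in> hm (replicate_mset m i + {#j#})" if "t \<le> m" for t
  proof -
    have "replicate_mset (m - t) i + {#j#} + replicate_mset t i = replicate_mset m i + {#j#}"
      by (rule multiset_eqI) (use that in auto)
    moreover have "free_divpow (v i) (gen i) (m - t) * gen j * free_divpow (v i) (gen i) t
       \<in> hm (replicate_mset (m - t) i + {#j#} + replicate_mset t i)"
      by (intro hm_mult fd hm_gen)
    ultimately show ?thesis
      using hm_smul[of _ _ "(-1) ^ t"] by (simp add: scal_minus1_power mult.assoc)
  qed
  then show ?thesis unfolding serre_elt_def m_def[symmetric]
    by (intro exI fa.subspace_sum[OF hm_subspace]) auto
qed

lemma SIgen_hm: "b \<in> SIgen \<Longrightarrow> \<exists>M. b \<in> hm M"
proof -
  have "\<exists>M. wd x * serre_elt i j * wd y \<in> hm M" for x i j y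
    using serre_elt_hm[of i j] hm_mult[OF hm_mult[OF hm_wd] hm_wd] by blast
  then show "b \<in> SIgen \<Longrightarrow> \<exists>M. b \<in> hm M"
    unfolding SIgen_def using hm_wd by blast
qed

lemma serre_ideal_diag_op: "(\<And>l l'. mset l = mset l' \<Longrightarrow> g l = g l') \<Longrightarrow> x \<in> serre_ideal \<Longrightarrow> diag_op g x \<in> serre_ideal"
  unfolding serre_ideal_def by (rule span_diag_op[OF SIgen_hm])

text \<open>Moving E_k through the word to the left of a Serre element leaves diagonal rescalings of
  elements already in the subspace, and E_k then passes the Serre element itself. A word with a
  letter outside \<open>I\<close> keeps that letter, since E_k with k \<in> I only removes letters
  k.\<close>

lemma serre_ideal_Eop:
  assumes k: "k \<in> I" and x: "x \<in> serre_ideal" shows "Eop lam k x \<in> serre_ideal"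
proof (rule lin_span_subspace[OF lin_Eop serre_ideal_subspace x[unfolded serre_ideal_def]])
  have qd: "diag_op (\<lambda>l. qint (v k) (lam k - wtp k l)) x \<in> serre_ideal" if "x \<in> serre_ideal" for x
    by (rule serre_ideal_diag_op[OF _ that]) (metis wtp_mset)
  fix g assume "g \<in> SIgen"
  then consider (1) x y i j where "g = wd x * serre_elt i j * wd y" "i \<in> I" "j \<in> I" "i \<noteq> j"
    | (2) l' where "g = wd l'" "\<not> set l' \<subseteq> I"
    unfolding SIgen_def by blast
  then show "Eop lam k g \<in> serre_ideal"
  proof cases
    case 1
    have "Eop lam k (wd x * serre_elt i j * wd y) \<in> serre_ideal"
    proof (induction x)
      case Nil
      show ?case using 1(2-4) by (simp add: Eop_serre_elt serre_ideal_mult_right serre_elt_mem)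
    next
      case (Cons g x)
      have "diag_op (\<lambda>l. qint (v k) (lam k - wtp k l)) (wd x * serre_elt i j * wd y) \<in> serre_ideal"
        by (rule qd[OF serre_ideal_serre_elt[OF 1(2-4)]])
      then show ?case using Cons by (auto simp: wd_Cons mult.assoc Eop_gen_mult serre_ideal_mult_left serre_ideal_add)
    qed
    then show ?thesis by (simp add: 1)
  next
    case 2
    have "Eop lam k (wd l) \<in> serre_ideal" if "\<not> set l \<subseteq> I" for l
      using that
    proof (induction l)
      case (Cons j l)
      have "gen j * Eop lam k (wd l) \<in> serre_ideal"
      proof (cases "set l \<subseteq> I")
        case True
        then have "wd [j] \<in> serre_ideal" using Cons.prems by (intro serre_ideal_bad) auto
        then show ?thesis by (simp add: wd_single serre_ideal_mult_right)
      qed (simp add: Cons.IH serre_ideal_mult_left)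
      moreover have "k = j \<Longrightarrow> wd l \<in> serre_ideal" using Cons.prems k by (auto intro: serre_ideal_bad)
      ultimately show ?case
        by (auto simp: wd_Cons Eop_gen_mult diag_op_wd intro!: serre_ideal_add serre_ideal_smul)
    qed simp
    then show ?thesis using 2 by simp
  qed
qed

section \<open>Skew derivations\<close>

text \<open>
  Up to normalisation, \<open>\<epsilon> = -1\<close> and \<open>\<epsilon> = 1\<close> give the leading and the lowest coefficient of \<open>Eop \<lambda> i\<close>
  as a Laurent polynomial in \<open>v\<^sub>i\<^bsup>\<lambda> i\<^esup>\<close> (see \<open>Eop_skew_der\<close>).
\<close>

definition skew_der :: "int \<Rightarrow> 'i \<Rightarrow> 'i free_alg \<Rightarrow> 'i free_alg" where
  "skew_der \<epsilon> i x = Eop (\<lambda>_. 1) i x - (v i powi \<epsilon>) *\<^sub>q Eop (\<lambda>_. 0) i x"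

lemma lin_skew_der: "lin (skew_der \<epsilon> i)"
  unfolding skew_der_def by (intro lin_minus_fun lin_smul lin_Eop)

lemma skew_der_1: "skew_der \<epsilon> i 1 = 0"
  by (simp add: skew_der_def Eop_1)

lemma serre_ideal_skew_der: "i \<in> I \<Longrightarrow> x \<in> serre_ideal \<Longrightarrow> skew_der \<epsilon> i x \<in> serre_ideal"
  unfolding skew_der_def by (intro serre_ideal_diff serre_ideal_smul serre_ideal_Eop)

lemma skew_der_hm: "x \<in> hm M \<Longrightarrow> skew_der \<epsilon> i x \<in> homog (\<lambda>l'. add_mset i (mset l') = M)"
  unfolding skew_der_def by (intro fa.subspace_diff[OF homog_subspace] homog_smul Eop_hm)

lemma skew_der_hm': "x \<in> hm (add_mset i M) \<Longrightarrow> skew_der \<epsilon> i x \<in> hm M"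
  using skew_der_hm[of x "add_mset i M" \<epsilon> i] by (simp add: hm_def)

lemma skew_der_not_in: "x \<in> hm M \<Longrightarrow> i \<notin># M \<Longrightarrow> skew_der \<epsilon> i x = 0"
  by (rule homog_nonempty_zero[OF _ skew_der_hm]) auto

text \<open>The combination is made so that [1 - n] - v_i^\<epsilon> [-n] = v_i^(\<epsilon> n): only
  one of the two exponentials in the quantum integer survives.\<close>

lemma skew_der_gen_mult:
  assumes i: "i \<in> I" and \<epsilon>: "\<epsilon> = 1 \<or> \<epsilon> = -1"
  shows "skew_der \<epsilon> i (gen j * x) = gen j * skew_der \<epsilon> i x + (if i = j then diag_op (\<lambda>l. v i powi (\<epsilon> * wtp i l)) x else 0)"
proof -
  have q: "not_root_of_unity (v i)" by (rule not_root_of_unity_v[OF i])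
  have n: "qint (v i) (1 - n) - v i powi \<epsilon> * qint (v i) (- n) = v i powi (\<epsilon> * n)" for n
    using \<epsilon> qint_add[OF q, of "1" "- n"] qint_add[OF q, of "- n" 1] qint_1[OF q] by auto
  have "diag_op (\<lambda>l. qint (v i) (1 - wtp i l)) x - v i powi \<epsilon> *\<^sub>q diag_op (\<lambda>l. qint (v i) (0 - wtp i l)) x
      = diag_op (\<lambda>l. v i powi (\<epsilon> * wtp i l)) x"
    by (rule lin_eqI[OF lin_minus_fun[OF lin_diag_op lin_smul[OF lin_diag_op]] lin_diag_op])
       (simp add: diag_op_wd scal_mult_assoc n[symmetric] scal_diff left_diff_distrib)
  then show ?thesis
    by (cases "i = j") (auto simp: skew_der_def Eop_gen_mult distrib_left right_diff_distrib gen_scal)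
qed

lemma skew_der_gen_wd:
  assumes i: "i \<in> I" and \<epsilon>: "\<epsilon> = 1 \<or> \<epsilon> = -1"
  shows "skew_der \<epsilon> i (gen j * wd l) = gen j * skew_der \<epsilon> i (wd l) + (if i = j then v i powi (\<epsilon> * wtp i l) *\<^sub>q wd l else 0)"
  by (simp add: skew_der_gen_mult[OF assms] diag_op_wd)

lemma skew_der_gen:
  assumes i: "i \<in> I" and \<epsilon>: "\<epsilon> = 1 \<or> \<epsilon> = -1"
  shows "skew_der \<epsilon> i (gen j) = (if i = j then 1 else 0)"
  using skew_der_gen_wd[OF assms, of j "[]"] by (simp add: skew_der_1)

text \<open>Both sides satisfy the same recursion on words, as [\<lambda>_i - n] splits into
  multiples of v_i^(\<lambda>_i) v_i^(-n) and v_i^(-\<lambda>_i) v_i^n. All dependence on the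
  highest weight sits in the two scalars.\<close>

lemma Eop_skew_der:
  assumes i: "i \<in> I"
  shows "Eop lam i x = inverse (v i - inverse (v i)) *\<^sub>q
    (v i powi lam i *\<^sub>q skew_der (-1) i x - v i powi (- lam i) *\<^sub>q skew_der 1 i x)"
proof -
  have q: "v k \<noteq> 0" for k by (simp add: v_def vv_nz)
  let ?R = "\<lambda>x. inverse (v i - inverse (v i)) *\<^sub>q (v i powi lam i *\<^sub>q skew_der (-1) i x - v i powi (- lam i) *\<^sub>q skew_der 1 i x)"
  have "Eop lam i (wd l) = ?R (wd l)" for l
  proof (induction l)
    case (Cons j l)
    have n: "qint (v k) (lam k - wtp k l) = inverse (v k - inverse (v k)) *
        (v k powi lam k * v k powi (- wtp k l) - v k powi (- lam k) * v k powi (wtp k l))" for k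
      unfolding qint_def power_int_add[OF disjI1[OF q], symmetric] by (simp add: field_simps)
    have "?R (gen j * wd l) = gen j * ?R (wd l) + (if i = j then qint (v i) (lam i - wtp i l) *\<^sub>q wd l else 0)"
      by (simp add: skew_der_gen_wd[OF i] n scal_mult_assoc right_diff_distrib scal_diff left_diff_distrib
          distrib_left gen_scal mult.assoc[of _ "_ :: qv"])
    then show ?case using Cons by (simp add: wd_Cons Eop_gen_mult diag_op_wd)
  qed (simp add: skew_der_1 Eop_1)
  then show ?thesis
    by (rule lin_eqI[OF lin_Eop lin_smul[OF lin_minus_fun[OF lin_smul[OF lin_skew_der] lin_smul[OF lin_skew_der]]]])
qed

text \<open>A letter appended on the right shifts the twist exponent of every earlier letter by
  a_ij, whence one common factor; removing the last letter itself meets an empty tail and gives no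
  twist.\<close>

lemma skew_der_mult_gen:
  assumes i: "i \<in> I" and \<epsilon>: "\<epsilon> = 1 \<or> \<epsilon> = -1"
  shows "skew_der \<epsilon> i (x * gen j) = v i powi (\<epsilon> * a i j) *\<^sub>q (skew_der \<epsilon> i x * gen j) + (if i = j then x else 0)"
proof -
  have q: "v i \<noteq> 0" by (rule not_root_of_unityD(1)[OF not_root_of_unity_v[OF i]])
  have "skew_der \<epsilon> i (wd l * gen j) = v i powi (\<epsilon> * a i j) *\<^sub>q (skew_der \<epsilon> i (wd l) * gen j) + (if i = j then wd l else 0)" for l
  proof (induction l)
    case Nil
    then show ?case by (simp add: skew_der_1 skew_der_gen[OF assms])
  next
    case (Cons k l)
    have e: "wd l * gen j = wd (l @ [j])" by (simp add: wd_append wd_single)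
    have "skew_der \<epsilon> i (wd (k # l) * gen j) = gen k * skew_der \<epsilon> i (wd l * gen j)
      + (if i = k then v i powi (\<epsilon> * wtp i (l @ [j])) *\<^sub>q (wd l * gen j) else 0)"
      unfolding wd_Cons mult.assoc e by (rule skew_der_gen_wd[OF assms])
    also have "v i powi (\<epsilon> * wtp i (l @ [j])) = v i powi (\<epsilon> * a i j) * v i powi (\<epsilon> * wtp i l)"
      using q by (simp add: distrib_left power_int_add)
    finally show ?case unfolding Cons
      by (simp add: wd_Cons skew_der_gen_wd[OF assms] mult.assoc distrib_left distrib_right gen_scal scal_mult_assoc)
  qed
  then show ?thesis
    by (rule lin_eqI[OF lin_comp[OF lin_skew_der lin_mult_right[OF lin_id]], rotated])
       (cases "i = j"; simp add: lin_plus lin_smul lin_mult_right lin_skew_der lin_id)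
qed

text \<open>Removing a letter l changes the twist exponent for k by the constant a_kl, and
  conversely; by v_k^(a_kl) = v_l^(a_lk) both discrepancies amount to the same factor. This carries
  information about the derivations with -1 over to those with 1.\<close>

lemma skew_der_commute:
  assumes k: "k \<in> I" and l: "l \<in> I"
  shows "skew_der (-1) k (skew_der 1 l x) = v k powi a k l *\<^sub>q skew_der 1 l (skew_der (-1) k x)"
proof -
  have q: "v k \<noteq> 0" "v l \<noteq> 0" using not_root_of_unityD(1)[OF not_root_of_unity_v] k l by auto
  have "skew_der (-1) k (skew_der 1 l (wd w)) = v k powi a k l *\<^sub>q skew_der 1 l (skew_der (-1) k (wd w))" for w
  proof (induction w)
    case Nil
    then show ?case by (simp add: skew_der_1 lin_0[OF lin_skew_der])
  next
    case (Cons j w)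
    have 1: "diag_op (\<lambda>l. v k powi (- wtp k l)) (skew_der 1 l (wd w)) = (v k powi a k l * v k powi (- wtp k w)) *\<^sub>q skew_der 1 l (wd w)"
      using skew_der_hm[OF hm_wd] by (intro diag_op_homog homog_mono[OF _ skew_der_hm[OF hm_wd]])
        (use q in \<open>auto simp: wtp_add_mset power_int_diff power_int_minus field_simps power_int_add\<close>)
    have 2: "diag_op (\<lambda>m. v l powi (wtp l m)) (skew_der (-1) k (wd w)) = (inverse (v k powi a k l) * v l powi (wtp l w)) *\<^sub>q skew_der (-1) k (wd w)"
      unfolding v_sym[OF k l]
      by (intro diag_op_homog homog_mono[OF _ skew_der_hm[OF hm_wd]])
        (use q in \<open>auto simp: wtp_add_mset power_int_diff power_int_minus field_simps power_int_add\<close>)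
    have L: "skew_der (-1) k (skew_der 1 l (gen j * wd w)) = gen j * skew_der (-1) k (skew_der 1 l (wd w))
      + (if k = j then (v k powi a k l * v k powi (- wtp k w)) *\<^sub>q skew_der 1 l (wd w) else 0)
      + (if l = j then v l powi wtp l w *\<^sub>q skew_der (-1) k (wd w) else 0)"
      using 1 by (auto simp: skew_der_gen_wd[OF l] skew_der_gen_mult[OF k] lin_add[OF lin_skew_der] lin_scal[OF lin_skew_der] lin_0[OF lin_skew_der])
    have R: "skew_der 1 l (skew_der (-1) k (gen j * wd w)) = gen j * skew_der 1 l (skew_der (-1) k (wd w))
      + (if l = j then (inverse (v k powi a k l) * v l powi (wtp l w)) *\<^sub>q skew_der (-1) k (wd w) else 0)
      + (if k = j then v k powi (- wtp k w) *\<^sub>q skew_der 1 l (wd w) else 0)"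
      using 2 by (auto simp: skew_der_gen_wd[OF k] skew_der_gen_mult[OF l] lin_add[OF lin_skew_der] lin_scal[OF lin_skew_der] lin_0[OF lin_skew_der])
    have "v k powi a k l \<noteq> 0" using q by simp
    then show ?case unfolding wd_Cons L R Cons
      by (auto simp: distrib_left scal_mult_assoc gen_scal)
  qed
  then show ?thesis
    by (rule lin_eqI[OF lin_comp[OF lin_skew_der lin_skew_der] lin_smul[OF lin_comp[OF lin_skew_der lin_skew_der]]])
qed

end

text \<open>The spaces \<open>S n\<close> are not assumed nested, so membership is asked for all
  large indices: this condition is stable under sums, and it suffices to test it on words.\<close>

lemma free_alg_eventually:
  assumes sub: "\<And>n. fa.subspace (S n)" and w: "\<And>l. \<exists>n. \<forall>m\<ge>n. wd l \<in> S m"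
  shows "\<exists>n. \<forall>m\<ge>(n::nat). x \<in> S m"
proof -
  have "fa.subspace {x. \<exists>n. \<forall>m\<ge>n. x \<in> S m}"
  proof (rule fa.subspaceI)
    show "0 \<in> {x. \<exists>n. \<forall>m\<ge>n. x \<in> S m}" using fa.subspace_0[OF sub] by auto
  next
    fix x y assume "x \<in> {x. \<exists>n. \<forall>m\<ge>n. x \<in> S m}" "y \<in> {x. \<exists>n. \<forall>m\<ge>n. x \<in> S m}"
    then obtain n n' where "\<forall>m\<ge>n. x \<in> S m" "\<forall>m\<ge>n'. y \<in> S m" by auto
    then show "x + y \<in> {x. \<exists>n. \<forall>m\<ge>n. x \<in> S m}"
      using fa.subspace_add[OF sub] by (auto intro!: exI[of _ "max n n'"])
  next
    fix c x assume "x \<in> {x. \<exists>n. \<forall>m\<ge>n. x \<in> S m}"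
    then show "c *\<^sub>q x \<in> {x. \<exists>n. \<forall>m\<ge>n. x \<in> S m}"
      using fa.subspace_scale[OF sub] by blast
  qed
  from lin_into_subspace[OF lin_id this, of x] w show ?thesis by auto
qed

lemma subspace_vimage: "lin f \<Longrightarrow> fa.subspace N \<Longrightarrow> fa.subspace {x. f x \<in> N}"
  by (auto simp: fa.subspace_def lin_0 lin_add lin_scal)

lemma scal_collect: "scal s * (c *\<^sub>q A) * g * (c' *\<^sub>q B) = (s * c * c') *\<^sub>q (A * g * B)"
proof -
  have "A * (g * (c' *\<^sub>q B)) = c' *\<^sub>q (A * (g * B))" by (simp only: mult_scal_right)
  then show ?thesis by (simp add: mult.assoc)
qed

context qdatum
begin

section \<open>Integrable quotients\<close>

text \<open>
  The free algebra modulo \<open>NL J \<lambda>\<close> is the quotient of the Verma module of \<open>U\<close> by the submodule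
  generated by \<open>F\<^sub>i\<close> to the power \<open>\<lambda> i + 1\<close>, for \<open>i \<in> J\<close>.
\<close>

definition NLgen :: "'i set \<Rightarrow> ('i \<Rightarrow> int) \<Rightarrow> 'i free_alg set" where
  "NLgen J lam = SIgen \<union> {wd x * gen i ^ Suc (nat (lam i)) | x i. i \<in> J}"

definition NL :: "'i set \<Rightarrow> ('i \<Rightarrow> int) \<Rightarrow> 'i free_alg set" where
  "NL J lam = fa.span (NLgen J lam)"

lemma NL_subspace: "fa.subspace (NL J lam)"
  by (simp add: NL_def)

lemmas NL_add = fa.subspace_add[OF NL_subspace] and NL_diff = fa.subspace_diff[OF NL_subspace]
  and NL_smul = fa.subspace_scale[OF NL_subspace] and NL_0 = fa.subspace_0[OF NL_subspace]

lemma NL_serre_ideal: "x \<in> serre_ideal \<Longrightarrow> x \<in> NL J lam"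
  unfolding serre_ideal_def NL_def using fa.span_mono[of SIgen "NLgen J lam"] by (auto simp: NLgen_def)

lemma NL_power: "i \<in> J \<Longrightarrow> wd x * gen i ^ Suc (nat (lam i)) \<in> NL J lam"
  unfolding NL_def by (rule fa.span_base) (auto simp: NLgen_def)

lemma NL_cases:
  assumes "lin f" "fa.subspace N" "x \<in> NL J lam" "\<And>x. x \<in> serre_ideal \<Longrightarrow> f x \<in> N"
    "\<And>x i. i \<in> J \<Longrightarrow> f (wd x * gen i ^ Suc (nat (lam i))) \<in> N"
  shows "f x \<in> N"
proof (rule lin_span_subspace[OF assms(1,2) assms(3)[unfolded NL_def]])
  fix g assume "g \<in> NLgen J lam"
  then show "f g \<in> N" unfolding NLgen_def using assms(4,5) serre_ideal_def fa.span_base by blast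
qed

lemma NL_mult_left: assumes "x \<in> NL J lam" shows "b * x \<in> NL J lam"
proof -
  have "wd l * x \<in> NL J lam" for l
  proof (rule NL_cases[OF lin_mult_left[OF lin_id] NL_subspace assms])
    show "wd l * x \<in> NL J lam" if "x \<in> serre_ideal" for x
      using that by (intro NL_serre_ideal serre_ideal_mult_left)
    show "wd l * (wd x * gen i ^ Suc (nat (lam i))) \<in> NL J lam" if "i \<in> J" for x i
      using NL_power[OF that, of "l @ x" lam] by (simp only: wd_append mult.assoc)
  qed
  then show ?thesis by (rule lin_into_subspace[OF lin_mult_right[OF lin_id] NL_subspace])
qed

lemma NL_diag_op:
  assumes "\<And>l l'. mset l = mset l' \<Longrightarrow> g l = g l'" "x \<in> NL J lam"
  shows "diag_op g x \<in> NL J lam"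
  using assms(2) unfolding NL_def
proof (rule span_diag_op[rotated 2])
  fix b assume "b \<in> NLgen J lam"
  then consider "b \<in> SIgen" | x i where "b = wd x * gen i ^ Suc (nat (lam i))"
    unfolding NLgen_def by blast
  then show "\<exists>M. b \<in> hm M"
  proof cases
    case 2
    show ?thesis unfolding 2 using hm_mult[OF hm_wd hm_power[OF hm_gen]] by (rule exI)
  qed (rule SIgen_hm)
qed (rule assms(1))

text \<open>The vector F_i to the power \<lambda>_i + 1 is singular: the sl_2 coefficient for E_i
  contains the factor [\<lambda>_i - \<lambda>_i], and the other E_k commute with F_i. Words
  multiplied on the left only add diagonal rescalings.\<close>

lemma NL_Eop:
  assumes k: "k \<in> I" and J: "J \<subseteq> I" and lam: "\<And>i. i \<in> J \<Longrightarrow> 0 \<le> lam i" and x: "x \<in> NL J lam"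
  shows "Eop lam k x \<in> NL J lam"
proof (rule NL_cases[OF lin_Eop NL_subspace x])
  show "Eop lam k x \<in> NL J lam" if "x \<in> serre_ideal" for x
    using that k by (intro NL_serre_ideal serre_ideal_Eop)
  fix x i assume i: "i \<in> J"
  let ?g = "gen i ^ Suc (nat (lam i)) :: 'i free_alg"
  show "Eop lam k (wd x * ?g) \<in> NL J lam"
  proof (induction x)
    case Nil
    have "Eop lam k ?g = 0"
    proof (cases "k = i")
      case True
      have "Eop lam i (((\<lambda>x. gen i * x) ^^ Suc (nat (lam i))) 1)
        = ((\<lambda>x. gen i * x) ^^ Suc (nat (lam i))) (Eop lam i 1)
          + (qint (v i) (int (Suc (nat (lam i)))) * qint (v i) (lam i - int (nat (lam i)))) *\<^sub>q ((\<lambda>x. gen i * x) ^^ nat (lam i)) 1"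
        by (rule sl2_funpow[where W = "\<lambda>n x. x \<in> Wt lam i n", OF not_root_of_unity_v lin_mult_left[OF lin_id] lin_Eop])
           (use k True Wt_gen_mult[of _ lam i _ i] a_ii[OF k] Wt_wd[of "[]" lam i] in \<open>auto simp: Eop_gen_Wt\<close>)
      then show ?thesis using lam[OF i] by (simp add: funpow_gen Eop_1 True del: power_Suc funpow.simps)
    next
      case False
      have "Eop lam k (gen i ^ n) = 0" for n
        by (induction n) (simp_all add: Eop_1 Eop_gen_other False)
      then show ?thesis .
    qed
    then show ?case by (simp add: NL_0)
  next
    case (Cons g x)
    have "diag_op (\<lambda>l. qint (v k) (lam k - wtp k l)) (wd x * ?g) \<in> NL J lam"
      by (rule NL_diag_op[OF _ NL_power[OF i]]) (metis wtp_mset)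
    then show ?case using Cons
      by (auto simp: wd_Cons mult.assoc Eop_gen_mult simp del: power_Suc intro!: NL_add NL_mult_left)
  qed
qed

text \<open>Whenever m = 1 - a_ij factors F_i stand in front of F_j, the Serre relation moves some
  of them behind it; so fewer than m of the p factors stay in front.\<close>

lemma gen_power_move:
  assumes i: "i \<in> I" and j: "j \<in> I" and ij: "i \<noteq> j"
  defines "m \<equiv> nat (1 - a i j)"
  shows "gen i ^ p * gen j \<in> fa.span (serre_ideal \<union> {gen i ^ s * gen j * gen i ^ t | s t. s + t = p \<and> s < m})"
    (is "_ \<in> fa.span (serre_ideal \<union> ?G p)")
proof (induction p)
  case 0
  have "m > 0" using a_ij[OF i j ij] by (simp add: m_def)
  then have "gen j \<in> ?G 0" by force
  then show ?case by (simp add: fa.span_base)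
next
  case (Suc p)
  have "gen i * (gen i ^ p * gen j) \<in> fa.span (serre_ideal \<union> ?G (Suc p))"
  proof (rule lin_span_subspace[OF lin_mult_left[OF lin_id] _ Suc])
    fix x assume "x \<in> serre_ideal \<union> ?G p"
    then consider "x \<in> serre_ideal" | s t where "x = gen i ^ s * gen j * gen i ^ t" "s + t = p" "s < m" by blast
    then show "gen i * x \<in> fa.span (serre_ideal \<union> ?G (Suc p))"
    proof cases
      case 1
      then show ?thesis by (simp add: serre_ideal_mult_left fa.span_base)
    next
      case 2
      show ?thesis
      proof (cases "Suc s < m")
        case True
        have "gen i * x \<in> ?G (Suc p)"
          by (intro CollectI exI[of _ "Suc s"] exI[of _ t]) (use 2 True in \<open>simp add: mult.assoc\<close>)
        then show ?thesis by (simp add: fa.span_base)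
      next
        case False
        then have s: "m = Suc s" using 2 by simp
        let ?T = "\<lambda>t. (-1) ^ t * free_divpow (v i) (gen i) (m - t) * gen j * free_divpow (v i) (gen i) t"
        have T: "?T u = ((-1) ^ u * inverse (qfact (v i) (m - u)) * inverse (qfact (v i) u)) *\<^sub>q (gen i ^ (m - u) * gen j * gen i ^ u)" for u
          unfolding free_divpow_def scal_minus1_power[symmetric] scal_collect ..
        have "serre_elt i j = ?T 0 + (\<Sum>u\<le>s. ?T (Suc u))"
          unfolding serre_elt_def m_def[symmetric] s sum.atMost_Suc_shift ..
        \<comment> \<open>The Serre relation is solved for its term with all F_i in front, whose
          coefficient 1 / [m]^! is invertible.\<close>
        then have T0: "?T 0 = serre_elt i j - (\<Sum>u\<le>s. ?T (Suc u))" by (simp only: add_diff_cancel_right')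
        have "gen i ^ m * gen j = qfact (v i) m *\<^sub>q ?T 0"
          unfolding T using qfact_nz[OF not_root_of_unity_v[OF i], of m] by (simp add: scal_mult_assoc)
        then have "gen i ^ m * gen j = qfact (v i) m *\<^sub>q (serre_elt i j - (\<Sum>u\<le>s. ?T (Suc u)))"
          unfolding T0 .
        then have "gen i ^ m * gen j * gen i ^ t = qfact (v i) m *\<^sub>q (serre_elt i j * gen i ^ t - (\<Sum>u\<le>s. ?T (Suc u) * gen i ^ t))"
          by (simp only: mult_scal_left left_diff_distrib sum_distrib_right)
        moreover have "gen i * x = gen i ^ m * gen j * gen i ^ t" using 2(1) s by (simp add: mult.assoc)
        moreover have "serre_elt i j * gen i ^ t \<in> fa.span (serre_ideal \<union> ?G (Suc p))"
          by (intro fa.span_base UnI1 serre_ideal_mult_right serre_elt_mem i j ij)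
        moreover have "?T (Suc u) * gen i ^ t \<in> fa.span (serre_ideal \<union> ?G (Suc p))" if "u \<le> s" for u
        proof -
          have "gen i ^ (m - Suc u) * gen j * gen i ^ Suc u * gen i ^ t \<in> ?G (Suc p)"
            by (intro CollectI exI[of _ "m - Suc u"] exI[of _ "Suc u + t"])
               (use 2 s that in \<open>simp add: mult.assoc power_add\<close>)
          then show ?thesis unfolding T mult_scal_left by (intro fa.span_scale fa.span_base UnI2)
        qed
        ultimately show ?thesis
          by (auto intro!: fa.span_scale fa.span_diff fa.span_sum)
      qed
    qed
  qed simp
  then show ?case by (simp add: mult.assoc)
qed

text \<open>Local nilpotency of F_i spreads from the highest weight vector letter by letter: of p
  factors in front of a letter j fewer than 1 - a_ij stay there, so p \<ge> n + (1 - a_ij) leaves at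
  least n to act on the rest of the word.\<close>

lemma gen_nilp_wd:
  assumes i: "i \<in> J" and J: "J \<subseteq> I"
  shows "\<exists>n. \<forall>p\<ge>n. gen i ^ p * wd l \<in> NL J lam"
proof (induction l)
  case Nil
  have "gen i ^ p \<in> NL J lam" if "p \<ge> Suc (nat (lam i))" for p
    using NL_mult_left[OF NL_power[OF i, of "[]" lam], of "gen i ^ (p - Suc (nat (lam i)))"] that
    by (simp flip: power_add power_Suc)
  then show ?case by auto
next
  case (Cons j l)
  then obtain n where n: "\<And>p. p \<ge> n \<Longrightarrow> gen i ^ p * wd l \<in> NL J lam" by blast
  consider "j \<notin> I" | "j = i" | "j \<in> I" "j \<noteq> i" by blast
  then show ?case
  proof cases
    case 1
    then have "wd (j # l) \<in> serre_ideal" by (intro serre_ideal_bad) auto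
    then show ?thesis by (auto intro: NL_serre_ideal serre_ideal_mult_left)
  next
    case 2
    have "gen i ^ p * wd (j # l) \<in> NL J lam" if "p \<ge> n" for p
      using n[of "Suc p"] that unfolding 2 wd_Cons power_Suc2 by (simp add: mult.assoc)
    then show ?thesis by blast
  next
    case 3
    let ?m = "nat (1 - a i j)"
    have "gen i ^ p * wd (j # l) \<in> NL J lam" if p: "p \<ge> n + ?m" for p
      unfolding wd_Cons mult.assoc[symmetric]
    proof (rule lin_span_subspace[OF lin_mult_right[OF lin_id] NL_subspace gen_power_move])
      fix x assume "x \<in> serre_ideal \<union> {gen i ^ s * gen j * gen i ^ t | s t. s + t = p \<and> s < ?m}"
      then consider "x \<in> serre_ideal" | s t where "x = gen i ^ s * gen j * gen i ^ t" "s + t = p" "s < ?m" by blast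
      then show "x * wd l \<in> NL J lam"
      proof cases
        case 1
        then show ?thesis by (intro NL_serre_ideal serre_ideal_mult_right)
      next
        case 2
        then have "gen i ^ t * wd l \<in> NL J lam" using n p by auto
        then show ?thesis using 2(1) by (simp add: mult.assoc NL_mult_left)
      qed
    qed (use 3 i J in auto)
    then show ?thesis by blast
  qed
qed

lemma gen_nilp:
  assumes i: "i \<in> J" and J: "J \<subseteq> I"
  shows "\<exists>n. \<forall>p\<ge>n. gen i ^ p * x \<in> NL J lam"
  using free_alg_eventually[of "\<lambda>p. {x. gen i ^ p * x \<in> NL J lam}" x]
    subspace_vimage[OF lin_mult_left[OF lin_id] NL_subspace] gen_nilp_wd[OF i J]
  by auto

lemma F_power:
  assumes i: "i \<in> I" and x: "x \<in> Wt lam i n"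
  shows "Eop lam i (gen i ^ Suc s * x) = gen i ^ Suc s * Eop lam i x
    + (qint (v i) (int (Suc s)) * qint (v i) (n - int s)) *\<^sub>q (gen i ^ s * x)"
  unfolding funpow_gen[symmetric]
  by (rule sl2_funpow[where W = "\<lambda>n x. x \<in> Wt lam i n", OF not_root_of_unity_v[OF i] lin_mult_left[OF lin_id] lin_Eop])
     (use x Wt_gen_mult[of _ lam i _ i] a_ii[OF i] in \<open>auto simp: Eop_gen_Wt\<close>)

lemma E_power:
  assumes i: "i \<in> I" and x: "x \<in> Wt lam i (- n)"
  shows "gen i * (Eop lam i ^^ Suc s) x = (Eop lam i ^^ Suc s) (gen i * x)
    + (qint (v i) (int (Suc s)) * qint (v i) (n - int s)) *\<^sub>q (Eop lam i ^^ s) x"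
proof -
  have w: "x \<in> Wt lam i (- n) \<Longrightarrow> Eop lam i x \<in> Wt lam i (2 - n)" for n x
    using Wt_Eop[of x lam i "- n" i] a_ii[OF i] by simp
  show ?thesis
  by (rule sl2_funpow[where W = "\<lambda>n x. x \<in> Wt lam i (-n)" and Z = "\<lambda>x. gen i * x", OF not_root_of_unity_v[OF i] lin_Eop lin_mult_left[OF lin_id]])
     (use x w in \<open>auto simp: Eop_gen_Wt qint_minus scal_uminus\<close>)
qed

section \<open>Non-degeneracy\<close>

lemma skew_der_nilp:
  assumes i: "i \<in> I" shows "\<exists>n. \<forall>m\<ge>n. (skew_der \<epsilon> i ^^ m) x \<in> serre_ideal"
proof -
  have sub: "fa.subspace {x. (skew_der \<epsilon> i ^^ m) x \<in> serre_ideal}" for m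
    by (intro subspace_vimage lin_funpow lin_skew_der serre_ideal_subspace)
  have w: "\<exists>n. \<forall>m\<ge>n. (skew_der \<epsilon> i ^^ m) (wd l) \<in> serre_ideal" for l
  proof -
    have "\<forall>m\<ge>Suc (length l). (skew_der \<epsilon> i ^^ m) (wd l) \<in> serre_ideal" 
    proof (induction "length l" arbitrary: l rule: less_induct)
      case less
      show ?case
      proof (intro allI impI)
        fix m assume "m \<ge> Suc (length l)"
        then obtain k where k: "m = Suc k" "k \<ge> length l" by (cases m) auto
        have "(skew_der \<epsilon> i ^^ k) (skew_der \<epsilon> i (wd l)) \<in> serre_ideal"
        proof (rule homog_lin[OF lin_funpow[OF lin_skew_der] serre_ideal_subspace _ skew_der_hm[OF hm_wd]])
          fix l' assume "add_mset i (mset l') = mset l"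
          then have "length l' < length l" by (metis size_add_mset size_mset lessI)
          then show "(skew_der \<epsilon> i ^^ k) (wd l') \<in> serre_ideal" using less[of l'] k by auto
        qed
        then show "(skew_der \<epsilon> i ^^ m) (wd l) \<in> serre_ideal" by (simp add: k funpow_swap1)
      qed
    qed
    then show ?thesis by blast
  qed
  show ?thesis using free_alg_eventually[OF sub, where x = x] w by auto
qed

lemma serre_ideal_skew_der_funpow: "i \<in> I \<Longrightarrow> x \<in> serre_ideal \<Longrightarrow> (skew_der \<epsilon> i ^^ n) x \<in> serre_ideal"
  by (induction n) (simp_all add: serre_ideal_skew_der)

text \<open>
  The \<open>q\<close>-boson relation \<open>r\<^sub>i (x F\<^sub>i) = v\<^sub>i\<^sup>-\<^sup>2 r\<^sub>i(x) F\<^sub>i + x\<close> allows a descent from \<open>r\<^sub>i\<^sup>n x = 0\<close> for large \<open>n\<close>.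
\<close>

lemma skew_der_kernel_image:
  assumes i: "i \<in> I" and x: "skew_der (-1) i (x * gen i) \<in> serre_ideal"
  shows "x \<in> serre_ideal"
proof -
  define q where "q = v i powi (-2)"
  let ?D = "skew_der (-1) i"
  have q: "not_root_of_unity q" unfolding q_def by (intro not_root_of_unity_powi not_root_of_unity_v i) simp
  have r1: "?D (x * gen i) = q *\<^sub>q (?D x * gen i) + x" for x
    using skew_der_mult_gen[OF i, of "-1" x i] a_ii[OF i] by (simp add: q_def)
  have step: "(?D ^^ k) (x * gen i) = (q ^ k) *\<^sub>q ((?D ^^ k) x * gen i) + (\<Sum>t<k. q ^ t) *\<^sub>q (?D ^^ (k - 1)) x" for k
  proof (induction k)
    case (Suc k)
    have "(\<Sum>t<k. q ^ t) *\<^sub>q ?D ((?D ^^ (k - 1)) x) = (\<Sum>t<k. q ^ t) *\<^sub>q (?D ^^ k) x"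
      by (cases k) simp_all
    then show ?case
      by (simp add: Suc lin_add[OF lin_skew_der] lin_scal[OF lin_skew_der] r1 distrib_left scal_mult_assoc scal_add distrib_right mult.commute[of _ q])
  qed simp
  have "(?D ^^ Suc n) x \<in> serre_ideal \<Longrightarrow> (?D ^^ n) x \<in> serre_ideal" for n
  proof -
    assume a: "(?D ^^ Suc n) x \<in> serre_ideal"
    define s where "s = (\<Sum>t<Suc n. q ^ t)"
    have "(1 - q) * s = 1 - q ^ Suc n" unfolding s_def by (rule one_diff_power_eq[symmetric])
    moreover have "q ^ Suc n \<noteq> 1" using not_root_of_unityD(2)[OF q, of "int (Suc n)"] by (simp only: power_int_of_nat) auto
    ultimately have s: "s \<noteq> 0" by auto
    have "(?D ^^ Suc n) (x * gen i) \<in> serre_ideal"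
      using serre_ideal_skew_der_funpow[OF i x, of n "-1"] by (simp add: funpow_swap1)
    then have "s *\<^sub>q (?D ^^ n) x \<in> serre_ideal"
      using step[of "Suc n"] serre_ideal_smul[OF serre_ideal_mult_right[OF a, of "gen i"], of "q ^ Suc n"] serre_ideal_diff
      by (fastforce simp: s_def simp del: funpow.simps power_Suc sum.lessThan_Suc)
    then have "inverse s *\<^sub>q s *\<^sub>q (?D ^^ n) x \<in> serre_ideal" by (rule serre_ideal_smul)
    then show ?thesis using s by (simp add: scal_mult_assoc)
  qed
  moreover obtain n where "(?D ^^ n) x \<in> serre_ideal" using skew_der_nilp[OF i] by blast
  ultimately have "(?D ^^ 0) x \<in> serre_ideal" by (induction n) auto
  then show ?thesis by simp
qed

lemma serre_ideal_of_skew_der_i: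
  assumes i: "i \<in> I" and y: "y \<in> hm (mset l)" and pos: "wtp i l > 0"
    and r: "skew_der (-1) i y \<in> serre_ideal" "skew_der 1 i y \<in> serre_ideal"
  shows "y \<in> serre_ideal"
proof -
  let ?N = "NL {i} (\<lambda>_. 0)"
  let ?E = "Eop (\<lambda>_. 0) i"
  \<comment> \<open>E_i is a combination of both skew derivations, so both vanishing assumptions
    enter here.\<close>
  have E: "?E y \<in> serre_ideal" unfolding Eop_skew_der[OF i] by (intro serre_ideal_smul serre_ideal_diff r)
  have W: "y \<in> Wt (\<lambda>_. 0) i (- wtp i l)"
    unfolding Wt_def using y by (rule hm_homog) (metis diff_0 wtp_mset)
  \<comment> \<open>The coefficient [s + 1][-w - s] with w = \<open>wtp i l\<close> > 0 never
    vanishes, so from some power of F_i killing y one descends to the power 0.\<close>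
  have step: "gen i ^ s * y \<in> ?N" if "gen i ^ Suc s * y \<in> ?N" for s
  proof -
    define c where "c = qint (v i) (int (Suc s)) * qint (v i) (- wtp i l - int s)"
    have c: "c \<noteq> 0" unfolding c_def using pos qint_nz[OF not_root_of_unity_v[OF i]] by (simp del: of_nat_Suc)
    have "c *\<^sub>q (gen i ^ s * y) = ?E (gen i ^ Suc s * y) - gen i ^ Suc s * ?E y"
      unfolding F_power[OF i W] c_def by simp
    also have "\<dots> \<in> ?N" by (rule NL_diff[OF NL_Eop NL_serre_ideal[OF serre_ideal_mult_left[OF E]]]) (use that i in \<open>simp_all del: power_Suc\<close>)
    finally have "inverse c *\<^sub>q c *\<^sub>q (gen i ^ s * y) \<in> ?N" by (rule NL_smul)
    then show ?thesis using c by (simp add: scal_mult_assoc)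
  qed
  obtain n where "gen i ^ n * y \<in> ?N" using gen_nilp[of i "{i}"] i by blast
  then have "gen i ^ 0 * y \<in> ?N" by (induction n) (auto intro: step simp del: power_Suc)
  then have "y \<in> ?N" by simp
  \<comment> \<open>For highest weight 0 the adjoined generators are the words ending in a single
    F_i, so the elements of \<open>?N\<close> are those congruent to some x F_i.\<close>
  moreover have "fa.subspace {y. \<exists>x. y - x * gen i \<in> serre_ideal}"
  proof (rule fa.subspaceI)
    have "0 - 0 * gen i \<in> serre_ideal" by (simp add: serre_ideal_0)
    then show "0 \<in> {y. \<exists>x. y - x * gen i \<in> serre_ideal}" by blast
  next
    fix y y' assume "y \<in> {y. \<exists>x. y - x * gen i \<in> serre_ideal}" "y' \<in> {y. \<exists>x. y - x * gen i \<in> serre_ideal}"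
    then obtain x x' where "y - x * gen i \<in> serre_ideal" "y' - x' * gen i \<in> serre_ideal" by auto
    then have "(y + y') - (x + x') * gen i \<in> serre_ideal" using serre_ideal_add by (fastforce simp: algebra_simps)
    then show "y + y' \<in> {y. \<exists>x. y - x * gen i \<in> serre_ideal}" by blast
  next
    fix c y assume "y \<in> {y. \<exists>x. y - x * gen i \<in> serre_ideal}"
    then obtain x where "y - x * gen i \<in> serre_ideal" by auto
    then have "c *\<^sub>q (y - x * gen i) \<in> serre_ideal" by (rule serre_ideal_smul)
    then have "c *\<^sub>q y - (c *\<^sub>q x) * gen i \<in> serre_ideal" by (simp add: right_diff_distrib mult.assoc)
    then show "c *\<^sub>q y \<in> {y. \<exists>x. y - x * gen i \<in> serre_ideal}" by blast
  qed
  then have "y \<in> {y. \<exists>x. y - x * gen i \<in> serre_ideal}" if "y \<in> ?N" for y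
  proof (rule NL_cases[OF lin_id _ that])
    fix y assume "y \<in> serre_ideal"
    then have "y - 0 * gen i \<in> serre_ideal" by simp
    then show "y \<in> {y. \<exists>x. y - x * gen i \<in> serre_ideal}" by blast
  next
    fix x j assume "j \<in> {i}"
    then have "wd x * gen j ^ Suc (nat 0) - wd x * gen i \<in> serre_ideal" by (simp add: serre_ideal_0)
    then show "wd x * gen j ^ Suc (nat 0) \<in> {y. \<exists>x. y - x * gen i \<in> serre_ideal}" by blast
  qed
  ultimately obtain x where x: "y - x * gen i \<in> serre_ideal" by blast
  have "skew_der (-1) i (x * gen i) = skew_der (-1) i y - skew_der (-1) i (y - x * gen i)"
    by (simp add: lin_diff[OF lin_skew_der])
  then have "skew_der (-1) i (x * gen i) \<in> serre_ideal" using r(1) serre_ideal_skew_der[OF i x] by (simp add: serre_ideal_diff)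
  then have "x \<in> serre_ideal" by (rule skew_der_kernel_image[OF i])
  then show ?thesis using serre_ideal_add[OF x serre_ideal_mult_right, of x "gen i"] by simp
qed

lemma hm_bad: "x \<in> hm M \<Longrightarrow> \<not> set_mset M \<subseteq> I \<Longrightarrow> x \<in> serre_ideal"
  unfolding hm_def
  by (erule homog_lin[OF lin_id serre_ideal_subspace, rotated]) (metis serre_ideal_bad set_mset_mset)

lemma wtp_count:
  assumes "set l \<subseteq> I" shows "wtp i l = (\<Sum>j\<in>I. a i j * int (count (mset l) j))"
  using assms
proof (induction l)
  case (Cons k l)
  have "(\<Sum>j\<in>I. a i j * int (count (mset (k # l)) j)) = (\<Sum>j\<in>I. a i j * int (count (mset l) j) + (if j = k then a i j else 0))"
    by (intro sum.cong) (auto simp: algebra_simps)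
  also have "\<dots> = wtp i l + a i k" using Cons finite_index_I by (simp add: sum.distrib)
  finally show ?case by simp
qed simp

text \<open>With c_i the multiplicities of the letters and \<nu> the sum of their simple roots, 0 <
  (\<nu>, \<nu>) = \<Sum> c_i d_i \<langle>h_i, \<nu>\<rangle> with all c_i d_i \<ge> 0; so some
  pairing is positive.\<close>

lemma exists_wtp_pos:
  assumes "set l \<subseteq> I" "l \<noteq> []" shows "\<exists>i\<in>I. wtp i l > 0"
proof (rule ccontr)
  assume "\<not> ?thesis"
  then have neg: "\<And>i. i \<in> I \<Longrightarrow> wtp i l \<le> 0" by force
  let ?c = "\<lambda>i. int (count (mset l) i)"
  have "(\<Sum>i\<in>I. \<Sum>j\<in>I. ?c i * (d i * a i j) * ?c j) = (\<Sum>i\<in>I. ?c i * d i * wtp i l)"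
    by (intro sum.cong refl) (simp add: wtp_count[OF assms(1)] sum_distrib_left mult_ac)
  also have "\<dots> \<le> 0"
    using neg d_pos by (intro sum_nonpos mult_nonneg_nonpos mult_nonneg_nonneg) (auto intro: less_imp_le)
  finally have "\<not> (\<exists>i\<in>I. ?c i \<noteq> 0)" using pos_def[of ?c] by linarith
  moreover have "hd l \<in> I" "?c (hd l) \<noteq> 0" using assms by auto
  ultimately show False by blast
qed

text \<open>For the i with positive pairing, the derivation with 1 must be controlled too. Its value
  on y has smaller degree and, by q-commutation, is again sent into the Serre subspace by all
  derivations with -1, so the induction hypothesis applies to it.\<close>

lemma serre_ideal_of_skew_der:
  assumes "y \<in> hm M" "M \<noteq> {#}" "\<And>k. k \<in> I \<Longrightarrow> skew_der (-1) k y \<in> serre_ideal"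
  shows "y \<in> serre_ideal"
  using assms
proof (induction "size M" arbitrary: M y rule: less_induct)
  case less
  show ?case
  proof (cases "set_mset M \<subseteq> I")
    case True
    obtain l where l: "mset l = M" using ex_mset by blast
    have "set l \<subseteq> I" "l \<noteq> []" using True less.prems(2) l by auto
    then obtain i where i: "i \<in> I" "wtp i l > 0" using exists_wtp_pos by blast
    have "skew_der 1 i y \<in> serre_ideal"
    proof (cases "i \<in># M")
      case True
      then obtain M' where M': "M = add_mset i M'" by (metis multi_member_split)
      have y': "skew_der 1 i y \<in> hm M'" using less.prems(1) unfolding M' by (rule skew_der_hm')
      show ?thesis
      \<comment> \<open>In degree 0 the induction hypothesis says nothing, but there y is a multiple
        of F_i, on which both derivations agree.\<close>
      proof (cases "M' = {#}")
        case True
        then have "y \<in> hm {#i#}" using less.prems(1) M' by simp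
        from hm_single[OF this] obtain c where "y = c *\<^sub>q gen i" by blast
        then show ?thesis using less.prems(3)[OF i(1)] by (simp add: lin_scal[OF lin_skew_der] skew_der_gen[OF i(1)])
      next
        case False
        have "skew_der (-1) k (skew_der 1 i y) \<in> serre_ideal" if "k \<in> I" for k
          unfolding skew_der_commute[OF that i(1)] by (intro serre_ideal_smul serre_ideal_skew_der i less.prems(3) that)
        then show ?thesis using less.hyps[OF _ y' False] M' by simp
      qed
    next
      case False
      then show ?thesis using skew_der_not_in[OF less.prems(1)] by (simp add: serre_ideal_0)
    qed
    then show ?thesis using serre_ideal_of_skew_der_i[OF i(1) _ i(2)] less.prems l i by blast
  next
    case False
    then show ?thesis using less.prems(1) by (rule hm_bad[rotated])
  qed
qed

section \<open>The pairing of the raising with the lowering part\<close>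

definition e0 :: "'i free_alg \<Rightarrow> 'i free_alg" where
  "e0 = diag_op (\<lambda>l. if l = [] then 1 else 0)"

lemma lin_e0: "lin e0"
  by (simp add: e0_def lin_diag_op)

lemma e0_1: "e0 1 = 1"
  using diag_op_wd[of "\<lambda>l. if l = [] then 1 else 0" "[]"] by (simp add: e0_def)

lemma e0_mult_gen: "e0 (x * gen i) = 0"
proof -
  have "e0 (wd l * gen i) = 0" for l
    using diag_op_wd[of "\<lambda>l. if l = [] then 1 else 0" "l @ [i]"] by (simp add: e0_def wd_append wd_single)
  then show ?thesis by (rule lin_eqI[OF lin_comp[OF lin_e0 lin_mult_right[OF lin_id]] lin_zero])
qed

text \<open>Followed by the constant term this is, up to normalisation, the pairing of U^+ with U^-:
  the first argument is the E-part, written in the same letters, and each E_k acts through its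
  leading skew derivation.\<close>

abbreviation ract :: "'i free_alg \<Rightarrow> 'i free_alg \<Rightarrow> 'i free_alg" where
  "ract \<equiv> act (skew_der (-1))"

text \<open>Each derivation applied to z F_l either passes F_l at the cost of a scalar, or removes
  it. Collecting the removals over the positions in \<open>b\<close> reproduces the skew derivation
  of the word \<open>b\<close>; the scalars agree by v_k^(a_kl) = v_l^(a_lk).\<close>

lemma ract_mult_gen:
  assumes "set b \<subseteq> I" and l: "l \<in> I"
  shows "\<exists>c. \<forall>z. ract (wd b) (z * gen l) = c *\<^sub>q (ract (wd b) z * gen l) + ract (skew_der (-1) l (wd b)) z"
  using assms(1)
proof (induction b rule: rev_induct)
  case Nil
  then show ?case by (intro exI[of _ 1]) (simp add: skew_der_1 lin_0[OF lin_act_left])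
next
  case (snoc k b)
  then have k: "k \<in> I" by simp
  obtain c where c: "\<And>z. ract (wd b) (z * gen l) = c *\<^sub>q (ract (wd b) z * gen l) + ract (skew_der (-1) l (wd b)) z"
    using snoc by auto
  note lb = lin_act[of "skew_der (-1)", OF lin_skew_der]
  note la = lin_act_left[of "skew_der (-1)"]
  define e where "e = v k powi (- a k l)"
  have e: "e = v l powi (- a l k)" using v_sym[OF k l] by (simp add: e_def power_int_minus)
  have "ract (wd (b @ [k])) (z * gen l) = (e * c) *\<^sub>q (ract (wd (b @ [k])) z * gen l) + ract (skew_der (-1) l (wd (b @ [k]))) z" for z
  proof -
    have "ract (wd (b @ [k])) (z * gen l) = ract (wd b) (e *\<^sub>q (skew_der (-1) k z * gen l) + (if k = l then z else 0))"
      using skew_der_mult_gen[OF k, of "-1" z l] by (simp add: wd_append wd_single act_mult[OF lin_skew_der] e_def)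
    also have "\<dots> = e *\<^sub>q (c *\<^sub>q (ract (wd b) (skew_der (-1) k z) * gen l) + ract (skew_der (-1) l (wd b)) (skew_der (-1) k z))
      + (if k = l then ract (wd b) z else 0)"
      by (simp add: lin_add[OF lb] lin_scal[OF lb] lin_0[OF lb] c)
    also have "e *\<^sub>q ract (skew_der (-1) l (wd b)) (skew_der (-1) k z) + (if k = l then ract (wd b) z else 0)
      = ract (skew_der (-1) l (wd (b @ [k]))) z"
      using skew_der_mult_gen[OF l, of "-1" "wd b" k]
      by (auto simp: wd_append wd_single e[symmetric] lin_add[OF la] lin_scal[OF la] lin_0[OF la] act_mult[OF lin_skew_der])
    then have "e *\<^sub>q (c *\<^sub>q (ract (wd b) (skew_der (-1) k z) * gen l) + ract (skew_der (-1) l (wd b)) (skew_der (-1) k z))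
      + (if k = l then ract (wd b) z else 0) = (e * c) *\<^sub>q (ract (wd b) (skew_der (-1) k z) * gen l) + ract (skew_der (-1) l (wd (b @ [k]))) z"
      by (simp add: distrib_left scal_mult_assoc add.assoc)
    finally show ?thesis by (simp add: wd_append wd_single act_mult[OF lin_skew_der])
  qed
  then show ?case by blast
qed

text \<open>The term that keeps F_l on the right has no constant term.\<close>

lemma pairing_adjoint:
  assumes l: "l \<in> I" and X: "X \<in> hm M" and M: "set_mset M \<subseteq> I"
  shows "e0 (ract X (z * gen l)) = e0 (ract (skew_der (-1) l X) z)"
proof (rule homog_eq[OF _ _ _ X[unfolded hm_def]])
  show "lin (\<lambda>X. e0 (ract X (z * gen l)))" by (rule lin_comp[OF lin_e0 lin_act_left])
  show "lin (\<lambda>X. e0 (ract (skew_der (-1) l X) z))" by (rule lin_comp[OF lin_e0 lin_comp[OF lin_act_left lin_skew_der]])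
  fix b assume "mset b = M"
  then have "set b \<subseteq> I" using M by auto
  from ract_mult_gen[OF this l] show "e0 (ract (wd b) (z * gen l)) = e0 (ract (skew_der (-1) l (wd b)) z)"
    by (auto simp: lin_add[OF lin_e0] lin_scal[OF lin_e0] e0_mult_gen)
qed

text \<open>Some skew derivation with -1 leaves X outside the Serre subspace; a witness for the
  result, extended on the right by the letter in question, is a witness for X by
  adjointness.\<close>

lemma pairing_nondegenerate:
  assumes "X \<in> hm M" "X \<notin> serre_ideal"
  shows "\<exists>z. mset z = M \<and> e0 (ract X (wd z)) \<noteq> 0"
  using assms
proof (induction "size M" arbitrary: M X)
  case 0
  then obtain c where c: "X = scal c" using hm_empty by auto
  have "X \<noteq> 0" using 0 serre_ideal_0 by metis
  moreover have "e0 (ract X (wd [])) = X" using lin_scal[OF lin_e0, of c 1] by (simp add: e0_1 c)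
  ultimately show ?case using 0 by (intro exI[of _ "[]"]) simp
next
  case (Suc n)
  have M: "set_mset M \<subseteq> I" using Suc.prems hm_bad by blast
  have "M \<noteq> {#}" using Suc.hyps(2) by auto
  then obtain l where l: "l \<in> I" "skew_der (-1) l X \<notin> serre_ideal" using serre_ideal_of_skew_der[OF Suc.prems(1)] Suc.prems(2) by blast
  then have "l \<in># M" using skew_der_not_in[OF Suc.prems(1)] serre_ideal_0 by force
  then obtain M' where M': "M = add_mset l M'" by (metis multi_member_split)
  have "skew_der (-1) l X \<in> hm M'" using Suc.prems(1) unfolding M' by (rule skew_der_hm')
  then obtain z where z: "mset z = M'" "e0 (ract (skew_der (-1) l X) (wd z)) \<noteq> 0"
    using Suc.hyps(1)[of M' "skew_der (-1) l X"] l Suc.hyps(2) M' by auto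
  have "e0 (ract X (wd (z @ [l]))) \<noteq> 0"
    using z pairing_adjoint[OF l(1) Suc.prems(1) M, of "wd z"] by (simp add: wd_append wd_single)
  then show ?case using z M' by (intro exI[of _ "z @ [l]"]) simp
qed

end

section \<open>Positive definite forms\<close>

text \<open>Cauchy-Schwarz with a cruder constant, obtained one variable at a time from (a + b)^2
  \<le> 2 a^2 + 2 b^2.\<close>

lemma linear_form_bound:
  assumes "finite J"
  shows "\<exists>b\<ge>0. \<forall>x. (\<Sum>j\<in>J. f j * x j)\<^sup>2 \<le> b * (\<Sum>j\<in>J. (x j)\<^sup>2 :: real)"
  using assms
proof (induction J)
  case (insert k J)
  then obtain b where b: "b \<ge> 0" "\<And>x. (\<Sum>j\<in>J. f j * x j)\<^sup>2 \<le> b * (\<Sum>j\<in>J. (x j)\<^sup>2)" by blast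
  have "(\<Sum>j\<in>insert k J. f j * x j)\<^sup>2 \<le> (2 * (f k)\<^sup>2 + 2 * b) * (\<Sum>j\<in>insert k J. (x j)\<^sup>2)" for x
  proof -
    let ?S = "\<Sum>j\<in>J. f j * x j" and ?X = "\<Sum>j\<in>J. (x j)\<^sup>2"
    have "(f k * x k + ?S)\<^sup>2 \<le> 2 * (f k * x k)\<^sup>2 + 2 * ?S\<^sup>2"
      using zero_le_power2[of "f k * x k - ?S"] by (simp add: power2_eq_square algebra_simps)
    also have "\<dots> \<le> 2 * (f k)\<^sup>2 * (x k)\<^sup>2 + 2 * (b * ?X)"
      using b(2)[of x] by (simp add: power_mult_distrib)
    also have "\<dots> \<le> (2 * (f k)\<^sup>2 + 2 * b) * ((x k)\<^sup>2 + ?X)"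
      using b(1) by (simp add: algebra_simps sum_nonneg)
    finally show ?thesis using insert by simp
  qed
  then show ?case using b(1) by (intro exI[of _ "2 * (f k)\<^sup>2 + 2 * b"]) auto
qed auto

text \<open>Completing the square in one variable leaves the Schur complement \<open>g\<close> as a
  form in the others, again positive definite; the bounds for the square and for \<open>g\<close>
  combine into one for \<open>f\<close>.\<close>

lemma pos_def_coercive:
  fixes f :: "'i \<Rightarrow> 'i \<Rightarrow> real"
  assumes "finite I" "\<And>i j. i \<in> I \<Longrightarrow> j \<in> I \<Longrightarrow> f i j = f j i"
    "\<And>x. (\<exists>i\<in>I. x i \<noteq> 0) \<Longrightarrow> 0 < (\<Sum>i\<in>I. \<Sum>j\<in>I. x i * f i j * x j)"
  shows "\<exists>e>0. \<forall>x. e * (\<Sum>i\<in>I. (x i)\<^sup>2) \<le> (\<Sum>i\<in>I. \<Sum>j\<in>I. x i * f i j * x j)"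
  using assms
proof (induction I arbitrary: f)
  case empty
  then show ?case by (auto intro: exI[of _ 1])
next
  case (insert k J)
  let ?Q = "\<lambda>x. \<Sum>i\<in>insert k J. \<Sum>j\<in>insert k J. x i * f i j * x j"
  let ?B = "\<lambda>x. \<Sum>j\<in>J. f k j * x j"
  define p where "p = f k k"
  have Q: "?Q x = p * (x k)\<^sup>2 + 2 * x k * ?B x + (\<Sum>i\<in>J. \<Sum>j\<in>J. x i * f i j * x j)" for x
  proof -
    have "(\<Sum>i\<in>J. x i * f i k * x k) = x k * ?B x"
      unfolding sum_distrib_left by (intro sum.cong refl) (use insert.prems(1) in \<open>auto simp: mult_ac\<close>)
    moreover have "(\<Sum>j\<in>J. x k * f k j * x j) = x k * ?B x"
      unfolding sum_distrib_left by (simp add: mult_ac)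
    ultimately show ?thesis
      using insert.hyps by (simp add: sum.distrib p_def power2_eq_square algebra_simps)
  qed
  have p: "p > 0"
  proof -
    let ?x = "\<lambda>i. if i = k then 1 else 0 :: real"
    have "(\<Sum>j\<in>J. f k j * ?x j) = 0" "(\<Sum>i\<in>J. \<Sum>j\<in>J. ?x i * f i j * ?x j) = 0"
      using insert.hyps by (auto intro!: sum.neutral)
    then show ?thesis using insert.prems(2)[of ?x] Q[of ?x] by simp
  qed
  define g where "g i j = f i j - f k i * f k j / p" for i j
  have G: "(\<Sum>i\<in>J. \<Sum>j\<in>J. x i * g i j * x j) = (\<Sum>i\<in>J. \<Sum>j\<in>J. x i * f i j * x j) - (?B x)\<^sup>2 / p" for x
  proof -
    have "(?B x)\<^sup>2 = (\<Sum>i\<in>J. \<Sum>j\<in>J. f k i * x i * (f k j * x j))"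
      by (simp add: power2_eq_square sum_product)
    then show ?thesis
      by (simp add: g_def sum_divide_distrib sum_subtractf[symmetric] algebra_simps)
  qed
  have QG: "?Q x = p * (x k + ?B x / p)\<^sup>2 + (\<Sum>i\<in>J. \<Sum>j\<in>J. x i * g i j * x j)" for x
    unfolding Q G using p by (simp add: power2_eq_square field_simps)
  have "\<exists>e>0. \<forall>x. e * (\<Sum>i\<in>J. (x i)\<^sup>2) \<le> (\<Sum>i\<in>J. \<Sum>j\<in>J. x i * g i j * x j)"
  proof (rule insert.IH)
    show "g i j = g j i" if "i \<in> J" "j \<in> J" for i j
      using that insert.prems(1) by (simp add: g_def mult.commute)
    fix x :: "'i \<Rightarrow> real" assume x: "\<exists>i\<in>J. x i \<noteq> 0"
    \<comment> \<open>Coordinate k is set so that the completed square vanishes; then positivity of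
      \<open>f\<close> at y is positivity of \<open>g\<close> at x.\<close>
    define y where "y = x(k := - ?B x / p)"
    have yx: "y j = x j" if "j \<in> J" for j using that insert.hyps by (auto simp: y_def)
    have "0 < ?Q y" by (rule insert.prems(2)) (use x yx in force)
    moreover have "?B y = ?B x" using yx by (intro sum.cong) auto
    moreover have "(\<Sum>i\<in>J. \<Sum>j\<in>J. y i * g i j * y j) = (\<Sum>i\<in>J. \<Sum>j\<in>J. x i * g i j * x j)"
      using yx by (intro sum.cong refl) auto
    ultimately show "0 < (\<Sum>i\<in>J. \<Sum>j\<in>J. x i * g i j * x j)"
      unfolding QG by (simp add: y_def)
  qed
  then obtain e where e: "e > 0" "\<And>x. e * (\<Sum>i\<in>J. (x i)\<^sup>2) \<le> (\<Sum>i\<in>J. \<Sum>j\<in>J. x i * g i j * x j)" by blast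
  obtain b where b: "b \<ge> 0" "\<And>x. (?B x)\<^sup>2 \<le> b * (\<Sum>j\<in>J. (x j)\<^sup>2)"
    using linear_form_bound[OF insert.hyps(1), of "f k"] by blast
  \<comment> \<open>With |x| the norm over J, the inequalities x_k^2 \<le> 2 (x_k + B/p)^2 + 2
    (B/p)^2, B^2 \<le> b |x|^2 and e |x|^2 \<le> g(x) bound x_k^2 + |x|^2 by a combination of p (x_k
    + B/p)^2 and g(x); M is the sum of the two coefficients.\<close>
  define M where "M = 2 / p + (2 * b / p\<^sup>2 + 1) / e"
  have M: "M > 0" unfolding M_def using p e(1) b(1) by (intro add_pos_nonneg) auto
  have "(\<Sum>i\<in>insert k J. (x i)\<^sup>2) \<le> M * ?Q x" for x
  proof -
    let ?X = "\<Sum>j\<in>J. (x j)\<^sup>2" and ?G = "\<Sum>i\<in>J. \<Sum>j\<in>J. x i * g i j * x j"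
    let ?y = "x k + ?B x / p"
    have X0: "?X \<ge> 0" by (simp add: sum_nonneg)
    have G0: "?G \<ge> 0" using e(2)[of x] e(1) X0 by (smt (verit) mult_nonneg_nonneg)
    have "(x k)\<^sup>2 \<le> 2 * ?y\<^sup>2 + 2 * (?B x / p)\<^sup>2"
      using zero_le_power2[of "?y + ?B x / p"] by (simp add: power2_eq_square algebra_simps)
    also have "(?B x / p)\<^sup>2 \<le> b * ?X / p\<^sup>2"
      using b(2)[of x] p by (simp add: power_divide divide_right_mono)
    finally have "(x k)\<^sup>2 + ?X \<le> 2 * ?y\<^sup>2 + (2 * b / p\<^sup>2 + 1) * ?X"
      by (simp add: algebra_simps)
    also have "\<dots> \<le> 2 / p * (p * ?y\<^sup>2) + (2 * b / p\<^sup>2 + 1) * (?G / e)"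
      using e p b(1) by (intro add_mono mult_left_mono) (auto simp: field_simps)
    also have "\<dots> = 2 / p * (p * ?y\<^sup>2) + (2 * b / p\<^sup>2 + 1) / e * ?G" by simp
    also have "\<dots> \<le> M * (p * ?y\<^sup>2) + M * ?G"
      using p e(1) b(1) G0 by (intro add_mono mult_right_mono) (auto simp: M_def)
    finally show ?thesis unfolding QG using insert.hyps by (simp add: distrib_left)
  qed
  then have "1 / M * (\<Sum>i\<in>insert k J. (x i)\<^sup>2) \<le> ?Q x" for x
    using M by (simp add: divide_le_eq mult.commute)
  then show ?case using M by (intro exI[of _ "1 / M"]) auto
qed

text \<open>By coercivity the quadratic part outgrows the linear one, which confines the integral
  points to a box. Finiteness of Weyl group orbits and of the set of dominant weights below a
  weight, and existence of a regular weight, all rest on sets of this form.\<close>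

lemma pos_def_finite:
  fixes f :: "'i \<Rightarrow> 'i \<Rightarrow> int" and L :: "'i \<Rightarrow> int"
  assumes I: "finite I" and sym: "\<And>i j. i \<in> I \<Longrightarrow> j \<in> I \<Longrightarrow> f i j = f j i" and form_finite_type: "finite_type I f"
  shows "finite {c. (\<forall>i. i \<notin> I \<longrightarrow> c i = 0) \<and> (\<Sum>i\<in>I. \<Sum>j\<in>I. c i * f i j * c j) + (\<Sum>i\<in>I. L i * c i) \<le> 0}"
    (is "finite ?F")
proof -
  obtain e :: real where e: "e > 0"
    "\<And>x. e * (\<Sum>i\<in>I. (x i)\<^sup>2) \<le> (\<Sum>i\<in>I. \<Sum>j\<in>I. x i * of_int (f i j) * x j)"
    using pos_def_coercive[OF I, of "\<lambda>i j. of_int (f i j)"] sym form_finite_type unfolding finite_type_def by auto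
  \<comment> \<open>Minus the sum of the minima of e x^2 + L_i x: even with the other coordinates at
    their minima, coordinate k satisfies e x_k^2 + L_k x_k \<le> C.\<close>
  define C where "C = (\<Sum>i\<in>I. (of_int (L i))\<^sup>2 / (4 * e))"
  define N where "N i = (\<bar>of_int (L i)\<bar> + C) / e + 1" for i
  have C: "C \<ge> 0" unfolding C_def using e(1) by (intro sum_nonneg) auto
  have bound: "\<bar>real_of_int (c k)\<bar> \<le> N k" if c: "c \<in> ?F" and k: "k \<in> I" for c k
  proof -
    let ?x = "\<lambda>i. real_of_int (c i)" and ?l = "\<lambda>i. real_of_int (L i)"
    have "(\<Sum>i\<in>I. \<Sum>j\<in>I. ?x i * of_int (f i j) * ?x j) + (\<Sum>i\<in>I. ?l i * ?x i) \<le> 0"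
      using c by (simp flip: of_int_mult of_int_sum of_int_add)
    then have le: "(\<Sum>i\<in>I. e * (?x i)\<^sup>2 + ?l i * ?x i) \<le> 0"
      using e(2)[of ?x] by (simp add: sum.distrib sum_distrib_left)
    have low: "- ((?l i)\<^sup>2 / (4 * e)) \<le> e * (?x i)\<^sup>2 + ?l i * ?x i" for i
    proof -
      have "0 \<le> (2 * e * ?x i + ?l i)\<^sup>2 / (4 * e)" using e(1) by simp
      also have "\<dots> = e * (?x i)\<^sup>2 + ?l i * ?x i + (?l i)\<^sup>2 / (4 * e)"
        using e(1) by (simp add: power2_eq_square field_simps)
      finally show ?thesis by simp
    qed
    have "(\<Sum>i\<in>I - {k}. - ((?l i)\<^sup>2 / (4 * e))) \<le> (\<Sum>i\<in>I - {k}. e * (?x i)\<^sup>2 + ?l i * ?x i)"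
      by (rule sum_mono) (rule low)
    moreover have "(\<Sum>i\<in>I - {k}. (?l i)\<^sup>2 / (4 * e)) \<le> C"
      unfolding C_def using I e(1) by (intro sum_mono2) auto
    ultimately have "e * (?x k)\<^sup>2 + ?l k * ?x k \<le> C"
      using le sum.remove[OF I k, of "\<lambda>i. e * (?x i)\<^sup>2 + ?l i * ?x i"] by (simp add: sum_negf)
    moreover have "- (\<bar>?l k\<bar> * \<bar>?x k\<bar>) \<le> ?l k * ?x k" by (metis abs_ge_minus_self abs_mult minus_le_iff)
    ultimately have *: "\<bar>?x k\<bar> * (e * \<bar>?x k\<bar> - \<bar>?l k\<bar>) \<le> C"
      by (simp add: algebra_simps power2_eq_square flip: abs_mult)
    show ?thesis
    proof (rule ccontr)
      assume "\<not> ?thesis"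
      then have a: "\<bar>?x k\<bar> > (\<bar>?l k\<bar> + C) / e + 1" by (simp add: N_def)
      then have "e * \<bar>?x k\<bar> > \<bar>?l k\<bar> + C + e" using e(1) by (simp add: field_simps)
      then have b: "e * \<bar>?x k\<bar> - \<bar>?l k\<bar> > C" using e(1) by linarith
      have "(\<bar>?l k\<bar> + C) / e \<ge> 0" using C e(1) by simp
      then have "\<bar>?x k\<bar> \<ge> 1" using a by linarith
      then have "1 * (e * \<bar>?x k\<bar> - \<bar>?l k\<bar>) \<le> \<bar>?x k\<bar> * (e * \<bar>?x k\<bar> - \<bar>?l k\<bar>)"
        using b C by (intro mult_right_mono) auto
      then have "e * \<bar>?x k\<bar> - \<bar>?l k\<bar> \<le> C" using * by (metis mult_1 order_trans)
      then show False using b by linarith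
    qed
  qed
  define m where "m = (\<Sum>i\<in>I. \<lceil>N i\<rceil>)"
  have Nm: "N k \<le> of_int m" if "k \<in> I" for k
  proof -
    have "N i \<ge> 0" for i using C e(1) by (simp add: N_def)
    then have "0 \<le> \<lceil>N i\<rceil>" for i by (metis zero_le_ceiling less_le_trans neg_less_0_iff_less zero_less_one)
    then have "\<lceil>N k\<rceil> \<le> m" unfolding m_def using I that by (intro member_le_sum) auto
    then show ?thesis by linarith
  qed
  have "?F \<subseteq> {c. \<forall>i. (i \<in> I \<longrightarrow> c i \<in> {-m..m}) \<and> (i \<notin> I \<longrightarrow> c i = 0)}"
  proof
    fix c assume c: "c \<in> ?F"
    have "c i \<in> {-m..m}" if "i \<in> I" for i
      using bound[OF c that] Nm[OF that] by (auto simp: abs_le_iff)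
    then show "c \<in> {c. \<forall>i. (i \<in> I \<longrightarrow> c i \<in> {-m..m}) \<and> (i \<notin> I \<longrightarrow> c i = 0)}" using c by auto
  qed
  moreover have "finite {c. \<forall>i. (i \<in> I \<longrightarrow> c i \<in> {-m..m}) \<and> (i \<notin> I \<longrightarrow> c i = 0)}"
    by (rule finite_set_of_finite_funs) (use I in auto)
  ultimately show ?thesis by (rule finite_subset)
qed

section \<open>Weights and the Weyl group\<close>

lemma additive_zscale:
  assumes "additive (f :: 'a::ab_group_add \<Rightarrow> int)" shows "f (zscale n x) = n * f x"
proof -
  have s: "f (\<Sum>_<k. x) = int k * f x" for k :: nat
    by (induction k) (simp_all add: additive.add[OF assms] additive.zero[OF assms] algebra_simps)
  show ?thesis
    unfolding zscale_def additive.diff[OF assms] s by (cases "n \<ge> 0") auto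
qed

locale rdatum =
  fixes D :: "('i, 'x::ab_group_add, 'y::ab_group_add) root_datum"
  assumes D: "root_datum_finite_type D"
begin

abbreviation "I \<equiv> index D"
abbreviation "h i \<equiv> coroot D i"
abbreviation "\<alpha> i \<equiv> root D i"
abbreviation "aa \<equiv> (\<lambda>i j. pair D (coroot D i) (root D j))"

lemma form_cartan_datum: "cartan_datum I (form D)" and form_finite_type: "finite_type I (form D)" and pairing_perfect: "perfect_pairing (pair D)"
  using D by (simp_all only: root_datum_finite_type_def)

lemma finite_index: "finite I"
  and form_sym: "i \<in> I \<Longrightarrow> j \<in> I \<Longrightarrow> form D i j = form D j i"
  and form_even: "i \<in> I \<Longrightarrow> even (form D i i) \<and> 0 < form D i i"
  using form_cartan_datum by (simp_all only: cartan_datum_def)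

lemma form_ii: "i \<in> I \<Longrightarrow> form D i i = 2 * d_at D i"
  and d_at_pos: "i \<in> I \<Longrightarrow> d_at D i > 0"
  using form_even[of i] by (auto simp: d_at_def)

lemma pair_additive: "additive (pair D y)" "additive (\<lambda>y. pair D y x)"
  using pairing_perfect by (auto simp: perfect_pairing_def)

lemmas pair_simps = additive.add[OF pair_additive(1)] additive.diff[OF pair_additive(1)]
  additive.minus[OF pair_additive(1)] additive.zero[OF pair_additive(1)] additive_zscale[OF pair_additive(1)]
  additive.sum[OF pair_additive(1)]
  additive.add[OF pair_additive(2)] additive.diff[OF pair_additive(2)]
  additive.minus[OF pair_additive(2)] additive.zero[OF pair_additive(2)] additive_zscale[OF pair_additive(2)]
  additive.sum[OF pair_additive(2)]

lemma pair_nondegenerate: assumes "y \<noteq> 0" shows "\<exists>x. pair D y x \<noteq> 0"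
proof (rule ccontr)
  assume "\<not> ?thesis"
  then have "pair D y = pair D 0" by (auto simp: pair_simps)
  then show False using assms pairing_perfect by (auto simp: perfect_pairing_def bij_betw_def inj_on_def)
qed

lemma form_pair: assumes "i \<in> I" "j \<in> I" shows "form D i j = d_at D i * pair D (h i) (\<alpha> j)"
proof -
  have "rat_of_int (pair D (h i) (\<alpha> j)) = 2 * of_int (form D i j) / of_int (form D i i)"
    using D assms by (simp only: root_datum_finite_type_def)
  then have "rat_of_int (pair D (h i) (\<alpha> j)) * of_int (d_at D i) = of_int (form D i j)"
    using d_at_pos[OF assms(1)] by (simp add: form_ii[OF assms(1)])
  then show ?thesis by (metis mult.commute of_int_eq_iff of_int_mult)
qed

lemma pair_ii: "i \<in> I \<Longrightarrow> pair D (h i) (\<alpha> i) = 2"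
  using form_pair[of i i] form_ii[of i] d_at_pos[of i] by simp

lemma pair_ij: assumes "i \<in> I" "j \<in> I" "i \<noteq> j" shows "pair D (h i) (\<alpha> j) \<le> 0"
proof -
  have c: "2 * form D i j div form D i i \<le> 0"
    using form_cartan_datum assms by (simp add: cartan_datum_def)
  have "2 * form D i j = form D i i * pair D (h i) (\<alpha> j)"
    using form_pair[OF assms(1,2)] form_ii[OF assms(1)] by simp
  then show ?thesis using c d_at_pos[OF assms(1)] form_ii[OF assms(1)] by simp
qed

sublocale qdatum I aa "d_at D"
proof
  show "finite I" by (rule finite_index)
  show "d_at D i * aa i j = d_at D j * aa j i" if "i \<in> I" "j \<in> I" for i j
    using form_pair[OF that] form_pair[OF that(2,1)] form_sym[OF that] by simp
  show "0 < (\<Sum>i\<in>I. \<Sum>j\<in>I. c i * (d_at D i * aa i j) * c j)" if "\<exists>i\<in>I. c i \<noteq> 0" for c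
  proof -
    have "0 < (\<Sum>i\<in>I. \<Sum>j\<in>I. real_of_int (c i) * of_int (form D i j) * of_int (c j))"
      using form_finite_type that unfolding finite_type_def by auto
    then have "0 < (\<Sum>i\<in>I. \<Sum>j\<in>I. c i * form D i j * c j)"
      by (simp flip: of_int_mult of_int_sum)
    also have "(\<Sum>i\<in>I. \<Sum>j\<in>I. c i * form D i j * c j) = (\<Sum>i\<in>I. \<Sum>j\<in>I. c i * (d_at D i * aa i j) * c j)"
      by (intro sum.cong refl) (simp add: form_pair)
    finally show ?thesis .
  qed
qed (auto simp: d_at_pos pair_ii pair_ij)

lemma v_at: "v_at D i = v i"
  by (simp add: v_def v_at_def)

definition rt :: "('i \<Rightarrow> int) \<Rightarrow> 'x" where
  "rt c = (\<Sum>i\<in>I. zscale (c i) (\<alpha> i))"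

definition bil_form :: "('i \<Rightarrow> int) \<Rightarrow> ('i \<Rightarrow> int) \<Rightarrow> int" where
  "bil_form b c = (\<Sum>i\<in>I. \<Sum>j\<in>I. b i * form D i j * c j)"

definition unit_vec :: "'i \<Rightarrow> 'i \<Rightarrow> int" where
  "unit_vec k = (\<lambda>i. if i = k then 1 else 0)"

lemma rt_add: "rt (\<lambda>i. b i + c i) = rt b + rt c"
  by (simp add: rt_def zscale_add_left sum.distrib)

lemma rt_scale: "rt (\<lambda>i. n * c i) = zscale n (rt c)"
  by (simp add: rt_def zmod.scale_sum_right zscale_mult)

lemma rt_unit_vec: "k \<in> I \<Longrightarrow> rt (unit_vec k) = \<alpha> k"
proof -
  assume k: "k \<in> I"
  have "rt (unit_vec k) = (\<Sum>i\<in>I. if i = k then \<alpha> i else 0)"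
    unfolding rt_def unit_vec_def by (intro sum.cong) auto
  then show ?thesis using finite_index k by simp
qed

lemma bil_form_add_left: "bil_form (\<lambda>i. b i + b' i) c = bil_form b c + bil_form b' c"
  and bil_form_add_right: "bil_form b (\<lambda>i. c i + c' i) = bil_form b c + bil_form b c'"
  and bil_form_scale_left: "bil_form (\<lambda>i. n * b i) c = n * bil_form b c"
  and bil_form_scale_right: "bil_form b (\<lambda>i. n * c i) = n * bil_form b c"
  by (simp_all add: bil_form_def algebra_simps sum.distrib sum_distrib_left)

lemma bil_form_sym: "bil_form b c = bil_form c b"
  unfolding bil_form_def by (subst sum.swap) (intro sum.cong refl; simp add: form_sym mult_ac)

lemma bil_form_pair: "bil_form b c = (\<Sum>i\<in>I. b i * d_at D i * pair D (h i) (rt c))"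
  unfolding bil_form_def rt_def
  by (intro sum.cong refl) (simp add: pair_simps sum_distrib_left form_pair mult_ac)

lemma bil_form_unit_vec_left: assumes "k \<in> I" shows "bil_form (unit_vec k) c = d_at D k * pair D (h k) (rt c)"
proof -
  have "bil_form (unit_vec k) c = (\<Sum>i\<in>I. if i = k then d_at D i * pair D (h i) (rt c) else 0)"
    unfolding bil_form_pair unit_vec_def by (intro sum.cong) auto
  then show ?thesis using finite_index assms by simp
qed

lemma bil_form_finite: "finite {c. (\<forall>i. i \<notin> I \<longrightarrow> c i = 0) \<and> bil_form c c + (\<Sum>i\<in>I. L i * c i) \<le> 0}"
  unfolding bil_form_def by (rule pos_def_finite[OF finite_index form_sym form_finite_type])

section \<open>Finiteness of Weyl group orbits\<close>

definition orbit_box :: "'x \<Rightarrow> 'x set" where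
  "orbit_box \<nu> = (\<lambda>c. \<nu> + rt c) ` {c. (\<forall>i. i \<notin> I \<longrightarrow> c i = 0)
     \<and> bil_form c c + (\<Sum>i\<in>I. 2 * d_at D i * pair D (h i) \<nu> * c i) = 0}"

lemma finite_orbit_box: "finite (orbit_box \<nu>)"
  unfolding orbit_box_def
  by (intro finite_imageI finite_subset[OF _ bil_form_finite[of "\<lambda>i. 2 * d_at D i * pair D (h i) \<nu>"]]) auto

text \<open>The function defining \<open>orbit_box \<nu>\<close> is \<open>|\<nu> + c|\<^sup>2 - |\<nu>|\<^sup>2\<close> for a Weyl group invariant form.\<close>

lemma reflection_orbit_box:
  assumes k: "k \<in> I" and \<mu>: "\<mu> \<in> orbit_box \<nu>"
  shows "reflection D k \<mu> \<in> orbit_box \<nu>"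
proof -
  obtain c where c: "\<mu> = \<nu> + rt c" "\<forall>i. i \<notin> I \<longrightarrow> c i = 0"
    "bil_form c c + (\<Sum>i\<in>I. 2 * d_at D i * pair D (h i) \<nu> * c i) = 0"
    using \<mu> unfolding orbit_box_def by auto
  define n where "n = pair D (h k) \<mu>"
  define c' where "c' = (\<lambda>i. c i + (- n) * unit_vec k i)"
  have "reflection D k \<mu> = \<mu> + zscale (- n) (\<alpha> k)" by (simp add: reflection_def n_def zscale_minus)
  then have r: "reflection D k \<mu> = \<nu> + rt c'"
    unfolding c'_def rt_add rt_scale rt_unit_vec[OF k] using c(1) by (simp add: add.assoc)
  have s: "(\<Sum>i\<in>I. 2 * d_at D i * pair D (h i) \<nu> * c' i)
    = (\<Sum>i\<in>I. 2 * d_at D i * pair D (h i) \<nu> * c i) - 2 * n * d_at D k * pair D (h k) \<nu>"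
  proof -
    have "(\<Sum>i\<in>I. 2 * d_at D i * pair D (h i) \<nu> * c' i)
      = (\<Sum>i\<in>I. 2 * d_at D i * pair D (h i) \<nu> * c i - (if i = k then 2 * n * d_at D i * pair D (h i) \<nu> else 0))"
      by (intro sum.cong) (auto simp: c'_def unit_vec_def algebra_simps)
    then show ?thesis using finite_index k by (simp add: sum_subtractf)
  qed
  have "bil_form c' c' = bil_form c c + (- n) * bil_form (unit_vec k) c + (- n) * (bil_form c (unit_vec k) + (- n) * bil_form (unit_vec k) (unit_vec k))"
    unfolding c'_def bil_form_add_left bil_form_scale_left bil_form_add_right bil_form_scale_right by (simp add: algebra_simps)
  also have "\<dots> = bil_form c c - 2 * n * d_at D k * pair D (h k) (rt c) + 2 * n * n * d_at D k"
    unfolding bil_form_sym[of c "unit_vec k"] bil_form_unit_vec_left[OF k] rt_unit_vec[OF k] pair_ii[OF k] by (simp add: algebra_simps)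
  finally have "bil_form c' c' + (\<Sum>i\<in>I. 2 * d_at D i * pair D (h i) \<nu> * c' i) = 0"
    using c(3) unfolding s n_def c(1) by (simp add: pair_simps algebra_simps)
  moreover have "\<forall>i. i \<notin> I \<longrightarrow> c' i = 0" using c(2) k by (auto simp: c'_def unit_vec_def)
  ultimately show ?thesis unfolding r orbit_box_def by blast
qed

lemma orbit_box_self: "\<nu> \<in> orbit_box \<nu>"
proof -
  have "rt (\<lambda>_. 0) = 0" by (simp add: rt_def)
  then show ?thesis unfolding orbit_box_def by (force simp: bil_form_def)
qed

lemma reflection_involution: "k \<in> I \<Longrightarrow> reflection D k (reflection D k \<mu>) = \<mu>"
proof -
  assume k: "k \<in> I"
  define n where "n = pair D (h k) \<mu>"
  have "pair D (h k) (\<mu> - zscale n (\<alpha> k)) = - n"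
    unfolding pair_simps pair_ii[OF k] by (simp add: n_def)
  then show ?thesis unfolding reflection_def n_def[symmetric] by (simp add: zscale_minus)
qed

lemma reflection_Bij: "k \<in> I \<Longrightarrow> reflection D k \<in> Bij UNIV"
  unfolding Bij_def by (auto intro!: bij_betw_byWitness[where f' = "reflection D k"] simp: reflection_involution)

text \<open>The simple reflections are involutions, so the inverses that \<open>generate\<close>
  allows are generators again.\<close>

lemma weyl_group_induct:
  assumes w: "w \<in> weyl_group D"
    and 1: "P (\<lambda>x. x)" and r: "\<And>k. k \<in> I \<Longrightarrow> P (reflection D k)"
    and m: "\<And>f g. P f \<Longrightarrow> P g \<Longrightarrow> P (\<lambda>x. f (g x))"
  shows "P w"
proof -
  have "w \<in> Bij UNIV \<and> P w" using w unfolding weyl_group_def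
  proof (induction rule: generate.induct)
    case one
    then show ?case using 1 id_Bij[of UNIV] by (simp add: BijGroup_def restrict_def)
  next
    case (incl h)
    then show ?case using r reflection_Bij by auto
  next
    case (inv f)
    then obtain k where k: "k \<in> I" "f = reflection D k" by auto
    have "inv\<^bsub>BijGroup UNIV\<^esub> f = f"
    proof -
      have "inv_into UNIV f = f"
        by (rule inv_equality) (use k reflection_involution in auto)
      then show ?thesis using inv_BijGroup[OF reflection_Bij[OF k(1)]] k by (simp add: restrict_def)
    qed
    then show ?case using k r reflection_Bij by simp
  next
    case (eng f g)
    then have "f \<otimes>\<^bsub>BijGroup UNIV\<^esub> g = (\<lambda>x. f (g x))" by (simp add: BijGroup_def compose_def restrict_def)
    moreover have "compose UNIV f g \<in> Bij UNIV" using eng by (intro compose_Bij) auto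
    ultimately show ?case using eng m by (simp add: compose_def restrict_def)
  qed
  then show ?thesis by simp
qed

lemma weyl_group_mult: "f \<in> weyl_group D \<Longrightarrow> g \<in> weyl_group D \<Longrightarrow> (\<lambda>x. f (g x)) \<in> weyl_group D"
proof -
  have B: "w \<in> Bij UNIV" if "w \<in> weyl_group D" for w
    using that
  proof (rule weyl_group_induct)
    show "(\<lambda>x. x) \<in> Bij UNIV" using id_Bij[of UNIV] by (simp add: restrict_def)
    show "(\<lambda>x. f (g x)) \<in> Bij UNIV" if "f \<in> Bij UNIV" "g \<in> Bij UNIV" for f g :: "'x \<Rightarrow> 'x"
      using compose_Bij[OF that] by (simp add: compose_def restrict_def)
  qed (rule reflection_Bij)
  assume fg: "f \<in> weyl_group D" "g \<in> weyl_group D"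
  then have "f \<otimes>\<^bsub>BijGroup UNIV\<^esub> g = (\<lambda>x. f (g x))" using B by (simp add: BijGroup_def compose_def restrict_def)
  then show ?thesis using fg unfolding weyl_group_def by (metis generate.eng)
qed

lemma weyl_orbit_self: "\<nu> \<in> \<pi> \<Longrightarrow> \<nu> \<in> weyl_orbit D \<pi>"
proof -
  have "(\<lambda>x. x) \<in> weyl_group D"
    using generate.one[of "BijGroup UNIV" "reflection D ` I"] by (simp add: weyl_group_def BijGroup_def restrict_def)
  then show "\<nu> \<in> \<pi> \<Longrightarrow> \<nu> \<in> weyl_orbit D \<pi>" unfolding weyl_orbit_def by force
qed

lemma weyl_orbit_reflection: "k \<in> I \<Longrightarrow> \<mu> \<in> weyl_orbit D \<pi> \<Longrightarrow> reflection D k \<mu> \<in> weyl_orbit D \<pi>"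
proof -
  assume k: "k \<in> I" and "\<mu> \<in> weyl_orbit D \<pi>"
  then obtain w \<nu> where w: "\<mu> = w \<nu>" "w \<in> weyl_group D" "\<nu> \<in> \<pi>" unfolding weyl_orbit_def by blast
  have "reflection D k \<in> weyl_group D" unfolding weyl_group_def using k by (auto intro: generate.incl)
  from weyl_group_mult[OF this w(2)] show "reflection D k \<mu> \<in> weyl_orbit D \<pi>"
    unfolding weyl_orbit_def w(1) using w(3)
    by (intro CollectI exI[of _ "\<lambda>x. reflection D k (w x)"] exI[of _ \<nu>]) simp
qed

lemma weyl_orbit_mono: "\<pi> \<subseteq> \<pi>' \<Longrightarrow> weyl_orbit D \<pi> \<subseteq> weyl_orbit D \<pi>'"
  unfolding weyl_orbit_def by blast

text \<open>Reflections preserve the finite set \<open>orbit_box \<nu>\<close> of translates of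
  \<nu> by the root lattice that have the same norm, so the orbit stays inside.\<close>

lemma finite_weyl_orbit: "finite \<pi> \<Longrightarrow> finite (weyl_orbit D \<pi>)"
proof -
  assume fp: "finite \<pi>"
  have w: "\<forall>\<mu>\<in>orbit_box \<nu>. w \<mu> \<in> orbit_box \<nu>" if "w \<in> weyl_group D" for w \<nu>
    using that by (rule weyl_group_induct) (auto intro: reflection_orbit_box)
  have "weyl_orbit D \<pi> \<subseteq> (\<Union>\<nu>\<in>\<pi>. orbit_box \<nu>)"
  proof
    fix \<mu> assume "\<mu> \<in> weyl_orbit D \<pi>"
    then obtain f \<nu> where "\<mu> = f \<nu>" "f \<in> weyl_group D" "\<nu> \<in> \<pi>" unfolding weyl_orbit_def by auto
    then show "\<mu> \<in> (\<Union>\<nu>\<in>\<pi>. orbit_box \<nu>)" using w orbit_box_self by (intro UN_I[of \<nu>]) auto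
  qed
  then show ?thesis using fp finite_orbit_box by (meson finite_UN finite_subset)
qed

text \<open>The function |c|^2 - 4 \<Sum> d_i c_i is minimised over the root lattice: adding
  \<alpha>_k changes it by d_k (2 \<langle>h_k, c\<rangle> + 2 - 4), which is not negative at a
  minimum, so \<langle>h_k, c\<rangle> \<ge> 1. The constant 4 is chosen for this outcome.\<close>

lemma exists_regular: "\<exists>\<xi>. \<forall>k\<in>I. 1 \<le> pair D (h k) \<xi>"
proof -
  define L where "L i = - 4 * d_at D i" for i
  define \<Phi> where "\<Phi> c = bil_form c c + (\<Sum>i\<in>I. L i * c i)" for c
  \<comment> \<open>The function is \<le> 0 at finitely many points only, among them 0, so a
    minimiser there is a minimiser everywhere.\<close>
  let ?F = "{c. (\<forall>i. i \<notin> I \<longrightarrow> c i = 0) \<and> \<Phi> c \<le> 0}"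
  have f: "finite ?F" unfolding \<Phi>_def by (rule bil_form_finite)
  have z: "(\<lambda>_. 0) \<in> ?F" by (simp add: \<Phi>_def bil_form_def)
  have "?F \<noteq> {}" using z by (metis empty_iff)
  from ex_is_arg_min_if_finite[OF f this, of \<Phi>] obtain c where c: "is_arg_min \<Phi> (\<lambda>c. c \<in> ?F) c" ..
  have "1 \<le> pair D (h k) (rt c)" if k: "k \<in> I" for k
  proof -
    let ?c = "\<lambda>i. c i + unit_vec k i"
    have "\<Phi> c \<le> \<Phi> ?c"
    proof (cases "\<Phi> ?c \<le> 0")
      case True
      then have "?c \<in> ?F" using c k by (auto simp: is_arg_min_linorder unit_vec_def)
      then show ?thesis using c by (auto simp: is_arg_min_linorder)
    next
      case False
      then show ?thesis using c by (auto simp: is_arg_min_linorder)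
    qed
    moreover have "(\<Sum>i\<in>I. L i * ?c i) = (\<Sum>i\<in>I. L i * c i) + L k"
    proof -
      have "(\<Sum>i\<in>I. L i * ?c i) = (\<Sum>i\<in>I. L i * c i + (if i = k then L i else 0))"
        by (intro sum.cong) (auto simp: unit_vec_def algebra_simps)
      then show ?thesis using finite_index k by (simp add: sum.distrib)
    qed
    ultimately have "0 \<le> d_at D k * (2 * pair D (h k) (rt c) + 2 - 4)"
      unfolding \<Phi>_def bil_form_add_left bil_form_add_right bil_form_sym[of c "unit_vec k"] bil_form_unit_vec_left[OF k] rt_unit_vec[OF k] pair_ii[OF k] L_def
      by (simp add: algebra_simps)
    then show ?thesis using d_at_pos[OF k] by (simp add: zero_le_mult_iff)
  qed
  then show ?thesis by blast
qed

text \<open>One hyperplane at a time: if y vanishes on \<xi>, replace \<xi> by M \<xi> + \<mu> with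
  y not vanishing on \<mu>. For M beyond the finitely many pairings with \<mu> the earlier
  conditions persist, because the pairings with \<xi> are integers and so bounded away from
  0.\<close>

lemma exists_generic:
  assumes "finite Y0" "0 \<notin> Y0"
  shows "\<exists>\<xi>. (\<forall>k\<in>I. 1 \<le> pair D (h k) \<xi>) \<and> (\<forall>y\<in>Y0. pair D y \<xi> \<noteq> 0)"
  using assms
proof (induction Y0)
  case empty
  then show ?case using exists_regular by simp
next
  case (insert y Y0)
  have "0 \<notin> Y0" using insert.prems by simp
  from insert.IH[OF this] obtain \<xi> where \<xi>: "\<forall>k\<in>I. 1 \<le> pair D (h k) \<xi>" "\<forall>y\<in>Y0. pair D y \<xi> \<noteq> 0"
    by (elim exE conjE) (rule that)
  have "y \<noteq> 0" using insert.prems by auto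
  from pair_nondegenerate[OF this] obtain \<mu> where \<mu>: "pair D y \<mu> \<noteq> 0" ..
  show ?case
  proof (cases "pair D y \<xi> = 0")
    case False
    then show ?thesis using \<xi> by auto
  next
    case True
    define M where "M = 1 + (\<Sum>z\<in>Y0 \<union> h ` I. \<bar>pair D z \<mu>\<bar>)"
    have le: "\<bar>pair D z \<mu>\<bar> < M" if "z \<in> Y0 \<union> h ` I" for z
      using member_le_sum[OF that, of "\<lambda>z. \<bar>pair D z \<mu>\<bar>"] insert.hyps finite_index by (simp add: M_def)
    have M: "M > 0" unfolding M_def by (smt (verit) sum_nonneg abs_ge_zero)
    have "1 \<le> pair D (h k) (zscale M \<xi> + \<mu>)" if "k \<in> I" for k
    proof -
      have "M * 1 \<le> M * pair D (h k) \<xi>" using \<xi>(1) that M by (intro mult_left_mono) auto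
      then show ?thesis using le[of "h k"] that by (auto simp: pair_simps)
    qed
    moreover have "pair D z (zscale M \<xi> + \<mu>) \<noteq> 0" if "z \<in> insert y Y0" for z
    proof (cases "z = y")
      case True
      then show ?thesis using \<mu> \<open>pair D y \<xi> = 0\<close> by (simp add: pair_simps)
    next
      case False
      then have z: "z \<in> Y0" using that by simp
      then have "\<bar>pair D z \<xi>\<bar> \<ge> 1" using \<xi>(2) by (smt (verit))
      then have "M * 1 \<le> M * \<bar>pair D z \<xi>\<bar>" using M by (intro mult_left_mono) auto
      then have "M \<le> \<bar>M * pair D z \<xi>\<bar>" using M by (simp add: abs_mult)
      then show ?thesis using le[of z] z by (auto simp: pair_simps)
    qed
    ultimately show ?thesis by blast
  qed
qed

section \<open>Dominant weights below a given weight\<close>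

definition below :: "'x \<Rightarrow> 'x set" where
  "below \<nu> = {\<mu> \<in> dominant D. weight_le D \<mu> \<nu>}"

lemma weight_le_rt: "weight_le D \<mu> \<nu> \<longleftrightarrow> (\<exists>c. (\<forall>i. 0 \<le> c i) \<and> (\<forall>i. i \<notin> I \<longrightarrow> c i = 0) \<and> \<mu> = \<nu> - rt c)"
proof
  assume "weight_le D \<mu> \<nu>"
  then obtain c :: "'i \<Rightarrow> nat" where "\<nu> - \<mu> = rt (\<lambda>i. int (c i))" unfolding weight_le_def rt_def by blast
  also have "\<dots> = rt (\<lambda>i. if i \<in> I then int (c i) else 0)" unfolding rt_def by (intro sum.cong) auto
  finally have e: "\<nu> - \<mu> = rt (\<lambda>i. if i \<in> I then int (c i) else 0)" .
  show "\<exists>c. (\<forall>i. 0 \<le> c i) \<and> (\<forall>i. i \<notin> I \<longrightarrow> c i = 0) \<and> \<mu> = \<nu> - rt c"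
    by (rule exI[of _ "\<lambda>i. if i \<in> I then int (c i) else 0"]) (simp flip: e)
next
  assume "\<exists>c. (\<forall>i. 0 \<le> c i) \<and> (\<forall>i. i \<notin> I \<longrightarrow> c i = 0) \<and> \<mu> = \<nu> - rt c"
  then obtain c where c: "\<forall>i. 0 \<le> c i" "\<mu> = \<nu> - rt c" by blast
  then show "weight_le D \<mu> \<nu>"
    unfolding weight_le_def rt_def by (intro exI[of _ "\<lambda>i. nat (c i)"]) simp
qed

lemma weight_leE:
  assumes "weight_le D \<mu> \<nu>"
  obtains c where "\<forall>i. 0 \<le> c i" "\<forall>i. i \<notin> I \<longrightarrow> c i = 0" "\<mu> = \<nu> - rt c"
  using assms unfolding weight_le_rt by (elim exE conjE) (rule that)

text \<open>For \<mu> = \<nu> - c with both weights dominant, |c|^2 - 2 (\<nu>, c) = -(c, \<mu> +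
  \<nu>) \<le> 0, which has finitely many solutions in the root lattice.\<close>

lemma finite_below: assumes \<nu>: "\<nu> \<in> dominant D" shows "finite (below \<nu>)"
proof -
  define L where "L i = - 2 * d_at D i * pair D (h i) \<nu>" for i
  have "below \<nu> \<subseteq> (\<lambda>c. \<nu> - rt c) ` {c. (\<forall>i. i \<notin> I \<longrightarrow> c i = 0) \<and> bil_form c c + (\<Sum>i\<in>I. L i * c i) \<le> 0}"
  proof
    fix \<mu> assume "\<mu> \<in> below \<nu>"
    then have \<mu>: "\<mu> \<in> dominant D" and "weight_le D \<mu> \<nu>" by (auto simp: below_def)
    from this(2) obtain c where c: "\<forall>i. 0 \<le> c i" "\<forall>i. i \<notin> I \<longrightarrow> c i = 0" "\<mu> = \<nu> - rt c"
      by (rule weight_leE)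
    have "bil_form c c + (\<Sum>i\<in>I. L i * c i) = (\<Sum>i\<in>I. - (c i * d_at D i * (pair D (h i) \<mu> + pair D (h i) \<nu>)))"
      unfolding bil_form_pair sum.distrib[symmetric] L_def c(3)
      by (intro sum.cong refl) (simp add: pair_simps algebra_simps)
    also have "\<dots> \<le> 0"
      using \<mu> \<nu> c(1) less_imp_le[OF d_at_pos] by (intro sum_nonpos) (auto simp: dominant_def intro!: mult_nonneg_nonneg)
    finally show "\<mu> \<in> (\<lambda>c. \<nu> - rt c) ` {c. (\<forall>i. i \<notin> I \<longrightarrow> c i = 0) \<and> bil_form c c + (\<Sum>i\<in>I. L i * c i) \<le> 0}"
      using c by blast
  qed
  then show ?thesis by (rule finite_subset) (intro finite_imageI bil_form_finite)
qed

lemma below_self: "\<nu> \<in> dominant D \<Longrightarrow> \<nu> \<in> below \<nu>"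
  unfolding below_def weight_le_rt by (auto intro!: exI[of _ "\<lambda>_. 0"] simp: rt_def)

lemma below_finite_saturated: assumes \<nu>: "\<nu> \<in> dominant D" shows "below \<nu> \<in> finite_saturated D"
proof -
  have "weight_le D \<mu>' \<nu>" if le: "weight_le D \<mu> \<nu>" "weight_le D \<mu>' \<mu>" for \<mu> \<mu>'
  proof -
    obtain c where c: "\<forall>i. 0 \<le> c i" "\<forall>i. i \<notin> I \<longrightarrow> c i = 0" "\<mu> = \<nu> - rt c"
      by (rule weight_leE[OF le(1)])
    obtain c' where "\<forall>i. 0 \<le> c' i" "\<forall>i. i \<notin> I \<longrightarrow> c' i = 0" "\<mu>' = \<mu> - rt c'"
      by (rule weight_leE[OF le(2)])
    with c show ?thesis unfolding weight_le_rt by (intro exI[of _ "\<lambda>i. c i + c' i"]) (simp add: rt_add)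
  qed
  then show ?thesis
    using finite_below[OF \<nu>] below_self[OF \<nu>] unfolding finite_saturated_def saturated_def by (auto simp: below_def)
qed

end

section \<open>Presented algebras\<close>

abbreviation fc :: "'g set \<Rightarrow> 'g free_alg set" where
  "fc G \<equiv> homog (\<lambda>l. set l \<subseteq> G)"

lemma free_algebra_carrier: "carrier (free_algebra G) = fc G"
proof
  show "carrier (free_algebra G) \<subseteq> fc G"
  proof
    fix a assume a: "a \<in> carrier (free_algebra G)"
    have "(\<Sum>w\<in>Poly_Mapping.keys a. Poly_Mapping.lookup a w *\<^sub>q wd (letters w)) \<in> fc G"
      using a by (intro fa.subspace_sum[OF homog_subspace] homog_smul homog_wd) (auto simp: free_algebra_def)
    then show "a \<in> fc G" by (simp flip: free_alg_expand)
  qed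
  have "x \<in> fa.span (wd ` {l. set l \<subseteq> G}) \<Longrightarrow> \<forall>w\<in>Poly_Mapping.keys x. set (letters w) \<subseteq> G" for x
  proof (induction rule: fa.span_induct_alt)
    case (step c x y)
    have "Poly_Mapping.keys (c *\<^sub>q x) \<subseteq> Poly_Mapping.keys x" by (auto simp: in_keys_iff lookup_scal)
    then have "Poly_Mapping.keys (c *\<^sub>q x + y) \<subseteq> Poly_Mapping.keys x \<union> Poly_Mapping.keys y"
      using keys_add[of "c *\<^sub>q x" y] by blast
    moreover have "\<forall>w\<in>Poly_Mapping.keys x. set (letters w) \<subseteq> G" using step.hyps by (auto simp: wd_def)
    ultimately show ?case using step.IH by blast
  qed simp
  then show "fc G \<subseteq> carrier (free_algebra G)" by (auto simp: free_algebra_def homog_def)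
qed

lemma free_algebra_simps [simp]:
  "carrier (free_algebra G) = fc G" "a \<otimes>\<^bsub>free_algebra G\<^esub> b = a * b" "a \<oplus>\<^bsub>free_algebra G\<^esub> b = a + b"
  "\<one>\<^bsub>free_algebra G\<^esub> = 1" "\<zero>\<^bsub>free_algebra G\<^esub> = 0"
  by (simp_all only: free_algebra_carrier) (simp_all add: free_algebra_def)

lemma fc_mult: "a \<in> fc G \<Longrightarrow> b \<in> fc G \<Longrightarrow> a * b \<in> fc G"
  by (erule (1) homog_mult) auto

lemma fc_1: "1 \<in> fc G"
  using homog_wd[of "\<lambda>l. set l \<subseteq> G" "[]"] by simp

lemma fc_gen: "g \<in> G \<Longrightarrow> gen g \<in> fc G"
  using homog_wd[of "\<lambda>l. set l \<subseteq> G" "[g]"] by (simp add: wd_single)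

lemma fc_scal: "scal c \<in> fc G"
  using homog_smul[OF fc_1, of c G] by simp

lemmas fc_add = fa.subspace_add[OF homog_subspace] and fc_diff = fa.subspace_diff[OF homog_subspace]
  and fc_0 = fa.subspace_0[OF homog_subspace] and fc_sum = fa.subspace_sum[OF homog_subspace]
  and fc_smul = homog_smul

lemma fc_minus: "a \<in> fc G \<Longrightarrow> - a \<in> fc G"
  using fc_diff[OF fc_0] by fastforce

lemma fc_power: "a \<in> fc G \<Longrightarrow> a ^ n \<in> fc G"
  by (induction n) (simp_all add: fc_1 fc_mult)

lemma fc_free_divpow: "a \<in> fc G \<Longrightarrow> free_divpow q a n \<in> fc G"
  unfolding free_divpow_def by (intro fc_smul fc_power)

lemma fc_wd: "set l \<subseteq> G \<Longrightarrow> wd l \<in> fc G"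
  by (rule homog_wd)

lemma free_algebra_ring: "ring (free_algebra G)"
proof (rule ringI)
  show "abelian_group (free_algebra G)"
    by (rule abelian_groupI) (auto simp: add_ac fc_add fc_0 intro: bexI[OF _ fc_minus])
  show "monoid (free_algebra G)"
    by (rule monoidI) (auto simp: mult.assoc fc_mult fc_1)
qed (auto simp: distrib_left distrib_right)

lemma subst_fc:
  assumes "\<And>g. g \<in> G \<Longrightarrow> val g \<in> fc H" "a \<in> fc G"
  shows "subst val a \<in> fc H"
proof (rule homog_lin[OF lin_subst homog_subspace _ assms(2)])
  fix l assume "set l \<subseteq> G"
  then show "subst val (wd l) \<in> fc H"
    by (induction l) (auto simp: subst_wd fc_1 assms(1) intro!: fc_mult)
qed

lemma presented_fields:
  "carrier (presented_algebra G R) = a_rcosets\<^bsub>free_algebra G\<^esub> (Idl\<^bsub>free_algebra G\<^esub> R)"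
  "X \<otimes>\<^bsub>presented_algebra G R\<^esub> Y = X \<otimes>\<^bsub>free_algebra G Quot (Idl\<^bsub>free_algebra G\<^esub> R)\<^esub> Y"
  "X \<oplus>\<^bsub>presented_algebra G R\<^esub> Y = X \<oplus>\<^bsub>free_algebra G Quot (Idl\<^bsub>free_algebra G\<^esub> R)\<^esub> Y"
  "\<one>\<^bsub>presented_algebra G R\<^esub> = \<one>\<^bsub>free_algebra G Quot (Idl\<^bsub>free_algebra G\<^esub> R)\<^esub>"
  "\<zero>\<^bsub>presented_algebra G R\<^esub> = \<zero>\<^bsub>free_algebra G Quot (Idl\<^bsub>free_algebra G\<^esub> R)\<^esub>"
  "c \<odot>\<^bsub>presented_algebra G R\<^esub> X = pclass G R (scal c) \<otimes>\<^bsub>free_algebra G Quot (Idl\<^bsub>free_algebra G\<^esub> R)\<^esub> X"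
  by (simp_all add: presented_algebra_def ring.defs FactRing_def)

locale presentation =
  fixes G :: "'g set" and R :: "'g free_alg set"
  assumes R_fc: "R \<subseteq> fc G"
begin

abbreviation "J \<equiv> Idl\<^bsub>free_algebra G\<^esub> R"
abbreviation "P \<equiv> presented_algebra G R"
abbreviation "cl \<equiv> pclass G R"

lemma J_ideal: "ideal J (free_algebra G)"
  by (rule ring.genideal_ideal[OF free_algebra_ring]) (simp add: R_fc)

lemma J_rel: "r \<in> R \<Longrightarrow> r \<in> J"
  using ring.genideal_self[OF free_algebra_ring, of R G] R_fc by auto

lemma J_minimal: "ideal K (free_algebra G) \<Longrightarrow> R \<subseteq> K \<Longrightarrow> J \<subseteq> K"
  by (rule ring.genideal_minimal[OF free_algebra_ring])

lemma J_fc: "a \<in> J \<Longrightarrow> a \<in> fc G"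
  using ideal.Icarr[OF J_ideal] by simp

lemma J_mult_left: "a \<in> J \<Longrightarrow> b \<in> fc G \<Longrightarrow> b * a \<in> J"
  using ideal.I_l_closed[OF J_ideal] by simp

lemma J_mult_right: "a \<in> J \<Longrightarrow> b \<in> fc G \<Longrightarrow> a * b \<in> J"
  using ideal.I_r_closed[OF J_ideal] by simp

lemma J_add: "a \<in> J \<Longrightarrow> b \<in> J \<Longrightarrow> a + b \<in> J"
  using additive_subgroup.a_closed[OF ideal.axioms(1)[OF J_ideal]] by simp

lemma J_0: "0 \<in> J"
  using additive_subgroup.zero_closed[OF ideal.axioms(1)[OF J_ideal]] by simp

lemma J_smul: "a \<in> J \<Longrightarrow> c *\<^sub>q a \<in> J"
  using J_mult_left fc_scal by blast

lemma J_subspace: "fa.subspace J"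
  by (intro fa.subspaceI J_0 J_add J_smul)

lemmas J_sum = fa.subspace_sum[OF J_subspace]
  and J_minus = fa.subspace_neg[OF J_subspace]

lemma minus_eq: "a \<in> fc G \<Longrightarrow> b \<in> fc G \<Longrightarrow> a \<ominus>\<^bsub>free_algebra G\<^esub> b = a - b"
proof -
  interpret ring "free_algebra G" by (rule free_algebra_ring)
  assume a: "a \<in> fc G" and b: "b \<in> fc G"
  have "\<ominus>\<^bsub>free_algebra G\<^esub> b = - b" by (rule minus_equality) (use b fc_minus in auto)
  then show ?thesis by (simp add: a_minus_def)
qed

lemma cl_eq: "a \<in> fc G \<Longrightarrow> b \<in> fc G \<Longrightarrow> cl a = cl b \<longleftrightarrow> a - b \<in> J"
  using ring.quotient_eq_iff_same_a_r_cos[OF free_algebra_ring J_ideal, of a b]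
  by (simp add: pclass_def minus_eq)

lemma P_carrier: "carrier P = cl ` fc G"
  by (auto simp: presented_fields A_RCOSETS_def' pclass_def)

lemma cl_closed: "a \<in> fc G \<Longrightarrow> cl a \<in> carrier P"
  by (simp add: P_carrier)

lemma P_mult: "a \<in> fc G \<Longrightarrow> b \<in> fc G \<Longrightarrow> cl a \<otimes>\<^bsub>P\<^esub> cl b = cl (a * b)"
  using ring_hom_mult[OF ideal.rcos_ring_hom[OF J_ideal], of a b]
  by (simp add: presented_fields pclass_def)

lemma P_add: "a \<in> fc G \<Longrightarrow> b \<in> fc G \<Longrightarrow> cl a \<oplus>\<^bsub>P\<^esub> cl b = cl (a + b)"
  using ring_hom_add[OF ideal.rcos_ring_hom[OF J_ideal], of a b]
  by (simp add: presented_fields pclass_def)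

lemma P_one: "\<one>\<^bsub>P\<^esub> = cl 1"
  using ring_hom_one[OF ideal.rcos_ring_hom[OF J_ideal]]
  by (simp add: presented_fields pclass_def)

lemma P_smult: "a \<in> fc G \<Longrightarrow> c \<odot>\<^bsub>P\<^esub> cl a = cl (c *\<^sub>q a)"
  using P_mult[OF fc_scal[of c] , of a] by (simp add: presented_fields)

lemma P_zero: "\<zero>\<^bsub>P\<^esub> = cl 0"
  using abelian_group.a_coset_add_zero[OF ring.is_abelian_group[OF free_algebra_ring], of J G] J_fc
  by (auto simp: presented_fields pclass_def FactRing_def)

lemma P_ring: "ring P"
proof (rule ringI)
  show "abelian_group P"
  proof (rule abelian_groupI)
    fix x assume "x \<in> carrier P"
    then obtain a where a: "a \<in> fc G" "x = cl a" by (auto simp: P_carrier)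
    then show "\<exists>y\<in>carrier P. y \<oplus>\<^bsub>P\<^esub> x = \<zero>\<^bsub>P\<^esub>"
      by (intro bexI[of _ "cl (- a)"]) (simp_all add: P_add P_zero fc_minus cl_closed)
  qed (auto simp: P_carrier P_add P_zero fc_add fc_0 add_ac)
  show "monoid P"
    by (rule monoidI) (auto simp: P_carrier P_mult P_one fc_mult fc_1 mult.assoc)
qed (auto simp: P_carrier P_mult P_add fc_mult fc_add distrib_left distrib_right)

lemma P_nat_pow: "a \<in> fc G \<Longrightarrow> cl a [^]\<^bsub>P\<^esub> (n::nat) = cl (a ^ n)"
proof (induction n)
  case 0
  then show ?case by (simp add: P_one)
next
  case (Suc n)
  then show ?case unfolding power_Suc2 by (simp add: P_mult fc_power)
qed

lemma P_divpow: "a \<in> fc G \<Longrightarrow> divpow P q (cl a) n = cl (free_divpow q a n)"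
  by (simp add: divpow_def free_divpow_def P_nat_pow P_smult fc_power)

lemma P_finsum:
  assumes "\<And>i. i \<in> A \<Longrightarrow> f i \<in> fc G" "finite A"
  shows "(\<Oplus>\<^bsub>P\<^esub>i\<in>A. cl (f i)) = cl (\<Sum>i\<in>A. f i)"
proof -
  interpret ring P by (rule P_ring)
  show ?thesis using assms(2,1)
  proof (induction A)
    case empty
    then show ?case by (simp add: P_zero)
  next
    case (insert i A)
    then have "(\<Oplus>\<^bsub>P\<^esub>i\<in>insert i A. cl (f i)) = cl (f i) \<oplus>\<^bsub>P\<^esub> (\<Oplus>\<^bsub>P\<^esub>i\<in>A. cl (f i))"
      by (intro finsum_insert) (auto intro: cl_closed)
    then show ?case using insert by (simp add: P_add fc_sum)
  qed
qed

lemma alg_hom_unique: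
  assumes f: "f \<in> alg_hom UNIV P B" and f': "f' \<in> alg_hom UNIV P B"
    and g: "\<And>g. g \<in> G \<Longrightarrow> f (cl (gen g)) = f' (cl (gen g))" and a: "a \<in> fc G"
  shows "f (cl a) = f' (cl a)"
proof -
  have h: "f (cl (a * b)) = f (cl a) \<otimes>\<^bsub>B\<^esub> f (cl b)" "f (cl (a + b)) = f (cl a) \<oplus>\<^bsub>B\<^esub> f (cl b)"
    "f (cl (c *\<^sub>q a)) = c \<odot>\<^bsub>B\<^esub> f (cl a)" "f (cl 1) = \<one>\<^bsub>B\<^esub>"
    if "a \<in> fc G" "b \<in> fc G" "f \<in> alg_hom UNIV P B" for a b c and f :: "'g free_alg set \<Rightarrow> 'a"
    using that by (auto simp: alg_hom_def ring_hom_def cl_closed simp flip: P_mult P_add P_smult P_one)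
  have w: "f (cl (wd l)) = f' (cl (wd l))" if "set l \<subseteq> G" for l
    using that
  proof (induction l)
    case Nil
    then show ?case using h(4)[OF fc_1 fc_1 f] h(4)[OF fc_1 fc_1 f'] by simp
  next
    case (Cons k l)
    then show ?case
      using h(1)[OF fc_gen fc_wd f, of k l] h(1)[OF fc_gen fc_wd f', of k l] g by (simp add: wd_Cons)
  qed
  have "a \<in> fa.span (wd ` {l. set l \<subseteq> G})" using a by (simp add: homog_def)
  then have "a \<in> fc G \<and> f (cl a) = f' (cl a)"
  proof (induction rule: fa.span_induct_alt)
    case base
    show ?case using h(3)[OF fc_1 fc_1 f, of 0] h(3)[OF fc_1 fc_1 f', of 0] h(4)[OF fc_1 fc_1 f] h(4)[OF fc_1 fc_1 f']
      by (simp add: fc_0)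
  next
    case (step c x y)
    then obtain l where l: "x = wd l" "set l \<subseteq> G" by auto
    then have x: "x \<in> fc G" by (simp add: fc_wd)
    note y = conjunct1[OF step.IH]
    show ?case using h(2)[OF fc_smul[OF x] y f] h(2)[OF fc_smul[OF x] y f'] h(3)[OF x x f] h(3)[OF x x f'] w[OF l(2)] l step.IH x
      by (simp add: fc_add fc_smul)
  qed
  then show ?thesis by simp
qed

end

text \<open>Here \<open>val\<close> picks representatives in the free algebra for the classes
  \<open>w\<close> by which homomorphisms are prescribed, so that these can be computed by
  substitution; \<open>rel\<close> makes them well defined.\<close>

locale presentation_hom = A: presentation G R + B: presentation H S
  for G :: "'g set" and R and H :: "'h set" and S +
  fixes val :: "'g \<Rightarrow> 'h free_alg" and w :: "'g \<Rightarrow> 'h free_alg set"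
  assumes val_fc: "g \<in> G \<Longrightarrow> val g \<in> fc H"
    and val_w: "g \<in> G \<Longrightarrow> w g = B.cl (val g)"
    and rel: "r \<in> R \<Longrightarrow> subst val r \<in> B.J"
begin

text \<open>The preimage of \<open>B.J\<close> under substitution is an ideal containing the
  relators.\<close>

lemma subst_J: "a \<in> A.J \<Longrightarrow> subst val a \<in> B.J"
proof -
  let ?K = "{a \<in> fc G. subst val a \<in> B.J}"
  note sf = subst_fc[of G val H, OF val_fc]
  interpret ring "free_algebra G" by (rule free_algebra_ring)
  have m: "\<ominus>\<^bsub>free_algebra G\<^esub> a = - a" if "a \<in> fc G" for a
    by (rule minus_equality) (use that fc_minus in auto)
  have "ideal ?K (free_algebra G)"
  proof (rule idealI)
    show "subgroup ?K (add_monoid (free_algebra G))"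
      by (rule add.subgroupI)
        (auto simp: lin_add[OF lin_subst] lin_minus[OF lin_subst] lin_0[OF lin_subst] fc_add B.J_add fc_minus B.J_minus B.J_0 fc_0 m intro!: exI[of _ 0])
  qed (auto simp: free_algebra_ring fc_mult subst_mult sf B.J_mult_left B.J_mult_right)
  from A.J_minimal[OF this] have "A.J \<subseteq> ?K" using A.R_fc rel by auto
  then show "a \<in> A.J \<Longrightarrow> subst val a \<in> B.J" by auto
qed

text \<open>Substitution induces a map on classes by \<open>subst_J\<close>, and a homomorphism is
  determined by the generators, so this map is the one singled out by the definite
  description.\<close>

lemma presented_hom:
  "presented_hom G R (presented_algebra H S) w \<in> extensional (carrier A.P)"
  "presented_hom G R (presented_algebra H S) w \<in> alg_hom UNIV A.P B.P"
  "a \<in> fc G \<Longrightarrow> presented_hom G R (presented_algebra H S) w (A.cl a) = B.cl (subst val a)"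
proof -
  note sf = subst_fc[of G val H, OF val_fc]
  define f where "f = (\<lambda>X\<in>carrier A.P. B.cl (subst val (SOME a. a \<in> fc G \<and> A.cl a = X)))"
  have f: "f (A.cl a) = B.cl (subst val a)" if a: "a \<in> fc G" for a
  proof -
    define b where "b = (SOME b. b \<in> fc G \<and> A.cl b = A.cl a)"
    have b: "b \<in> fc G \<and> A.cl b = A.cl a" unfolding b_def by (rule someI[of _ a]) (use a in simp)
    then have "subst val (b - a) \<in> B.J" using A.cl_eq[of b a] a by (intro subst_J) auto
    then have "B.cl (subst val b) = B.cl (subst val a)"
      using b a by (subst B.cl_eq) (auto simp: sf lin_diff[OF lin_subst])
    then show ?thesis using a by (simp add: f_def A.cl_closed b_def)
  qed
  have fh: "f \<in> alg_hom UNIV A.P B.P"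
    unfolding alg_hom_def ring_hom_def
    by (auto simp: A.P_carrier f A.P_mult A.P_add A.P_one A.P_smult fc_mult fc_add fc_1 fc_smul sf
        B.P_mult B.P_add B.P_one B.P_smult B.cl_closed subst_mult lin_add[OF lin_subst])
  have fe: "f \<in> extensional (carrier A.P)" by (simp add: f_def)
  have "presented_hom G R (presented_algebra H S) w = f"
    unfolding presented_hom_def
  proof (rule the_equality)
    show "f \<in> extensional (carrier A.P) \<and> f \<in> alg_hom UNIV A.P B.P \<and> (\<forall>g\<in>G. f (A.cl (gen g)) = w g)"
      using fe fh by (auto simp: f fc_gen val_w)
    fix f' assume f': "f' \<in> extensional (carrier A.P) \<and> f' \<in> alg_hom UNIV A.P B.P \<and> (\<forall>g\<in>G. f' (A.cl (gen g)) = w g)"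
    show "f' = f"
    proof (rule extensionalityI[of _ "carrier A.P"])
      fix X assume "X \<in> carrier A.P"
      then obtain a where "a \<in> fc G" "X = A.cl a" by (auto simp: A.P_carrier)
      then show "f' X = f X"
        using A.alg_hom_unique[of f' B.P f a] f' fh by (auto simp: f fc_gen val_w)
    qed (use fe f' in auto)
  qed
  then show "presented_hom G R (presented_algebra H S) w \<in> extensional (carrier A.P)"
    "presented_hom G R (presented_algebra H S) w \<in> alg_hom UNIV A.P B.P"
    "a \<in> fc G \<Longrightarrow> presented_hom G R (presented_algebra H S) w (A.cl a) = B.cl (subst val a)"
    using f fe fh by auto
qed

end

section \<open>Homomorphisms between \<open>U\<close> and the algebras \<open>S(\<pi>)\<close>\<close>

lemma serre_relators_fc:
  fixes e :: "sign \<Rightarrow> 'i \<Rightarrow> 'g free_alg"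
  assumes "\<And>\<epsilon> i. i \<in> index D \<Longrightarrow> e \<epsilon> i \<in> fc G"
  shows "serre_relators D e \<subseteq> fc G"
proof -
  have "(-1) ^ n * a * b * c \<in> fc G" if "a \<in> fc G" "b \<in> fc G" "c \<in> fc G" for n and a b c :: "'g free_alg"
    using that by (intro fc_mult) (simp_all add: fc_scal flip: scal_minus1_power)
  from this[OF fc_free_divpow[OF assms] assms fc_free_divpow[OF assms]] show ?thesis
    unfolding serre_relators_def by (auto intro!: fc_sum)
qed

lemma subst_serre_relators:
  assumes "r \<in> serre_relators D e" "\<And>\<epsilon> i. i \<in> index D \<Longrightarrow> subst val (e \<epsilon> i) = e' \<epsilon> i"
  shows "subst val r \<in> serre_relators D e'"
proof -
  obtain \<epsilon> i j where r: "i \<in> index D" "j \<in> index D" "i \<noteq> j"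
    "r = (\<Sum>(s, s')\<in>{(s, s'). int s + int s' = 1 - pair D (coroot D i) (root D j)}.
        (- 1) ^ s' * free_divpow (v_at D i) (e \<epsilon> i) s * e \<epsilon> j * free_divpow (v_at D i) (e \<epsilon> i) s')"
    using assms(1) unfolding serre_relators_def by blast
  have "subst val r = (\<Sum>(s, s')\<in>{(s, s'). int s + int s' = 1 - pair D (coroot D i) (root D j)}.
        (- 1) ^ s' * free_divpow (v_at D i) (e' \<epsilon> i) s * e' \<epsilon> j * free_divpow (v_at D i) (e' \<epsilon> i) s')"
    unfolding r(4) lin_sum[OF lin_subst]
    by (intro sum.cong refl)
       (auto simp: subst_mult subst_free_divpow assms(2) r simp flip: scal_minus1_power)
  then show ?thesis unfolding serre_relators_def using r(1-3) by blast
qed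

context rdatum
begin

lemma U_relators_fc: "U_relators D \<subseteq> fc (U_gens D)"
proof -
  have E: "gen (UGenE \<epsilon> i) \<in> fc (U_gens D)" if "i \<in> I" for \<epsilon> i
    using that by (intro fc_gen) (auto simp: U_gens_def)
  have K: "gen (UGenK z) \<in> fc (U_gens D)" for z
    by (intro fc_gen) (auto simp: U_gens_def)
  show ?thesis
    unfolding U_relators_def Let_def
    by (intro Un_least serre_relators_fc E) (auto intro!: fc_diff fc_mult fc_scal fc_1 fc_0 E K)
qed

definition idm :: "'x set \<Rightarrow> 'x \<Rightarrow> ('i, 'x) sgen free_alg" where
  "idm \<pi> \<nu> = (if \<nu> \<in> weyl_orbit D \<pi> then gen (SGenId \<nu>) else 0)"

abbreviation sE :: "sign \<Rightarrow> 'i \<Rightarrow> ('i, 'x) sgen free_alg" where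
  "sE \<epsilon> i \<equiv> gen (SGenE \<epsilon> i)"

lemma idm_fc: "idm \<pi> \<nu> \<in> fc (S_gens D \<pi>)"
  by (auto simp: idm_def S_gens_def fc_0 intro: fc_gen)

lemma sE_fc: "i \<in> I \<Longrightarrow> sE \<epsilon> i \<in> fc (S_gens D \<pi>)"
  by (intro fc_gen) (auto simp: S_gens_def)

lemma S_relators_eq: "S_relators D \<pi> =
     {idm \<pi> \<nu> * idm \<pi> \<nu>' - (if \<nu> = \<nu>' then idm \<pi> \<nu> else 0) | \<nu> \<nu>'. True}
     \<union> {(\<Sum>\<nu>\<in>weyl_orbit D \<pi>. idm \<pi> \<nu>) - 1}
     \<union> {sE \<epsilon> i * idm \<pi> \<nu> - idm \<pi> (\<nu> + signed \<epsilon> (root D i)) * sE \<epsilon> i | \<epsilon> i \<nu>. i \<in> I}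
     \<union> {sE Plus i * sE Minus j - sE Minus j * sE Plus i
          - (if i = j then
               (\<Sum>\<nu>\<in>weyl_orbit D \<pi>. scal (qint (v_at D i) (pair D (coroot D i) \<nu>)) * idm \<pi> \<nu>)
             else 0)
         | i j. i \<in> I \<and> j \<in> I}
     \<union> serre_relators D sE"
  unfolding S_relators_def Let_def idm_def ..

lemma S_relators_fc: "S_relators D \<pi> \<subseteq> fc (S_gens D \<pi>)"
  unfolding S_relators_eq
  by (intro Un_least serre_relators_fc sE_fc)
     (auto intro!: fc_diff fc_mult fc_scal fc_1 fc_0 fc_sum sE_fc idm_fc)

end

sublocale rdatum \<subseteq> U: presentation "U_gens D" "U_relators D"
  by unfold_locales (rule U_relators_fc)

sublocale rdatum \<subseteq> S: presentation "S_gens D \<pi>" "S_relators D \<pi>" for \<pi>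
  by unfold_locales (rule S_relators_fc)

context rdatum
begin

lemma idm_mult: "idm \<pi> \<nu> * idm \<pi> \<nu>' - (if \<nu> = \<nu>' then idm \<pi> \<nu> else 0) \<in> S.J \<pi>"
  by (rule S.J_rel) (auto simp: S_relators_eq)

lemma idm_sum: "(\<Sum>\<nu>\<in>weyl_orbit D \<pi>. idm \<pi> \<nu>) - 1 \<in> S.J \<pi>"
  by (rule S.J_rel) (auto simp: S_relators_eq)

lemma idm_E: "i \<in> I \<Longrightarrow> sE \<epsilon> i * idm \<pi> \<nu> - idm \<pi> (\<nu> + signed \<epsilon> (root D i)) * sE \<epsilon> i \<in> S.J \<pi>"
  by (rule S.J_rel) (unfold S_relators_eq, blast)

lemma idm_EF: "i \<in> I \<Longrightarrow> j \<in> I \<Longrightarrow> sE Plus i * sE Minus j - sE Minus j * sE Plus i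
    - (if i = j then (\<Sum>\<nu>\<in>weyl_orbit D \<pi>. scal (qint (v_at D i) (pair D (coroot D i) \<nu>)) * idm \<pi> \<nu>) else 0) \<in> S.J \<pi>"
  by (rule S.J_rel) (unfold S_relators_eq, blast)

definition kk :: "'x set \<Rightarrow> 'y \<Rightarrow> ('i, 'x) sgen free_alg" where
  "kk \<pi> z = (\<Sum>\<nu>\<in>weyl_orbit D \<pi>. vv powi pair D z \<nu> *\<^sub>q idm \<pi> \<nu>)"

lemma kk_fc: "kk \<pi> z \<in> fc (S_gens D \<pi>)"
  unfolding kk_def by (intro fc_sum fc_smul idm_fc)

lemma kk_superset:
  assumes "finite T" "weyl_orbit D \<pi> \<subseteq> T"
  shows "kk \<pi> z = (\<Sum>\<nu>\<in>T. vv powi pair D z \<nu> *\<^sub>q idm \<pi> \<nu>)"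
  unfolding kk_def by (rule sum.mono_neutral_left) (use assms in \<open>auto simp: idm_def\<close>)

lemma kk_mult: assumes "finite \<pi>" shows "kk \<pi> z * kk \<pi> z' - kk \<pi> (z + z') \<in> S.J \<pi>"
proof -
  let ?W = "weyl_orbit D \<pi>"
  note fW = finite_weyl_orbit[OF assms]
  have "kk \<pi> (z + z') = (\<Sum>\<nu>\<in>?W. \<Sum>\<nu>'\<in>?W. (vv powi pair D z \<nu> * vv powi pair D z' \<nu>') *\<^sub>q (if \<nu> = \<nu>' then idm \<pi> \<nu> else 0))"
    unfolding kk_def
  proof (intro sum.cong refl)
    fix \<nu> assume \<nu>: "\<nu> \<in> ?W"
    have "(\<Sum>\<nu>'\<in>?W. (vv powi pair D z \<nu> * vv powi pair D z' \<nu>') *\<^sub>q (if \<nu> = \<nu>' then idm \<pi> \<nu> else 0))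
      = (\<Sum>\<nu>'\<in>?W. if \<nu> = \<nu>' then (vv powi pair D z \<nu> * vv powi pair D z' \<nu>') *\<^sub>q idm \<pi> \<nu> else 0)"
      by (intro sum.cong) auto
    then show "vv powi pair D (z + z') \<nu> *\<^sub>q idm \<pi> \<nu> =
      (\<Sum>\<nu>'\<in>?W. (vv powi pair D z \<nu> * vv powi pair D z' \<nu>') *\<^sub>q (if \<nu> = \<nu>' then idm \<pi> \<nu> else 0))"
      using \<nu> fW by (simp add: pair_simps power_int_add vv_nz)
  qed
  moreover have "kk \<pi> z * kk \<pi> z' = (\<Sum>\<nu>\<in>?W. \<Sum>\<nu>'\<in>?W. (vv powi pair D z \<nu> * vv powi pair D z' \<nu>') *\<^sub>q (idm \<pi> \<nu> * idm \<pi> \<nu>'))"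
    unfolding kk_def sum_product
    by (intro sum.cong refl) (simp add: mult_scal_right[of "idm _ _"] mult.assoc)
  ultimately have "kk \<pi> z * kk \<pi> z' - kk \<pi> (z + z') = (\<Sum>\<nu>\<in>?W. \<Sum>\<nu>'\<in>?W. (vv powi pair D z \<nu> * vv powi pair D z' \<nu>') *\<^sub>q
     (idm \<pi> \<nu> * idm \<pi> \<nu>' - (if \<nu> = \<nu>' then idm \<pi> \<nu> else 0)))"
    by (simp add: sum_subtractf right_diff_distrib)
  then show ?thesis by (simp only:) (intro S.J_sum S.J_smul idm_mult)
qed

lemma kk_E:
  assumes "finite \<pi>" and i: "i \<in> I"
  shows "kk \<pi> z * sE \<epsilon> i - scal (vv powi signed \<epsilon> (pair D z (\<alpha> i))) * sE \<epsilon> i * kk \<pi> z \<in> S.J \<pi>"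
proof -
  let ?W = "weyl_orbit D \<pi>"
  let ?s = "signed \<epsilon> (\<alpha> i)"
  \<comment> \<open>The two sides run over the orbit and over a translate of it. Enlarging the index
    set to cover both allows the index to be shifted; the added terms vanish because
    \<open>idm\<close> is 0 off the orbit.\<close>
  define T where "T = ?W \<union> (\<lambda>\<mu>. \<mu> - ?s) ` ?W"
  have fT: "finite T" unfolding T_def using finite_weyl_orbit[OF assms(1)] by simp
  have s: "pair D z (\<nu> + ?s) = pair D z \<nu> + signed \<epsilon> (pair D z (\<alpha> i))" for \<nu>
    by (cases \<epsilon>) (simp_all add: pair_simps)
  have "kk \<pi> z = (\<Sum>\<mu>\<in>(\<lambda>\<nu>. \<nu> + ?s) ` T. vv powi pair D z \<mu> *\<^sub>q idm \<pi> \<mu>)"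
  proof (rule kk_superset)
    show "?W \<subseteq> (\<lambda>\<nu>. \<nu> + ?s) ` T"
    proof
      fix \<mu> assume "\<mu> \<in> ?W"
      then have "\<mu> - ?s \<in> T" by (simp add: T_def)
      then show "\<mu> \<in> (\<lambda>\<nu>. \<nu> + ?s) ` T" by (rule rev_image_eqI) simp
    qed
  qed (use fT in simp)
  also have "\<dots> = (\<Sum>\<nu>\<in>T. vv powi pair D z (\<nu> + ?s) *\<^sub>q idm \<pi> (\<nu> + ?s))"
    by (rule sum.reindex[unfolded comp_def]) (simp add: inj_on_def)
  finally have 1: "kk \<pi> z * sE \<epsilon> i = (\<Sum>\<nu>\<in>T. vv powi pair D z (\<nu> + ?s) *\<^sub>q (idm \<pi> (\<nu> + ?s) * sE \<epsilon> i))"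
    by (simp add: sum_distrib_right mult.assoc)
  have "sE \<epsilon> i * kk \<pi> z = (\<Sum>\<nu>\<in>T. vv powi pair D z \<nu> *\<^sub>q (sE \<epsilon> i * idm \<pi> \<nu>))"
    using kk_superset[OF fT, of \<pi> z] by (simp add: T_def sum_distrib_left gen_scal)
  then have 2: "scal (vv powi signed \<epsilon> (pair D z (\<alpha> i))) * sE \<epsilon> i * kk \<pi> z
    = (\<Sum>\<nu>\<in>T. vv powi pair D z (\<nu> + ?s) *\<^sub>q (sE \<epsilon> i * idm \<pi> \<nu>))"
    by (simp add: s mult.assoc sum_distrib_left power_int_add vv_nz mult.commute)
  show ?thesis
    unfolding 1 2 sum_subtractf[symmetric] right_diff_distrib[symmetric]
    using S.J_minus[OF idm_E[OF i, of \<epsilon> \<pi>]] by (intro S.J_sum S.J_smul) simp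
qed

abbreviation valU :: "'x set \<Rightarrow> ('i, 'y) ugen \<Rightarrow> ('i, 'x) sgen free_alg" where
  "valU \<pi> \<equiv> case_ugen sE (kk \<pi>)"

abbreviation valS :: "'x set \<Rightarrow> ('i, 'x) sgen \<Rightarrow> ('i, 'x) sgen free_alg" where
  "valS \<pi> \<equiv> case_sgen sE (idm \<pi>)"

lemma S_E_cl: "S_E D \<pi> \<epsilon> i = S.cl \<pi> (sE \<epsilon> i)"
  by (simp add: S_E_def)

lemma S_id_cl: "S_id D \<pi> \<nu> = S.cl \<pi> (idm \<pi> \<nu>)"
  by (simp add: S_id_def idm_def S.P_zero QS_def)

lemma S_K_cl: assumes "finite \<pi>" shows "S_K D \<pi> z = S.cl \<pi> (kk \<pi> z)"
  unfolding S_K_def QS_def S_id_cl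
  by (simp add: S.P_smult idm_fc S.P_finsum fc_smul finite_weyl_orbit[OF assms] kk_def)

lemma serre_J: "r \<in> serre_relators D sE \<Longrightarrow> r \<in> S.J \<pi>"
  by (rule S.J_rel) (simp add: S_relators_eq)

lemma U_to_S_hom: assumes fp: "finite \<pi>"
  shows "presentation_hom (U_gens D) (U_relators D) (S_gens D \<pi>) (S_relators D \<pi>) (valU \<pi>) (case_ugen (S_E D \<pi>) (S_K D \<pi>))"
proof
  fix g assume g: "g \<in> U_gens D"
  show "valU \<pi> g \<in> fc (S_gens D \<pi>)" using g by (cases g) (auto simp: U_gens_def kk_fc sE_fc)
  show "case_ugen (S_E D \<pi>) (S_K D \<pi>) g = S.cl \<pi> (valU \<pi> g)" by (cases g) (simp_all add: S_E_cl S_K_cl[OF fp])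
next
  fix r assume "r \<in> U_relators D"
  then consider (1) z z' where "r = gen (UGenK z) * gen (UGenK z') - gen (UGenK (z + z'))"
    | (2) "r = gen (UGenK 0) - 1"
    | (3) z \<epsilon> i where "i \<in> I" "r = gen (UGenK z) * gen (UGenE \<epsilon> i) - scal (vv powi signed \<epsilon> (pair D z (root D i))) * gen (UGenE \<epsilon> i) * gen (UGenK z)"
    | (4) i j where "i \<in> I" "j \<in> I" "r = gen (UGenE Plus i) * gen (UGenE Minus j) - gen (UGenE Minus j) * gen (UGenE Plus i)
          - (if i = j then
               scal (inverse (v_at D i - inverse (v_at D i)))
                 * (gen (UGenK (zscale (d_at D i) (coroot D i))) - gen (UGenK (- zscale (d_at D i) (coroot D i))))
             else 0)"
    | (5) "r \<in> serre_relators D (\<lambda>\<epsilon> i. gen (UGenE \<epsilon> i))"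
    unfolding U_relators_def Let_def by blast
  then show "subst (valU \<pi>) r \<in> S.J \<pi>"
  proof cases
    case 1
    then show ?thesis using kk_mult[OF fp] by (simp add: lin_diff[OF lin_subst] subst_mult)
  next
    case 2
    then show ?thesis using idm_sum[of \<pi>] by (simp add: lin_diff[OF lin_subst] kk_def pair_simps)
  next
    case 3
    then show ?thesis using kk_E[OF fp 3(1)] by (simp add: lin_diff[OF lin_subst] subst_mult)
  next
    case 4
    have "v_at D i powi n = vv powi (d_at D i * n)" for n by (simp add: v_at_def power_int_mult)
    then have "inverse (v_at D i - inverse (v_at D i)) * (vv powi pair D (zscale (d_at D i) (coroot D i)) \<nu> - vv powi pair D (- zscale (d_at D i) (coroot D i)) \<nu>)
       = qint (v_at D i) (pair D (coroot D i) \<nu>)" for \<nu>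
      unfolding qint_def by (simp add: pair_simps field_simps)
    then have "scal (inverse (v_at D i - inverse (v_at D i))) * (kk \<pi> (zscale (d_at D i) (coroot D i)) - kk \<pi> (- zscale (d_at D i) (coroot D i)))
       = (\<Sum>\<nu>\<in>weyl_orbit D \<pi>. scal (qint (v_at D i) (pair D (coroot D i) \<nu>)) * idm \<pi> \<nu>)"
      unfolding kk_def by (simp add: sum_subtractf[symmetric] sum_distrib_left flip: fa.scale_left_diff_distrib)
    then show ?thesis using idm_EF[OF 4(1,2), of \<pi>] 4(3)
      by (auto simp: lin_diff[OF lin_subst] subst_mult lin_0[OF lin_subst])
  next
    case 5
    then show ?thesis by (intro serre_J subst_serre_relators[OF 5]) simp
  qed
qed

lemma S_map_hom: assumes sub: "\<pi> \<subseteq> \<pi>'" and fp: "finite \<pi>'"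
  shows "presentation_hom (S_gens D \<pi>') (S_relators D \<pi>') (S_gens D \<pi>) (S_relators D \<pi>) (valS \<pi>) (case_sgen (S_E D \<pi>) (S_id D \<pi>))"
proof
  fix g assume g: "g \<in> S_gens D \<pi>'"
  show "valS \<pi> g \<in> fc (S_gens D \<pi>)" using g by (cases g) (auto simp: S_gens_def[of D \<pi>'] idm_fc sE_fc)
  show "case_sgen (S_E D \<pi>) (S_id D \<pi>) g = S.cl \<pi> (valS \<pi> g)" by (cases g) (simp_all add: S_E_cl S_id_cl)
next
  have sid: "subst (valS \<pi>) (idm \<pi>' \<nu>) = idm \<pi> \<nu>" for \<nu>
    using weyl_orbit_mono[OF sub] by (auto simp: idm_def lin_0[OF lin_subst])
  have ssum: "(\<Sum>\<nu>\<in>weyl_orbit D \<pi>'. c \<nu> *\<^sub>q idm \<pi> \<nu>) = (\<Sum>\<nu>\<in>weyl_orbit D \<pi>. c \<nu> *\<^sub>q idm \<pi> \<nu>)" for c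
    by (rule sum.mono_neutral_right[OF finite_weyl_orbit[OF fp] weyl_orbit_mono[OF sub]]) (auto simp: idm_def)
  fix r assume "r \<in> S_relators D \<pi>'"
  then consider (1) \<nu> \<nu>' where "r = idm \<pi>' \<nu> * idm \<pi>' \<nu>' - (if \<nu> = \<nu>' then idm \<pi>' \<nu> else 0)"
    | (2) "r = (\<Sum>\<nu>\<in>weyl_orbit D \<pi>'. idm \<pi>' \<nu>) - 1"
    | (3) \<epsilon> i \<nu> where "i \<in> I" "r = sE \<epsilon> i * idm \<pi>' \<nu> - idm \<pi>' (\<nu> + signed \<epsilon> (root D i)) * sE \<epsilon> i"
    | (4) i j where "i \<in> I" "j \<in> I" "r = sE Plus i * sE Minus j - sE Minus j * sE Plus i
          - (if i = j then
               (\<Sum>\<nu>\<in>weyl_orbit D \<pi>'. scal (qint (v_at D i) (pair D (coroot D i) \<nu>)) * idm \<pi>' \<nu>)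
             else 0)"
    | (5) "r \<in> serre_relators D sE"
    unfolding S_relators_eq by blast
  then show "subst (valS \<pi>) r \<in> S.J \<pi>"
  proof cases
    case 1
    then show ?thesis using idm_mult[of \<pi> \<nu> \<nu>'] by (auto simp: lin_diff[OF lin_subst] lin_0[OF lin_subst] subst_mult sid)
  next
    case 2
    then show ?thesis using idm_sum[of \<pi>] ssum[of "\<lambda>_. 1"] by (simp add: lin_diff[OF lin_subst] lin_sum[OF lin_subst] sid)
  next
    case 3
    then show ?thesis using idm_E[OF 3(1)] by (simp add: lin_diff[OF lin_subst] subst_mult sid)
  next
    case 4
    then show ?thesis using idm_EF[OF 4(1,2), of \<pi>]
      by (auto simp: lin_diff[OF lin_subst] subst_mult lin_0[OF lin_subst] lin_sum[OF lin_subst] sid ssum)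
  next
    case 5
    then show ?thesis by (intro serre_J subst_serre_relators[OF 5]) simp
  qed
qed

lemma U_to_S:
  assumes "finite \<pi>"
  shows "U_to_S D \<pi> \<in> alg_hom UNIV (QU D) (QS D \<pi>)"
    "a \<in> fc (U_gens D) \<Longrightarrow> U_to_S D \<pi> (U.cl a) = S.cl \<pi> (subst (valU \<pi>) a)"
  unfolding U_to_S_def QU_def QS_def
  using presentation_hom.presented_hom[OF U_to_S_hom[OF assms]] by auto

lemma S_map:
  assumes "\<pi> \<subseteq> \<pi>'" "finite \<pi>'"
  shows "S_map D \<pi> \<pi>' \<in> alg_hom UNIV (QS D \<pi>') (QS D \<pi>)"
    "a \<in> fc (S_gens D \<pi>') \<Longrightarrow> S_map D \<pi> \<pi>' (S.cl \<pi>' a) = S.cl \<pi> (subst (valS \<pi>) a)"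
  unfolding S_map_def QS_def
  using presentation_hom.presented_hom[OF S_map_hom[OF assms]] by auto

section \<open>The action of \<open>S(\<pi>)\<close> on integrable quotients\<close>

definition lam :: "'x \<Rightarrow> 'i \<Rightarrow> int" where
  "lam \<nu> i = pair D (h i) \<nu>"

definition wtx :: "'x \<Rightarrow> 'i list \<Rightarrow> 'x" where
  "wtx \<nu> l = \<nu> - (\<Sum>j\<leftarrow>l. \<alpha> j)"

definition hx :: "'x \<Rightarrow> 'x \<Rightarrow> 'i free_alg set" where
  "hx \<nu> \<mu> = homog (\<lambda>l. wtx \<nu> l = \<mu>)"

definition NN :: "'x \<Rightarrow> 'i free_alg set" where
  "NN \<nu> = NL I (lam \<nu>)"

lemma wtx_mset: "mset l = mset l' \<Longrightarrow> wtx \<nu> l = wtx \<nu> l'"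
  unfolding wtx_def by (metis mset_map sum_mset_sum_list)

lemma pair_wtx: "pair D (h i) (wtx \<nu> l) = lam \<nu> i - wtp i l"
proof -
  have "pair D (h i) (\<Sum>j\<leftarrow>l. \<alpha> j) = wtp i l"
    by (induction l) (simp_all add: pair_simps)
  then show ?thesis by (simp add: wtx_def lam_def pair_simps)
qed

lemma foldr_Eop_hm: "x \<in> hm M \<Longrightarrow> foldr (Eop la) b x \<in> homog (\<lambda>l. mset l + mset b = M)"
proof (induction b)
  case Nil
  then show ?case by (simp add: hm_def)
next
  case (Cons k b)
  show ?case unfolding foldr.simps comp_apply
  proof (rule homog_lin[OF lin_Eop homog_subspace _ Cons.IH[OF Cons.prems]])
    fix l assume l: "mset l + mset b = M"
    show "Eop la k (wd l) \<in> homog (\<lambda>l. mset l + mset (k # b) = M)"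
      by (rule homog_mono[OF _ Eop_hm[OF hm_wd]]) (use l in auto)
  qed
qed

lemma NN_dom: "\<nu> \<in> dominant D \<Longrightarrow> i \<in> I \<Longrightarrow> 0 \<le> lam \<nu> i"
  by (auto simp: dominant_def lam_def)

lemma NN_Eop: "\<nu> \<in> dominant D \<Longrightarrow> k \<in> I \<Longrightarrow> x \<in> NN \<nu> \<Longrightarrow> Eop (lam \<nu>) k x \<in> NN \<nu>"
  unfolding NN_def by (rule NL_Eop) (auto simp: NN_dom)

lemma NN_Eop_funpow: "\<nu> \<in> dominant D \<Longrightarrow> k \<in> I \<Longrightarrow> x \<in> NN \<nu> \<Longrightarrow> (Eop (lam \<nu>) k ^^ n) x \<in> NN \<nu>"
  by (induction n) (simp_all add: NN_Eop)

lemma NN_subspace: "fa.subspace (NN \<nu>)"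
  by (simp add: NN_def NL_subspace)

lemmas NN_0 = fa.subspace_0[OF NN_subspace] and NN_smul = fa.subspace_scale[OF NN_subspace]
  and NN_add = fa.subspace_add[OF NN_subspace] and NN_diff = fa.subspace_diff[OF NN_subspace]
  and NN_minus = fa.subspace_neg[OF NN_subspace] and NN_sum = fa.subspace_sum[OF NN_subspace]

lemma NN_mult_left: "x \<in> NN \<nu> \<Longrightarrow> b * x \<in> NN \<nu>"
  unfolding NN_def by (rule NL_mult_left)

lemma NN_serre_ideal: "x \<in> serre_ideal \<Longrightarrow> x \<in> NN \<nu>"
  unfolding NN_def by (rule NL_serre_ideal)

text \<open>
  The weights of the integrable quotient lie in \<open>W\<close>-orbits of dominant weights below \<open>\<nu>\<close>: if a
  weight pairs negatively with a coroot, reflecting it gives a weight closer to \<open>\<nu>\<close>.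
\<close>

lemma NN_weight:
  assumes \<nu>: "\<nu> \<in> dominant D" and l: "wd l \<notin> NN \<nu>"
  shows "wtx \<nu> l \<in> weyl_orbit D (below \<nu>)"
  using l
proof (induction "length l" arbitrary: l rule: less_induct)
  case less
  have lI: "set l \<subseteq> I" using less.prems serre_ideal_bad NN_serre_ideal by blast
  show ?case
  proof (cases "\<forall>i\<in>I. 0 \<le> pair D (h i) (wtx \<nu> l)")
    case True
    have "(\<Sum>j\<leftarrow>l. \<alpha> j) = rt (\<lambda>i. int (count (mset l) i))"
      using lI
    proof (induction l)
      case Nil
      then show ?case by (simp add: rt_def)
    next
      case (Cons k l)
      have "rt (\<lambda>i. int (count (mset (k # l)) i)) = rt (\<lambda>i. unit_vec k i + int (count (mset l) i))"
        unfolding rt_def unit_vec_def by (intro sum.cong) auto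
      then show ?case using Cons by (simp only: rt_add) (simp add: rt_unit_vec)
    qed
    then have "weight_le D (wtx \<nu> l) \<nu>"
      unfolding weight_le_rt wtx_def using lI
      by (intro exI[of _ "\<lambda>i. int (count (mset l) i)"]) (auto simp: not_in_iff[symmetric] in_multiset_in_set)
    then have "wtx \<nu> l \<in> below \<nu>" using True by (simp add: below_def dominant_def)
    then show ?thesis by (rule weyl_orbit_self)
  next
    case False
    then obtain i where i: "i \<in> I" and neg: "pair D (h i) (wtx \<nu> l) < 0" by force
    define n where "n = pair D (h i) (wtx \<nu> l)"
    define m where "m = nat (- n)"
    have n: "n = - int m" "m > 0" using neg by (auto simp: n_def m_def)
    \<comment> \<open>For this least p, the vector F_i^(p-1) w is non-zero in the quotient and
      killed by F_i: the bottom of an sl_2 string.\<close>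
    define p where "p = (LEAST p. gen i ^ p * wd l \<in> NN \<nu>)"
    obtain p' where "gen i ^ p' * wd l \<in> NN \<nu>" using gen_nilp[OF i order_refl] unfolding NN_def by blast
    then have p: "gen i ^ p * wd l \<in> NN \<nu>" unfolding p_def by (rule LeastI)
    then have "p \<noteq> 0" using less.prems by (intro notI) simp
    then obtain b where b: "p = Suc b" by (cases p) auto
    define y where "y = gen i ^ b * wd l"
    have y: "y \<notin> NN \<nu>" unfolding y_def using not_less_Least[of b "\<lambda>p. gen i ^ p * wd l \<in> NN \<nu>"] b p_def by simp
    have gy: "gen i * y \<in> NN \<nu>" using p by (simp add: y_def b mult.assoc)
    have yh: "y \<in> hm (replicate_mset b i + mset l)"
      unfolding y_def using hm_mult[OF hm_power[OF hm_gen[of i], of b] hm_wd[of l]] by simp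
    have yW: "y \<in> Wt (lam \<nu>) i (- (2 * int b + int m))"
      unfolding Wt_def
    proof (rule hm_homog[OF yh])
      fix l' assume "mset l' = replicate_mset b i + mset l"
      then have "wtp i l' = wtp i (replicate b i @ l)" by (intro wtp_mset) simp
      also have "\<dots> = 2 * int b + wtp i l" using a_ii[OF i] by (induction b) simp_all
      finally show "lam \<nu> i - wtp i l' = - (2 * int b + int m)" using n n_def pair_wtx[of i \<nu> l] by simp
    qed
    \<comment> \<open>Since y has weight -(2b + m), the coefficients in the string vanish only
      beyond E_i^(2b+m) y. The power b + m already reaches weight m, the pairing of the reflected
      weight with h_i.\<close>
    have E: "(Eop (lam \<nu>) i ^^ k) y \<notin> NN \<nu>" if "k \<le> b + m" for k
      using that
    proof (induction k)
      case 0
      then show ?case using y by simp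
    next
      case (Suc k)
      define c where "c = qint (v i) (int (Suc k)) * qint (v i) (2 * int b + int m - int k)"
      have c: "c \<noteq> 0" unfolding c_def using Suc.prems qint_nz[OF not_root_of_unity_v[OF i]] by (simp del: of_nat_Suc)
      show ?case
      proof
        assume "(Eop (lam \<nu>) i ^^ Suc k) y \<in> NN \<nu>"
        then have 1: "gen i * (Eop (lam \<nu>) i ^^ Suc k) y \<in> NN \<nu>" by (rule NN_mult_left)
        have 2: "(Eop (lam \<nu>) i ^^ Suc k) (gen i * y) \<in> NN \<nu>" by (rule NN_Eop_funpow[OF \<nu> i gy])
        have "c *\<^sub>q (Eop (lam \<nu>) i ^^ k) y = gen i * (Eop (lam \<nu>) i ^^ Suc k) y - (Eop (lam \<nu>) i ^^ Suc k) (gen i * y)"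
          unfolding E_power[OF i yW] c_def by simp
        then have "c *\<^sub>q (Eop (lam \<nu>) i ^^ k) y \<in> NN \<nu>" using NN_diff[OF 1 2] by simp
        then have "inverse c *\<^sub>q c *\<^sub>q (Eop (lam \<nu>) i ^^ k) y \<in> NN \<nu>" by (rule NN_smul)
        then show False using c Suc by (simp add: scal_mult_assoc)
      qed
    qed
    let ?b = "replicate (b + m) i"
    have E1: "foldr (Eop (lam \<nu>)) ?b y \<notin> NN \<nu>" using E[of "b + m"] by (simp add: foldr_replicate del: replicate_add)
    have "\<exists>l'. mset l' + mset ?b = replicate_mset b i + mset l \<and> wd l' \<notin> NN \<nu>"
    proof (rule ccontr)
      assume "\<not> ?thesis"
      then have "foldr (Eop (lam \<nu>)) ?b y \<in> NN \<nu>"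
        by (intro homog_lin[OF lin_id NN_subspace _ foldr_Eop_hm[OF yh]]) blast
      then show False using E1 by simp
    qed
    then obtain l' where l': "mset l' + mset ?b = replicate_mset b i + mset l" "wd l' \<notin> NN \<nu>" by blast
    \<comment> \<open>As a multiset, l arises from l' by adding m > 0 letters i, so l' is shorter
      and has the reflected weight.\<close>
    have m1: "mset (l' @ replicate m i) = mset l"
    proof -
      have "replicate_mset b i + mset (l' @ replicate m i) = replicate_mset b i + mset l"
        using l'(1) by (simp add: replicate_add add_ac)
      then show ?thesis by (rule add_left_imp_eq)
    qed
    then have len: "length l' < length l" using n(2) by (metis length_append length_replicate less_add_same_cancel1 size_mset)
    have "wtx \<nu> l = wtx \<nu> (l' @ replicate m i)" by (rule wtx_mset[OF m1[symmetric]])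
    also have "\<dots> = wtx \<nu> l' - (\<Sum>_<m. \<alpha> i)" by (simp add: wtx_def sum_list_replicate)
       (induction m; simp add: algebra_simps)
    also have "\<dots> = wtx \<nu> l' + zscale n (\<alpha> i)" by (simp add: n(1) zscale_minus zscale_of_nat)
    finally have w: "wtx \<nu> l' = reflection D i (wtx \<nu> l)" unfolding reflection_def n_def[symmetric] by simp
    have "reflection D i (wtx \<nu> l') \<in> weyl_orbit D (below \<nu>)"
      by (rule weyl_orbit_reflection[OF i less.hyps[OF len l'(2)]])
    then show ?thesis unfolding w reflection_involution[OF i] .
  qed
qed

section \<open>The generators of S(\<pi>) as operators on the free algebra\<close>

definition ops :: "'x \<Rightarrow> ('i, 'x) sgen \<Rightarrow> 'i free_alg \<Rightarrow> 'i free_alg" where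
  "ops \<nu> g = (case g of SGenE \<epsilon> i \<Rightarrow> (case \<epsilon> of Plus \<Rightarrow> Eop (lam \<nu>) i | Minus \<Rightarrow> (\<lambda>x. gen i * x))
     | SGenId \<mu> \<Rightarrow> diag_op (\<lambda>l. if wtx \<nu> l = \<mu> then 1 else 0))"

lemma ops_simps [simp]: "ops \<nu> (SGenE Plus i) = Eop (lam \<nu>) i" "ops \<nu> (SGenE Minus i) = (\<lambda>x. gen i * x)"
  "ops \<nu> (SGenId \<mu>) = diag_op (\<lambda>l. if wtx \<nu> l = \<mu> then 1 else 0)"
  by (simp_all add: ops_def)

lemma lin_ops: "lin (ops \<nu> g)"
proof (cases g)
  case (SGenE \<epsilon> i)
  show ?thesis
  proof (cases \<epsilon>)
    case Plus
    then show ?thesis unfolding SGenE Plus ops_simps by (intro lin_Eop)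
  next
    case Minus
    show ?thesis unfolding SGenE Minus ops_simps by (rule lin_mult_left[OF lin_id])
  qed
next
  case (SGenId \<mu>)
  show ?thesis unfolding SGenId ops_simps by (rule lin_diag_op)
qed

abbreviation acts :: "'x \<Rightarrow> ('i, 'x) sgen free_alg \<Rightarrow> 'i free_alg \<Rightarrow> 'i free_alg" where
  "acts \<nu> \<equiv> act (ops \<nu>)"

lemma acts_mult: "acts \<nu> (a * b) z = acts \<nu> a (acts \<nu> b z)"
  by (rule act_mult[OF lin_ops])

lemma lin_acts: "lin (acts \<nu> a)"
  by (rule lin_act[OF lin_ops])

lemma ops_NN:
  assumes \<nu>: "\<nu> \<in> dominant D" and g: "g \<in> S_gens D \<pi>" and z: "z \<in> NN \<nu>"
  shows "ops \<nu> g z \<in> NN \<nu>"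
proof -
  have "diag_op (\<lambda>l. if wtx \<nu> l = \<mu> then 1 else 0) z \<in> NN \<nu>" for \<mu>
    using z unfolding NN_def by (intro NL_diag_op) (metis wtx_mset)
  moreover have "ops \<nu> (SGenE \<epsilon> i) z \<in> NN \<nu>" if "i \<in> I" for \<epsilon> i
    using that z \<nu> by (cases \<epsilon>) (simp_all add: NN_mult_left NN_Eop)
  ultimately show ?thesis
    using g by (auto simp: S_gens_def simp del: ops_simps(1,2))
qed

lemma acts_NN:
  assumes \<nu>: "\<nu> \<in> dominant D" and a: "a \<in> fc (S_gens D \<pi>)" and z: "z \<in> NN \<nu>"
  shows "acts \<nu> a z \<in> NN \<nu>"
proof (rule homog_lin[OF lin_act_left NN_subspace _ a])
  fix l assume "set l \<subseteq> S_gens D \<pi>"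
  then show "acts \<nu> (wd l) z \<in> NN \<nu>"
    by (induction l) (use z in \<open>auto simp: act_wd intro: ops_NN[OF \<nu>]\<close>)
qed

lemma acts_idm:
  assumes "x \<in> hx \<nu> \<mu>"
  shows "acts \<nu> (idm \<pi> \<mu>') x = (if \<mu>' \<in> weyl_orbit D \<pi> \<and> \<mu> = \<mu>' then x else 0)"
proof -
  have "x \<in> homog (\<lambda>l. (if wtx \<nu> l = \<mu>' then 1 else 0) = (if \<mu> = \<mu>' then 1 else 0))"
    using assms unfolding hx_def by (rule homog_mono[rotated]) auto
  from diag_op_homog[OF this] show ?thesis by (simp add: idm_def lin_0[OF lin_act_left])
qed

lemma hx_NN:
  assumes "\<nu> \<in> dominant D" "x \<in> hx \<nu> \<mu>" "\<mu> \<notin> weyl_orbit D (below \<nu>)"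
  shows "x \<in> NN \<nu>"
  by (rule homog_lin[OF lin_id NN_subspace _ assms(2)[unfolded hx_def]]) (use NN_weight assms in blast)

lemma hx_wd: "wd l \<in> hx \<nu> (wtx \<nu> l)"
  unfolding hx_def by (rule homog_wd) simp

lemma hx_ops: "x \<in> hx \<nu> \<mu> \<Longrightarrow> ops \<nu> (SGenE \<epsilon> i) x \<in> hx \<nu> (\<mu> + signed \<epsilon> (\<alpha> i))"
proof (cases \<epsilon>)
  case Plus
  assume x: "x \<in> hx \<nu> \<mu>"
  have "Eop (lam \<nu>) i (wd l) \<in> hx \<nu> (wtx \<nu> l + \<alpha> i)" for l
    unfolding hx_def
  proof (rule homog_mono[OF _ Eop_hm[OF hm_wd]])
    fix l' assume "add_mset i (mset l') = mset l"
    then have "wtx \<nu> l = wtx \<nu> (i # l')" by (intro wtx_mset) simp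
    then show "wtx \<nu> l' = wtx \<nu> l + \<alpha> i" by (simp add: wtx_def)
  qed
  then have "Eop (lam \<nu>) i (wd l) \<in> hx \<nu> (\<mu> + \<alpha> i)" if "wtx \<nu> l = \<mu>" for l using that by blast
  then show ?thesis using homog_lin[OF lin_Eop homog_subspace _ x[unfolded hx_def]] Plus
    by (auto simp: hx_def)
next
  case Minus
  assume x: "x \<in> hx \<nu> \<mu>"
  have "gen i * x \<in> hx \<nu> (\<mu> - \<alpha> i)" unfolding hx_def
    by (rule homog_mult[where P = "\<lambda>l. l = [i]", OF _ x[unfolded hx_def]])
       (auto simp: wd_single[symmetric] wtx_def intro: homog_wd)
  then show ?thesis using Minus by simp
qed

lemma act_free_divpow: "acts \<nu> (free_divpow q (gen g) n) x = dv q (ops \<nu> g) n x"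
  by (simp add: free_divpow_def dv_def acts_mult act_power[OF lin_ops]) (metis act_gen ext)

lemma serre_sum:
  assumes "1 - a' = int m"
  shows "(\<Sum>(s, s')\<in>{(s, s'). int s + int s' = 1 - a'}. f s s') = (\<Sum>t\<le>m. f (m - t) t)"
proof -
  have "{(s, s'). int s + int s' = 1 - a'} = (\<lambda>t. (m - t, t)) ` {..m}"
    unfolding assms by (auto simp: image_iff)
  moreover have "inj_on (\<lambda>t. (m - t, t)) {..m}" by (auto simp: inj_on_def)
  ultimately show ?thesis by (simp add: sum.reindex)
qed

lemma one_minus_aij: "i \<in> I \<Longrightarrow> j \<in> I \<Longrightarrow> i \<noteq> j \<Longrightarrow> 1 - aa i j = int (nat (1 - aa i j))"
  using a_ij[of i j] by simp

text \<open>Relations are tested on words, which are weight vectors. The Serre relations hold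
  exactly for the E's and modulo the Serre subspace for the F's; relations involving idempotents can
  fail only at weights outside the orbit, where every vector lies in
  \<open>NN \<nu>\<close>.\<close>

lemma acts_relator:
  assumes \<nu>: "\<nu> \<in> dominant D" and r: "r \<in> S_relators D (below \<nu>)"
  shows "acts \<nu> r z \<in> NN \<nu>"
proof (rule lin_into_subspace[OF lin_acts NN_subspace])
  fix l
  let ?W = "weyl_orbit D (below \<nu>)"
  let ?x = "wd l :: 'i free_alg"
  let ?\<mu> = "wtx \<nu> l"
  let ?i = "idm (below \<nu>)"
  note fW = finite_weyl_orbit[OF finite_below[OF \<nu>]]
  note la = lin_act_left[of "ops \<nu>"]
  have ai: "acts \<nu> (?i \<mu>') ?x = (if \<mu>' \<in> ?W \<and> ?\<mu> = \<mu>' then ?x else 0)" for \<mu>'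
    by (rule acts_idm[OF hx_wd])
  have xN: "?\<mu> \<notin> ?W \<Longrightarrow> ?x \<in> NN \<nu>" by (rule hx_NN[OF \<nu> hx_wd])
  have ssum: "acts \<nu> (\<Sum>\<mu>'\<in>?W. c \<mu>' *\<^sub>q ?i \<mu>') ?x = (if ?\<mu> \<in> ?W then c ?\<mu> *\<^sub>q ?x else 0)" for c
  proof -
    have "acts \<nu> (\<Sum>\<mu>'\<in>?W. c \<mu>' *\<^sub>q ?i \<mu>') ?x = (\<Sum>\<mu>'\<in>?W. if ?\<mu> = \<mu>' then c \<mu>' *\<^sub>q ?x else 0)"
      unfolding lin_sum[OF la] lin_scal[OF la] ai by (intro sum.cong) auto
    then show ?thesis using fW by simp
  qed
  from r consider (1) \<mu> \<mu>' where "r = ?i \<mu> * ?i \<mu>' - (if \<mu> = \<mu>' then ?i \<mu> else 0)"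
    | (2) "r = (\<Sum>\<mu>\<in>?W. ?i \<mu>) - 1"
    | (3) \<epsilon> i \<mu> where "i \<in> I" "r = sE \<epsilon> i * ?i \<mu> - ?i (\<mu> + signed \<epsilon> (root D i)) * sE \<epsilon> i"
    | (4) i j where "i \<in> I" "j \<in> I" "r = sE Plus i * sE Minus j - sE Minus j * sE Plus i
          - (if i = j then
               (\<Sum>\<mu>\<in>?W. scal (qint (v_at D i) (pair D (coroot D i) \<mu>)) * ?i \<mu>)
             else 0)"
    | (5) "r \<in> serre_relators D sE"
    unfolding S_relators_eq by blast
  then show "acts \<nu> r ?x \<in> NN \<nu>"
  proof cases
    case 1
    have "acts \<nu> r ?x = 0"
      unfolding 1 by (auto simp: lin_diff[OF la] acts_mult ai lin_0[OF lin_acts] lin_0[OF la])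
    then show ?thesis by (simp add: NN_0)
  next
    case 2
    have "acts \<nu> r ?x = (if ?\<mu> \<in> ?W then ?x else 0) - ?x"
      unfolding 2 using ssum[of "\<lambda>_. 1"] by (simp add: lin_diff[OF la])
    then show ?thesis using xN by (auto simp: NN_0 NN_minus)
  next
    case 3
    let ?y = "ops \<nu> (SGenE \<epsilon> i) ?x"
    have y: "?y \<in> hx \<nu> (?\<mu> + signed \<epsilon> (\<alpha> i))" by (rule hx_ops[OF hx_wd])
    have e: "acts \<nu> r ?x = (if \<mu> \<in> ?W \<and> ?\<mu> = \<mu> then ?y else 0)
      - (if \<mu> + signed \<epsilon> (\<alpha> i) \<in> ?W \<and> ?\<mu> = \<mu> then ?y else 0)"
      unfolding 3(2) lin_diff[OF la] acts_mult act_gen acts_idm[OF y] ai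
      by (auto simp: lin_0[OF lin_ops])
    have "?y \<in> NN \<nu>" if "?\<mu> \<notin> ?W"
      using acts_NN[OF \<nu> sE_fc[OF 3(1)] xN[OF that], of \<epsilon>] by simp
    moreover have "?y \<in> NN \<nu>" if "?\<mu> + signed \<epsilon> (\<alpha> i) \<notin> ?W"
      by (rule hx_NN[OF \<nu> y that])
    ultimately show ?thesis unfolding e by (auto simp: NN_0 NN_minus)
  next
    case 4
    have x: "?x \<in> Wt (lam \<nu>) i (pair D (h i) ?\<mu>)" using Wt_wd[of l "lam \<nu>" i] by (simp add: pair_wtx)
    show ?thesis
    proof (cases "i = j")
      case True
      then have ji: "j = i" by simp
      have "acts \<nu> r ?x = qint (v i) (pair D (h i) ?\<mu>) *\<^sub>q ?x - (if ?\<mu> \<in> ?W then qint (v i) (pair D (h i) ?\<mu>) *\<^sub>q ?x else 0)"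
        unfolding 4(3) using ssum[of "\<lambda>\<mu>. qint (v i) (pair D (h i) \<mu>)"]
        by (simp add: ji lin_diff[OF la] acts_mult v_at Eop_gen_Wt[OF x])
      then show ?thesis using xN by (auto simp: NN_0 NN_smul)
    next
      case False
      then have "acts \<nu> r ?x = 0" unfolding 4(3) by (simp add: lin_diff[OF la] acts_mult lin_0[OF la] Eop_gen_other)
      then show ?thesis by (simp add: NN_0)
    qed
  next
    case 5
    then obtain \<epsilon> i j where ij: "i \<in> I" "j \<in> I" "i \<noteq> j"
      and r: "r = (\<Sum>(s, s')\<in>{(s, s'). int s + int s' = 1 - aa i j}.
        (- 1) ^ s' * free_divpow (v_at D i) (sE \<epsilon> i) s * sE \<epsilon> j * free_divpow (v_at D i) (sE \<epsilon> i) s')"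
      unfolding serre_relators_def by blast
    have "acts \<nu> r ?x = serre_op (v i) (nat (1 - aa i j)) (ops \<nu> (SGenE \<epsilon> i)) (ops \<nu> (SGenE \<epsilon> j)) ?x"
      unfolding r serre_sum[OF one_minus_aij[OF ij]] serre_op_def lin_sum[OF la]
      by (simp add: acts_mult act_free_divpow v_at flip: scal_minus1_power)
    also have "\<dots> \<in> NN \<nu>"
      using Eop_serre[OF ij] serre_ideal_mult_right[OF serre_elt_mem[OF ij], of ?x]
      by (cases \<epsilon>) (simp_all add: NN_0 NN_serre_ideal serre_elt_op)
    finally show ?thesis .
  qed
qed

text \<open>The elements mapping everything into \<open>NN \<nu>\<close> form an ideal, closed under
  multiplication from the left because the generators preserve \<open>NN \<nu>\<close>.\<close>

lemma acts_J:
  assumes \<nu>: "\<nu> \<in> dominant D" and a: "a \<in> S.J (below \<nu>)"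
  shows "acts \<nu> a z \<in> NN \<nu>"
proof -
  let ?G = "S_gens D (below \<nu>)"
  let ?K = "{a \<in> fc ?G. \<forall>z. acts \<nu> a z \<in> NN \<nu>}"
  note la = lin_act_left[of "ops \<nu>"]
  interpret ring "free_algebra ?G" by (rule free_algebra_ring)
  have m: "\<ominus>\<^bsub>free_algebra ?G\<^esub> a = - a" if "a \<in> fc ?G" for a
    by (rule minus_equality) (use that fc_minus in auto)
  have "ideal ?K (free_algebra ?G)"
  proof (rule idealI)
    show "subgroup ?K (add_monoid (free_algebra ?G))"
      by (rule add.subgroupI)
        (auto simp: lin_add[OF la] lin_minus[OF la] lin_0[OF la] fc_add NN_add fc_minus NN_minus NN_0 fc_0 m intro!: exI[of _ 0])
  qed (auto simp: free_algebra_ring fc_mult acts_mult intro: acts_NN[OF \<nu>])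
  from S.J_minimal[OF this] have "S.J (below \<nu>) \<subseteq> ?K" using S_relators_fc acts_relator[OF \<nu>] by auto
  then show ?thesis using a by auto
qed

section \<open>Straightening in \<open>U\<close>\<close>

abbreviation uE :: "sign \<Rightarrow> 'i \<Rightarrow> ('i, 'y) ugen free_alg" where
  "uE \<epsilon> i \<equiv> gen (UGenE \<epsilon> i)"

abbreviation uK :: "'y \<Rightarrow> ('i, 'y) ugen free_alg" where
  "uK y \<equiv> gen (UGenK y)"

text \<open>Letters outside \<open>I\<close> go to 0, in accordance with \<open>serre_ideal\<close>,
  which contains all words with such letters.\<close>

definition UE :: "sign \<Rightarrow> 'i free_alg \<Rightarrow> ('i, 'y) ugen free_alg" where
  "UE \<epsilon> = subst (\<lambda>i. if i \<in> I then uE \<epsilon> i else 0)"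

lemma lin_UE: "lin (UE \<epsilon>)"
  by (simp add: UE_def lin_subst)

lemma UE_mult: "UE \<epsilon> (a * b) = UE \<epsilon> a * UE \<epsilon> b"
  by (simp add: UE_def subst_mult)

lemma UE_gen: "i \<in> I \<Longrightarrow> UE \<epsilon> (gen i) = uE \<epsilon> i"
  by (simp add: UE_def)

lemma UE_1: "UE \<epsilon> 1 = 1"
  by (simp add: UE_def)

lemma uE_fc: "i \<in> I \<Longrightarrow> uE \<epsilon> i \<in> fc (U_gens D)"
  by (intro fc_gen) (auto simp: U_gens_def)

lemma uK_fc: "uK y \<in> fc (U_gens D)"
  by (intro fc_gen) (auto simp: U_gens_def)

lemma UE_fc: "UE \<epsilon> a \<in> fc (U_gens D)"
proof -
  have "a \<in> fc UNIV" by (simp add: homog_def span_wd)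
  then show ?thesis unfolding UE_def by (rule subst_fc[rotated]) (auto simp: uE_fc fc_0)
qed

lemma UE_bad: assumes "\<not> set l \<subseteq> I" shows "UE \<epsilon> (wd l) = 0"
  using assms by (induction l) (auto simp: UE_def subst_wd)

lemma UE_serre_ideal: assumes "x \<in> serre_ideal" shows "UE \<epsilon> x \<in> U.J"
proof (rule lin_span_subspace[OF lin_UE U.J_subspace assms[unfolded serre_ideal_def]])
  fix g assume "g \<in> SIgen"
  then consider (1) x y i j where "g = wd x * serre_elt i j * wd y" "i \<in> I" "j \<in> I" "i \<noteq> j"
    | (2) l' where "g = wd l'" "\<not> set l' \<subseteq> I"
    unfolding SIgen_def by blast
  then show "UE \<epsilon> g \<in> U.J"
  proof cases
    case 1
    note ij = 1(2-4)
    have "UE \<epsilon> (serre_elt i j) = (\<Sum>(s, s')\<in>{(s, s'). int s + int s' = 1 - aa i j}.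
        (- 1) ^ s' * free_divpow (v_at D i) (uE \<epsilon> i) s * uE \<epsilon> j * free_divpow (v_at D i) (uE \<epsilon> i) s')"
      unfolding serre_sum[OF one_minus_aij[OF ij]] serre_elt_def UE_def lin_sum[OF lin_subst]
      using ij by (simp add: subst_mult subst_free_divpow v_at flip: scal_minus1_power)
    also have "\<dots> \<in> U_relators D"
      unfolding U_relators_def Let_def serre_relators_def using ij by blast
    finally have "UE \<epsilon> (serre_elt i j) \<in> U.J" by (rule U.J_rel)
    then show ?thesis unfolding 1(1) UE_mult by (intro U.J_mult_left U.J_mult_right UE_fc)
  next
    case 2
    then show ?thesis by (simp add: UE_bad U.J_0)
  qed
qed

text \<open>Products of F's, one K and E's in this order, modulo the relations. That they span U is
  obtained by showing this space stable under left multiplication by every generator.\<close>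

definition Tri :: "('i, 'y) ugen free_alg set" where
  "Tri = fa.span (U.J \<union> {UE Minus (wd x) * uK y * UE Plus (wd z) | x y z. True})"

lemma Tri_subspace: "fa.subspace Tri"
  by (simp add: Tri_def)

lemmas Tri_add = fa.subspace_add[OF Tri_subspace] and Tri_diff = fa.subspace_diff[OF Tri_subspace]
  and Tri_smul = fa.subspace_scale[OF Tri_subspace]

lemma Tri_J: "x \<in> U.J \<Longrightarrow> x \<in> Tri"
  unfolding Tri_def by (simp add: fa.span_base)

lemma Tri_base: "UE Minus (wd x) * uK y * UE Plus (wd z) \<in> Tri"
  unfolding Tri_def by (rule fa.span_base) blast

lemma Tri_cong: "a \<in> Tri \<Longrightarrow> b - a \<in> U.J \<Longrightarrow> b \<in> Tri"
  using Tri_add[of a "b - a"] Tri_J by simp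

lemma Tri_left:
  assumes "b \<in> fc (U_gens D)" "\<And>x y z. b * (UE Minus (wd x) * uK y * UE Plus (wd z)) \<in> Tri" "a \<in> Tri"
  shows "b * a \<in> Tri"
  by (rule lin_span_subspace[OF lin_mult_left[OF lin_id] Tri_subspace assms(3)[unfolded Tri_def]])
     (use assms(1,2) in \<open>auto intro: Tri_J U.J_mult_left\<close>)

lemma U_KK: "uK y * uK y' - uK (y + y') \<in> U.J"
  by (rule U.J_rel) (unfold U_relators_def Let_def, blast)

lemma U_KE: "i \<in> I \<Longrightarrow> uK y * uE \<epsilon> i - scal (vv powi signed \<epsilon> (pair D y (root D i))) * uE \<epsilon> i * uK y \<in> U.J"
  by (rule U.J_rel) (unfold U_relators_def Let_def, blast)

lemma U_K0: "uK 0 - 1 \<in> U.J"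
  by (rule U.J_rel) (unfold U_relators_def Let_def, blast)

lemma U_EF: "i \<in> I \<Longrightarrow> j \<in> I \<Longrightarrow> uE Plus i * uE Minus j - uE Minus j * uE Plus i
          - (if i = j then
               scal (inverse (v_at D i - inverse (v_at D i)))
                 * (uK (zscale (d_at D i) (coroot D i)) - uK (- zscale (d_at D i) (coroot D i)))
             else 0) \<in> U.J"
  by (rule U.J_rel) (unfold U_relators_def Let_def, blast)

lemma Tri_F: assumes i: "i \<in> I" and a: "a \<in> Tri" shows "uE Minus i * a \<in> Tri"
proof (rule Tri_left[OF uE_fc[OF i] _ a])
  show "uE Minus i * (UE Minus (wd x) * uK y * UE Plus (wd z)) \<in> Tri" for x y z
    using Tri_base[of "i # x" y z] by (simp add: wd_Cons UE_mult UE_gen[OF i] mult.assoc)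
qed

lemma U_K_wd: "\<exists>c. uK y * UE \<epsilon> (wd x) - c *\<^sub>q (UE \<epsilon> (wd x) * uK y) \<in> U.J"
proof (induction x)
  case Nil
  then show ?case by (intro exI[of _ 1]) (simp add: UE_1 U.J_0)
next
  case (Cons i x)
  then obtain c where c: "uK y * UE \<epsilon> (wd x) - c *\<^sub>q (UE \<epsilon> (wd x) * uK y) \<in> U.J" by blast
  show ?case
  proof (cases "i \<in> I")
    case True
    define e where "e = vv powi signed \<epsilon> (pair D y (root D i))"
    let ?X = "UE \<epsilon> (wd x)"
    have 1: "(uK y * uE \<epsilon> i - e *\<^sub>q uE \<epsilon> i * uK y) * ?X \<in> U.J"
      unfolding e_def by (intro U.J_mult_right U_KE True UE_fc)
    have 2: "e *\<^sub>q (uE \<epsilon> i * (uK y * ?X - c *\<^sub>q (?X * uK y))) \<in> U.J"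
      by (intro U.J_smul U.J_mult_left c uE_fc True)
    have "(uK y * uE \<epsilon> i - e *\<^sub>q uE \<epsilon> i * uK y) * ?X + e *\<^sub>q (uE \<epsilon> i * (uK y * ?X - c *\<^sub>q (?X * uK y)))
      = uK y * (uE \<epsilon> i * ?X) - (e * c) *\<^sub>q (uE \<epsilon> i * ?X * uK y)"
      by (simp add: left_diff_distrib right_diff_distrib mult.assoc gen_scal)
    then show ?thesis using U.J_add[OF 1 2]
      by (intro exI[of _ "e * c"]) (simp add: wd_Cons UE_mult UE_gen[OF True])
  next
    case False
    then have "UE \<epsilon> (wd (i # x)) = 0" by (intro UE_bad) auto
    then show ?thesis by (simp add: U.J_0)
  qed
qed

lemma Tri_K: assumes a: "a \<in> Tri" shows "uK y' * a \<in> Tri"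
proof (rule Tri_left[OF uK_fc _ a])
  fix x y z
  let ?F = "UE Minus (wd x)" and ?E = "UE Plus (wd z)"
  obtain c where c: "uK y' * ?F - c *\<^sub>q (?F * uK y') \<in> U.J" using U_K_wd by blast
  have 1: "(uK y' * ?F - c *\<^sub>q (?F * uK y')) * (uK y * ?E) \<in> U.J"
    by (intro U.J_mult_right c fc_mult uK_fc UE_fc)
  have 2: "c *\<^sub>q (?F * ((uK y' * uK y - uK (y' + y)) * ?E)) \<in> U.J"
    by (intro U.J_smul U.J_mult_left U.J_mult_right U_KK UE_fc)
  have "uK y' * (?F * uK y * ?E) - c *\<^sub>q (?F * uK (y' + y) * ?E)
    = (uK y' * ?F - c *\<^sub>q (?F * uK y')) * (uK y * ?E) + c *\<^sub>q (?F * ((uK y' * uK y - uK (y' + y)) * ?E))"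
    by (simp add: left_diff_distrib right_diff_distrib mult.assoc)
  then show "uK y' * (?F * uK y * ?E) \<in> Tri"
    using U.J_add[OF 1 2] by (intro Tri_cong[OF Tri_smul[OF Tri_base[of x "y' + y" z], of c]]) simp
qed

text \<open>Induction on the F-word: the commutator of E_i with the first F_j is a combination of
  K's, which \<open>Tri_K\<close> absorbs, and E_i moves on to the shorter word. When no F is left,
  E_i passes K up to a power of v.\<close>

lemma Tri_E: assumes i: "i \<in> I" and a: "a \<in> Tri" shows "uE Plus i * a \<in> Tri"
proof (rule Tri_left[OF uE_fc[OF i] _ a])
  fix x y z
  show "uE Plus i * (UE Minus (wd x) * uK y * UE Plus (wd z)) \<in> Tri"
  proof (induction x)
    case Nil
    define e where "e = vv powi (pair D y (\<alpha> i))"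
    let ?E = "UE Plus (wd z)"
    have e: "e \<noteq> 0" by (simp add: e_def vv_nz)
    have "uK y * uE Plus i - e *\<^sub>q uE Plus i * uK y \<in> U.J"
      using U_KE[OF i, of y Plus] by (simp add: e_def)
    then have 1: "- (inverse e *\<^sub>q ((uK y * uE Plus i - e *\<^sub>q uE Plus i * uK y) * ?E)) \<in> U.J"
      by (intro U.J_minus U.J_smul U.J_mult_right UE_fc)
    have "inverse e *\<^sub>q (uK y * (uE Plus i * ?E)) \<in> Tri"
      using Tri_smul[OF Tri_base[of "[]" y "i # z"]] by (simp add: UE_1 wd_Cons UE_mult UE_gen[OF i])
    then have "uE Plus i * (uK y * ?E) \<in> Tri"
      by (rule Tri_cong) (use 1 e in \<open>simp add: left_diff_distrib right_diff_distrib mult.assoc\<close>)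
    then show ?case by (simp add: UE_1)
  next
    case (Cons j x)
    show ?case
    proof (cases "j \<in> I")
      case j: True
      let ?X = "UE Minus (wd x) * uK y * UE Plus (wd z)"
      let ?c = "if i = j then
               scal (inverse (v_at D i - inverse (v_at D i)))
                 * (uK (zscale (d_at D i) (coroot D i)) - uK (- zscale (d_at D i) (coroot D i)))
             else 0"
      have X: "?X \<in> fc (U_gens D)" by (intro fc_mult UE_fc uK_fc)
      have "?c * ?X \<in> Tri"
        using Tri_smul[OF Tri_diff[OF Tri_K[OF Tri_base[of x y z]] Tri_K[OF Tri_base[of x y z]]]] Tri_J[OF U.J_0]
        by (simp add: mult.assoc left_diff_distrib)
      then have "uE Minus j * (uE Plus i * ?X) + ?c * ?X \<in> Tri"
        by (intro Tri_add Tri_F[OF j] Cons.IH)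
      then have "uE Plus i * (uE Minus j * ?X) \<in> Tri"
        by (rule Tri_cong)
           (use U.J_mult_right[OF U_EF[OF i j] X] in \<open>simp add: left_diff_distrib mult.assoc algebra_simps\<close>)
      then show ?thesis by (simp add: wd_Cons UE_mult UE_gen[OF j] mult.assoc)
    next
      case False
      then have "UE Minus (wd (j # x)) = 0" by (intro UE_bad) auto
      then show ?thesis using Tri_J[OF U.J_0] by simp
    qed
  qed
qed

lemma fc_Tri: assumes "u \<in> fc (U_gens D)" shows "u \<in> Tri"
proof (rule homog_lin[OF lin_id Tri_subspace _ assms])
  fix l assume "set l \<subseteq> U_gens D"
  then show "wd l \<in> Tri"
  proof (induction l)
    case Nil
    have "uK 0 \<in> Tri" using Tri_base[of "[]" 0 "[]"] by (simp add: UE_1)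
    then have "1 \<in> Tri" by (rule Tri_cong) (use U.J_minus[OF U_K0] in simp)
    then show ?case by simp
  next
    case (Cons g l)
    then have g: "g \<in> U_gens D" and l: "wd l \<in> Tri" by auto
    from g consider \<epsilon> i where "g = UGenE \<epsilon> i" "i \<in> I" | y where "g = UGenK y" unfolding U_gens_def by auto
    then show ?case
    proof cases
      case 1
      then show ?thesis using Tri_E[OF 1(2) l] Tri_F[OF 1(2) l] by (cases \<epsilon>) (simp_all add: wd_Cons)
    next
      case 2
      then show ?thesis using Tri_K[OF l] by (simp add: wd_Cons)
    qed
  qed
qed

end

section \<open>Faithfulness\<close>

text \<open>A basis of N is extended by words to a basis of the free algebra; \<open>Bs\<close> are
  the added words and \<phi> the corresponding coordinate functions. For the Serre subspace this
  supplies both the E-words of the triangular form and enough linear functionals on U^-.\<close>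

lemma complement_coordinates:
  fixes N :: "'g free_alg set"
  assumes N: "fa.subspace N"
  obtains \<phi> :: "'g list \<Rightarrow> 'g free_alg \<Rightarrow> qv" and Bs where
    "\<And>b x y. \<phi> b (x + y) = \<phi> b x + \<phi> b y" "\<And>b c x. \<phi> b (c *\<^sub>q x) = c * \<phi> b x"
    "\<And>b x. b \<in> Bs \<Longrightarrow> x \<in> N \<Longrightarrow> \<phi> b x = 0"
    "\<And>b b'. b \<in> Bs \<Longrightarrow> b' \<in> Bs \<Longrightarrow> \<phi> b (wd b') = (if b = b' then 1 else 0)"
    "\<And>x. x \<in> fa.span (N \<union> wd ` Bs)" "\<And>x. (\<And>b. b \<in> Bs \<Longrightarrow> \<phi> b x = 0) \<Longrightarrow> x \<in> N"
proof -
  obtain B0 where B0: "B0 \<subseteq> N" "fa.independent B0" "N \<subseteq> fa.span B0"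
    using fa.maximal_independent_subset by blast
  obtain B where B: "B0 \<subseteq> B" "B \<subseteq> B0 \<union> range wd" "fa.independent B" "B0 \<union> range wd \<subseteq> fa.span B"
    using fa.maximal_independent_subset_extend[of B0 "B0 \<union> range wd"] B0 by blast
  have inj: "wd l = wd l' \<longleftrightarrow> l = l'" for l l' :: "'g list"
    by (auto simp: wd_def dest: arg_cong[where f = Poly_Mapping.keys])
  have "fa.span (range wd) \<subseteq> fa.span B"
    by (rule fa.span_minimal) (use B(4) in auto)
  then have sp: "x \<in> fa.span B" for x by (auto simp: span_wd)
  define Bs where "Bs = {l. wd l \<in> B \<and> wd l \<notin> B0}"
  define \<phi> where "\<phi> b x = fa.representation B x (wd b)" for b x
  show ?thesis
  proof (rule that[of \<phi> Bs])
    show "\<phi> b (x + y) = \<phi> b x + \<phi> b y" for b x y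
      unfolding \<phi>_def by (simp add: fa.representation_add[OF B(3) sp sp])
    show "\<phi> b (c *\<^sub>q x) = c * \<phi> b x" for b c x
      unfolding \<phi>_def by (simp add: fa.representation_scale[OF B(3) sp])
    show "\<phi> b x = 0" if "b \<in> Bs" "x \<in> N" for b x
    proof -
      have "fa.representation B x = fa.representation B0 x"
        by (rule fa.representation_extend[OF B(3) _ B(1)]) (use B0 that in auto)
      then show ?thesis using that fa.representation_ne_zero unfolding \<phi>_def Bs_def by fastforce
    qed
    show "\<phi> b (wd b') = (if b = b' then 1 else 0)" if "b \<in> Bs" "b' \<in> Bs" for b b'
      using that fa.representation_basis[OF B(3), of "wd b'"] unfolding \<phi>_def Bs_def by (auto simp: inj)
    have "B \<subseteq> N \<union> wd ` Bs" using B(2) B0(1) by (auto simp: Bs_def)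
    then show "x \<in> fa.span (N \<union> wd ` Bs)" for x using sp fa.span_mono by blast
    show "x \<in> N" if x: "\<And>b. b \<in> Bs \<Longrightarrow> \<phi> b x = 0" for x
    proof -
      have "b \<in> N" if "fa.representation B x b \<noteq> 0" for b
      proof (rule ccontr)
        assume "b \<notin> N"
        moreover have "b \<in> B" using that by (rule fa.representation_ne_zero)
        ultimately obtain l where "b = wd l" "l \<in> Bs" using B(2) B0(1) by (auto simp: Bs_def)
        then show False using x that by (auto simp: \<phi>_def)
      qed
      then have "(\<Sum>b | fa.representation B x b \<noteq> 0. fa.representation B x b *\<^sub>q b) \<in> N"
        by (intro fa.subspace_sum[OF N] fa.subspace_scale[OF N]) auto
      then show ?thesis by (simp add: fa.sum_nonzero_representation_eq[OF B(3) sp])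
    qed
  qed
qed

section \<open>Polynomial dependence on a multiple of the highest weight\<close>

definition sN :: "nat \<Rightarrow> qv" where
  "sN N = inverse vv ^ N"

text \<open>The variable is v^(-N), not v^N: once the top power of v^N is divided off, the leading
  term becomes the constant term \<open>z\<close>, to be read off by evaluation at 0.\<close>

definition poly_family :: "(nat \<Rightarrow> 'g free_alg) \<Rightarrow> 'g free_alg \<Rightarrow> bool" where
  "poly_family f z \<longleftrightarrow> (\<exists>M Z. Z 0 = z \<and> (\<forall>N. f N = (\<Sum>m\<le>M. (sN N ^ m) *\<^sub>q Z m)))"

lemma poly_family_const: "poly_family (\<lambda>_. x) x"
  unfolding poly_family_def by (intro exI[of _ "0::nat"] exI[of _ "\<lambda>_. x"]) simp

lemma poly_family_lin: assumes "lin g" "poly_family f z" shows "poly_family (\<lambda>N. g (f N)) (g z)"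
proof -
  obtain M Z where "Z 0 = z" "\<And>N. f N = (\<Sum>m\<le>M. (sN N ^ m) *\<^sub>q Z m)" using assms(2) unfolding poly_family_def by blast
  then show ?thesis unfolding poly_family_def
    by (intro exI[of _ M] exI[of _ "\<lambda>m. g (Z m)"]) (simp add: lin_sum[OF assms(1)] lin_scal[OF assms(1)])
qed

lemma poly_family_diff: assumes "poly_family f z" "poly_family f' z'" shows "poly_family (\<lambda>N. f N - f' N) (z - z')"
proof -
  obtain M Z where Z: "Z 0 = z" "\<And>N. f N = (\<Sum>m\<le>M. (sN N ^ m) *\<^sub>q Z m)" using assms(1) unfolding poly_family_def by blast
  obtain M' Z' where Z': "Z' 0 = z'" "\<And>N. f' N = (\<Sum>m\<le>M'. (sN N ^ m) *\<^sub>q Z' m)" using assms(2) unfolding poly_family_def by blast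
  have pad: "(\<Sum>m\<le>k. (sN N ^ m) *\<^sub>q Y m) = (\<Sum>m\<le>k'. (sN N ^ m) *\<^sub>q (if m \<le> k then Y m else 0))" if "k \<le> k'" for k k' N and Y :: "nat \<Rightarrow> 'a free_alg"
  proof -
    have "(\<Sum>m\<le>k. (sN N ^ m) *\<^sub>q Y m) = (\<Sum>m\<le>k. (sN N ^ m) *\<^sub>q (if m \<le> k then Y m else 0))" by (intro sum.cong) auto
    also have "\<dots> = (\<Sum>m\<le>k'. (sN N ^ m) *\<^sub>q (if m \<le> k then Y m else 0))"
      by (rule sum.mono_neutral_left) (use that in auto)
    finally show ?thesis .
  qed
  show ?thesis unfolding poly_family_def
    by (intro exI[of _ "max M M'"] exI[of _ "\<lambda>m. (if m \<le> M then Z m else 0) - (if m \<le> M' then Z' m else 0)"])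
       (simp add: Z Z' pad[of M "max M M'"] pad[of M' "max M M'"] right_diff_distrib sum_subtractf)
qed

lemma poly_family_shift: assumes "poly_family f z" "e \<ge> 1" shows "poly_family (\<lambda>N. (sN N ^ e) *\<^sub>q f N) 0"
proof -
  obtain M Z where Z: "Z 0 = z" "\<And>N. f N = (\<Sum>m\<le>M. (sN N ^ m) *\<^sub>q Z m)" using assms(1) unfolding poly_family_def by blast
  let ?Z = "\<lambda>m. if m < e then 0 else Z (m - e)"
  have "(\<Sum>m\<le>M + e. (sN N ^ m) *\<^sub>q ?Z m) = (sN N ^ e) *\<^sub>q f N" for N
  proof -
    have "(\<Sum>m\<le>M + e. (sN N ^ m) *\<^sub>q ?Z m) = (\<Sum>m\<in>(\<lambda>m. m + e) ` {..M}. (sN N ^ m) *\<^sub>q ?Z m)"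
    proof (rule sum.mono_neutral_right)
      show "\<forall>i\<in>{..M + e} - (\<lambda>m. m + e) ` {..M}. (sN N ^ i) *\<^sub>q ?Z i = 0"
      proof
        fix i assume i: "i \<in> {..M + e} - (\<lambda>m. m + e) ` {..M}"
        have "i < e"
        proof (rule ccontr)
          assume "\<not> i < e"
          then have "i = (i - e) + e" "i - e \<in> {..M}" using i by auto
          then show False using i by blast
        qed
        then show "(sN N ^ i) *\<^sub>q ?Z i = 0" by simp
      qed
    qed auto
    also have "\<dots> = (\<Sum>m\<le>M. (sN N ^ (m + e)) *\<^sub>q Z m)"
      by (subst sum.reindex) (auto simp: inj_on_def)
    finally show ?thesis by (simp add: Z sum_distrib_left scal_mult_assoc power_add mult.commute)
  qed
  then show ?thesis unfolding poly_family_def using assms(2)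
    by (intro exI[of _ "M + e"] exI[of _ ?Z]) auto
qed

definition const_coeff :: "'g free_alg \<Rightarrow> qv" where
  "const_coeff x = Poly_Mapping.lookup x 0"

lemma const_coeff_add: "const_coeff (x + y) = const_coeff x + const_coeff y" and const_coeff_smul: "const_coeff (c *\<^sub>q x) = c * const_coeff x"
  and const_coeff_sum: "const_coeff (sum f A) = (\<Sum>i\<in>A. const_coeff (f i))" and const_coeff_0: "const_coeff 0 = 0"
  by (simp_all add: const_coeff_def lookup_add lookup_scal lookup_sum)

lemma const_coeff_scal: "const_coeff (scal c) = c"
  by (simp add: const_coeff_def scal_def)

lemma poly_family_const_coeff:
  assumes "poly_family f z" obtains P where "\<And>N. const_coeff (f N) = poly P (sN N)" "poly P 0 = const_coeff z"
proof -
  obtain M Z where Z: "Z 0 = z" "\<And>N. f N = (\<Sum>m\<le>M. (sN N ^ m) *\<^sub>q Z m)" using assms unfolding poly_family_def by blast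
  show ?thesis
  proof (rule that[of "\<Sum>m\<le>M. Polynomial.monom (const_coeff (Z m)) m"])
    show "const_coeff (f N) = poly (\<Sum>m\<le>M. Polynomial.monom (const_coeff (Z m)) m) (sN N)" for N
      by (simp add: Z const_coeff_sum const_coeff_smul poly_sum poly_monom mult.commute)
    have "poly (\<Sum>m\<le>M. Polynomial.monom (const_coeff (Z m)) m) 0 = (\<Sum>m\<le>M. if m = 0 then const_coeff (Z m) else 0)"
      unfolding poly_sum by (intro sum.cong) (auto simp: poly_monom)
    then show "poly (\<Sum>m\<le>M. Polynomial.monom (const_coeff (Z m)) m) 0 = const_coeff z" by (simp add: Z)
  qed
qed

lemma inj_sN: "inj sN"
proof (rule injI)
  fix M N assume "sN M = sN N"
  then have "inverse vv powi int M = inverse vv powi int N" by (simp add: sN_def)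
  then show "M = N" using not_root_of_unity_inj[OF not_root_of_unity_inverse[OF not_root_of_unity_vv]] by fastforce
qed

text \<open>The powers v^(-N) are pairwise different, so P has infinitely many roots.\<close>

lemma poly_sN_zero:
  assumes "\<And>N. N \<ge> L \<Longrightarrow> poly P (sN N) = 0" shows "P = 0"
proof (rule ccontr)
  assume "P \<noteq> 0"
  then have "finite {x. poly P x = 0}" by (rule poly_roots_finite)
  moreover have "sN ` {L..} \<subseteq> {x. poly P x = 0}" using assms by auto
  ultimately have "finite (sN ` {L..})" by (rule rev_finite_subset)
  then show False using finite_imageD[OF _ inj_on_subset[OF inj_sN]] infinite_Ici by blast
qed

lemma sN_powi: "k \<ge> 0 \<Longrightarrow> vv powi (- (int N * k)) = sN N ^ nat k"
proof -
  assume "k \<ge> 0"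
  then obtain j where "k = int j" by (rule nonneg_int_cases)
  moreover have "vv powi (- (int N * int j)) = inverse (vv ^ (N * j))"
    by (simp only: power_int_minus of_nat_mult[symmetric] power_int_of_nat)
  ultimately show ?thesis by (simp add: sN_def power_inverse power_mult)
qed

lemma length_bound: "\<exists>L. \<forall>m\<ge>L. (x :: 'g free_alg) \<in> homog (\<lambda>l. length l \<le> m)"
  by (rule free_alg_eventually[OF homog_subspace]) (auto intro: homog_wd)

context qdatum
begin

lemma e0_const_coeff: "e0 x = scal (const_coeff x)"
proof -
  have "e0 (wd l) = const_coeff (wd l) *\<^sub>q 1" for l :: "'i list"
  proof (cases l)
    case Nil
    moreover have "const_coeff (1 :: 'i free_alg) = 1" using const_coeff_scal[of 1] by simp
    ultimately show ?thesis by (simp add: e0_1)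
  next
    case (Cons k b)
    then have "const_coeff (wd l) = 0" by (simp add: const_coeff_def wd_def lookup_single zero_word_def)
    then show ?thesis using Cons diag_op_wd[of "\<lambda>l. if l = [] then 1 else 0" l] by (simp add: e0_def)
  qed
  moreover have "lin (\<lambda>x :: 'i free_alg. const_coeff x *\<^sub>q (1 :: 'i free_alg))"
    by (rule linI) (simp_all add: const_coeff_add const_coeff_smul scal_add scal_mult)
  ultimately show ?thesis using lin_eqI[OF lin_e0, of "\<lambda>x. const_coeff x *\<^sub>q 1" x] by simp
qed

text \<open>The projection to words of length at most L fixes x, preserves the Serre subspace and
  kills the adjoined vectors, whose length exceeds \<lambda>_i \<ge> L. In low degrees the quotient
  therefore agrees with U^-.\<close>

lemma NL_short:
  assumes x: "x \<in> NL J la" and L: "x \<in> homog (\<lambda>l. length l \<le> L)" and la: "\<And>i. i \<in> J \<Longrightarrow> int L \<le> la i"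
  shows "x \<in> serre_ideal"
proof -
  let ?g = "\<lambda>l. if length l \<le> L then 1 else 0 :: qv"
  have "x \<in> homog (\<lambda>l. ?g l = 1)" using L by (rule homog_mono[rotated]) simp
  from diag_op_homog[OF this] have "x = diag_op ?g x" by simp
  also have "\<dots> \<in> serre_ideal"
  proof (rule NL_cases[OF lin_diag_op serre_ideal_subspace x])
    show "diag_op ?g x \<in> serre_ideal" if "x \<in> serre_ideal" for x
      by (rule serre_ideal_diag_op[OF _ that]) (auto dest: mset_eq_length)
    fix w i assume i: "i \<in> J"
    have "wd w * gen i ^ Suc (nat (la i)) \<in> hm (mset w + repeat_mset (Suc (nat (la i))) {#i#})"
      by (intro hm_mult hm_wd hm_power hm_gen)
    then have "wd w * gen i ^ Suc (nat (la i)) \<in> homog (\<lambda>l. ?g l = 0)"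
    proof (rule hm_homog)
      fix l assume "mset l = mset w + repeat_mset (Suc (nat (la i))) {#i#}"
      then have "length l = length w + Suc (nat (la i))" by (metis size_mset size_union size_repeat_mset size_single mult.right_neutral)
      then show "?g l = 0" using la[OF i] by auto
    qed
    from diag_op_homog[OF this] show "diag_op ?g (wd w * gen i ^ Suc (nat (la i))) \<in> serre_ideal" by (simp add: serre_ideal_0)
  qed
  finally show ?thesis .
qed

text \<open>The action of E_k at highest weight N x, divided by its top coefficient
  \<open>leading_factor\<close>: the ratio of the two scalars in \<open>Eop_skew_der\<close> is
  v_k^(-2 N x_k), a power of v^(-N) with positive exponent when x_k \<ge> 1.\<close>

definition scaled_E :: "('i \<Rightarrow> int) \<Rightarrow> nat \<Rightarrow> 'i \<Rightarrow> 'i free_alg \<Rightarrow> 'i free_alg" where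
  "scaled_E x N k z = skew_der (-1) k z - (sN N ^ nat (2 * d k * x k)) *\<^sub>q skew_der 1 k z"

lemma lin_scaled_E: "lin (scaled_E x N k)"
  unfolding scaled_E_def by (intro lin_minus_fun lin_smul lin_skew_der)

lemma poly_family_foldr_scaled_E:
  assumes x: "\<And>k. k \<in> I \<Longrightarrow> 1 \<le> x k" and "set b \<subseteq> I"
  shows "poly_family (\<lambda>N. foldr (scaled_E x N) b z) (ract (wd b) z)"
  using assms(2)
proof (induction b)
  case Nil
  then show ?case by (simp add: poly_family_const)
next
  case (Cons k b)
  then have k: "k \<in> I" and IH: "poly_family (\<lambda>N. foldr (scaled_E x N) b z) (ract (wd b) z)" by auto
  have "0 < d k * x k" using x[OF k] d_pos[OF k] by simp
  then have "nat (2 * d k * x k) \<ge> 1" by (simp add: mult.assoc)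
  from poly_family_diff[OF poly_family_lin[OF lin_skew_der IH, of "-1" k] poly_family_shift[OF poly_family_lin[OF lin_skew_der IH, of 1 k] this]]
  have "poly_family (\<lambda>N. scaled_E x N k (foldr (scaled_E x N) b z)) (skew_der (-1) k (ract (wd b) z))"
    unfolding scaled_E_def[where k = k] by simp
  then show ?case by (simp add: act_wd)
qed

definition leading_factor :: "('i \<Rightarrow> int) \<Rightarrow> nat \<Rightarrow> 'i \<Rightarrow> qv" where
  "leading_factor x N k = inverse (v k - inverse (v k)) * v k powi (int N * x k)"

text \<open>The factor split off depends on the E-word only through its multiset of letters. It is
  thus common to all E-words of one weight and cancels from a vanishing sum over them.\<close>

lemma foldr_Eop_scaled_E:
  assumes x: "\<And>k. k \<in> I \<Longrightarrow> 1 \<le> x k" and "set b \<subseteq> I"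
  shows "foldr (Eop (\<lambda>k. int N * x k)) b z = prod_mset (image_mset (leading_factor x N) (mset b)) *\<^sub>q foldr (scaled_E x N) b z"
  using assms(2)
proof (induction b)
  case (Cons k b)
  then have k: "k \<in> I" by simp
  have E: "Eop (\<lambda>k. int N * x k) k y = leading_factor x N k *\<^sub>q scaled_E x N k y" for y
  proof -
    have "- (int N * x k) * d k = int N * x k * d k + - (int N * (2 * d k * x k))" by (simp add: algebra_simps)
    then have "v k powi (- (int N * x k)) = v k powi (int N * x k) * sN N ^ nat (2 * d k * x k)"
      using x[OF k] d_pos[OF k] vv_nz
      by (simp add: v_def sN_powi[symmetric] mult.commute[of "d k"] mult.assoc flip: power_int_mult power_int_add)
    then show ?thesis
      by (simp add: Eop_skew_der[OF k] leading_factor_def scaled_E_def right_diff_distrib scal_mult_assoc mult.assoc)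
  qed
  have "foldr (Eop (\<lambda>k. int N * x k)) (k # b) z
    = leading_factor x N k *\<^sub>q scaled_E x N k (prod_mset (image_mset (leading_factor x N) (mset b)) *\<^sub>q foldr (scaled_E x N) b z)"
    using Cons by (simp add: E)
  then show ?case by (simp add: lin_scal[OF lin_scaled_E] scal_mult_assoc)
qed simp

lemma leading_factor_nz:
  assumes "set_mset M \<subseteq> I" shows "prod_mset (image_mset (leading_factor x N) M) \<noteq> 0"
  using assms
proof (induction M)
  case (add k M)
  then have k: "not_root_of_unity (v k)" by (auto intro: not_root_of_unity_v)
  then show ?case using add not_root_of_unity_diff_nz[OF k] not_root_of_unityD(1)[OF k] by (auto simp: leading_factor_def)
qed simp

end

context rdatum
begin

section \<open>Triangular forms and their action\<close>

definition tri_term :: "'i free_alg \<Rightarrow> 'y \<times> 'i list \<Rightarrow> ('i, 'y) ugen free_alg" where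
  "tri_term y p = UE Minus y * uK (fst p) * UE Plus (wd (snd p))"

lemma lin_tri_term: "lin (\<lambda>y. tri_term y p)"
  unfolding tri_term_def by (intro lin_mult_right lin_UE)

lemma tri_term_serre_ideal: "y \<in> serre_ideal \<Longrightarrow> tri_term y p \<in> U.J"
  unfolding tri_term_def by (intro U.J_mult_right UE_serre_ideal UE_fc uK_fc)

text \<open>The F-parts are collected for each pair of an element of Y and an E-word; E-words can be
  taken from \<open>Bs\<close> because all others reduce to these modulo the Serre subspace.\<close>

lemma triangular_form:
  assumes sp: "\<And>x. x \<in> fa.span (serre_ideal \<union> wd ` Bs)" and u: "u \<in> fc (U_gens D)"
  shows "\<exists>A Y. finite A \<and> (\<forall>p\<in>A. snd p \<in> Bs \<and> Y p \<notin> serre_ideal) \<and> u - (\<Sum>p\<in>A. tri_term (Y p) p) \<in> U.J"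
proof -
  define R where "R = {u. \<exists>A Y. finite A \<and> (\<forall>p\<in>A. snd p \<in> Bs) \<and> u - (\<Sum>p\<in>A. tri_term (Y p) p) \<in> U.J}"
  have RJ: "u \<in> R" if "u \<in> U.J" for u
    unfolding R_def using that by (intro CollectI exI[of _ "{}"]) simp
  have Radd: "u + u' \<in> R" if uR: "u \<in> R" and uR': "u' \<in> R" for u u'
  proof -
    obtain A Y where A: "finite A" "\<forall>p\<in>A. snd p \<in> Bs" "u - (\<Sum>p\<in>A. tri_term (Y p) p) \<in> U.J" using uR unfolding R_def by (elim CollectE exE conjE) (rule that)
    obtain A' Y' where A': "finite A'" "\<forall>p\<in>A'. snd p \<in> Bs" "u' - (\<Sum>p\<in>A'. tri_term (Y' p) p) \<in> U.J" using uR' unfolding R_def by (elim CollectE exE conjE) (rule that)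
    let ?Y = "\<lambda>p. (if p \<in> A then Y p else 0) + (if p \<in> A' then Y' p else 0)"
    have pad: "(\<Sum>p\<in>A \<union> A'. tri_term (if p \<in> C then Z p else 0) p) = (\<Sum>p\<in>C. tri_term (Z p) p)" if "C \<subseteq> A \<union> A'" for C Z
    proof -
      have "(\<Sum>p\<in>C. tri_term (Z p) p) = (\<Sum>p\<in>C. tri_term (if p \<in> C then Z p else 0) p)" by (intro sum.cong) auto
      also have "\<dots> = (\<Sum>p\<in>A \<union> A'. tri_term (if p \<in> C then Z p else 0) p)"
        by (rule sum.mono_neutral_left) (use that A A' lin_0[OF lin_tri_term] in auto)
      finally show ?thesis by simp
    qed
    have "(u + u') - (\<Sum>p\<in>A \<union> A'. tri_term (?Y p) p) = (u - (\<Sum>p\<in>A. tri_term (Y p) p)) + (u' - (\<Sum>p\<in>A'. tri_term (Y' p) p))"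
      by (simp add: lin_add[OF lin_tri_term] sum.distrib pad)
    also have "\<dots> \<in> U.J" using A(3) A'(3) by (rule U.J_add)
    finally show ?thesis unfolding R_def using A A' by (intro CollectI exI[of _ "A \<union> A'"] exI[of _ ?Y]) auto
  qed
  have Rsmul: "c *\<^sub>q u \<in> R" if uR: "u \<in> R" for c u
  proof -
    obtain A Y where A: "finite A" "\<forall>p\<in>A. snd p \<in> Bs" "u - (\<Sum>p\<in>A. tri_term (Y p) p) \<in> U.J" using uR unfolding R_def by (elim CollectE exE conjE) (rule that)
    have "c *\<^sub>q u - (\<Sum>p\<in>A. tri_term (c *\<^sub>q Y p) p) = c *\<^sub>q (u - (\<Sum>p\<in>A. tri_term (Y p) p))"
      by (simp add: lin_scal[OF lin_tri_term] right_diff_distrib sum_distrib_left)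
    also have "\<dots> \<in> U.J" using A(3) by (rule U.J_smul)
    finally show ?thesis unfolding R_def using A by (intro CollectI exI[of _ A] exI[of _ "\<lambda>p. c *\<^sub>q Y p"]) auto
  qed
  have Rsub: "fa.subspace R" by (rule fa.subspaceI[OF RJ[OF U.J_0] Radd Rsmul])
  have base: "UE Minus (wd x) * uK y * UE Plus t \<in> R" for x y t
  proof (rule lin_span_subspace[OF lin_mult_left[OF lin_UE] Rsub sp])
    fix t assume "t \<in> serre_ideal \<union> wd ` Bs"
    then consider "t \<in> serre_ideal" | b where "t = wd b" "b \<in> Bs" by auto
    then show "UE Minus (wd x) * uK y * UE Plus t \<in> R"
    proof cases
      case 1
      then show ?thesis by (intro RJ U.J_mult_left UE_serre_ideal fc_mult UE_fc uK_fc)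
    next
      case 2
      then show ?thesis unfolding R_def
        by (intro CollectI exI[of _ "{(y, b)}"] exI[of _ "\<lambda>_. wd x"]) (simp add: tri_term_def U.J_0)
    qed
  qed
  have "Tri \<subseteq> R" unfolding Tri_def by (rule fa.span_minimal[OF _ Rsub]) (auto intro: RJ base)
  then have "u \<in> R" using fc_Tri[OF u] by blast
  then obtain A Y where A: "finite A" "\<forall>p\<in>A. snd p \<in> Bs" "u - (\<Sum>p\<in>A. tri_term (Y p) p) \<in> U.J" unfolding R_def by (elim CollectE exE conjE) (rule that)
  \<comment> \<open>Summands whose F-part lies in the Serre subspace are absorbed into the ideal, so
    that every remaining pair has a non-zero coefficient in U^-.\<close>
  let ?A = "{p \<in> A. Y p \<notin> serre_ideal}"
  have "(\<Sum>p\<in>A. tri_term (Y p) p) = (\<Sum>p\<in>?A. tri_term (Y p) p) + (\<Sum>p\<in>A - ?A. tri_term (Y p) p)"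
    using sum.subset_diff[of ?A A "\<lambda>p. tri_term (Y p) p"] A(1) by (simp add: add.commute)
  then have "u - (\<Sum>p\<in>?A. tri_term (Y p) p) = (u - (\<Sum>p\<in>A. tri_term (Y p) p)) + (\<Sum>p\<in>A - ?A. tri_term (Y p) p)" by simp
  also have "\<dots> \<in> U.J" by (intro U.J_add A(3) U.J_sum tri_term_serre_ideal) auto
  finally show ?thesis using A by (intro exI[of _ ?A] exI[of _ Y]) auto
qed

lemma acts_UE_Minus: "acts \<nu> (subst (valU \<pi>) (UE Minus y)) x - y * x \<in> serre_ideal"
proof -
  have "acts \<nu> (subst (valU \<pi>) (UE Minus (wd l))) x - wd l * x \<in> serre_ideal" for l
  proof (cases "set l \<subseteq> I")
    case True
    then have "acts \<nu> (subst (valU \<pi>) (UE Minus (wd l))) x = wd l * x"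
      by (induction l) (simp_all add: UE_1 wd_Cons UE_mult UE_gen subst_mult acts_mult mult.assoc)
    then show ?thesis by (simp add: serre_ideal_0)
  next
    case False
    then show ?thesis using serre_ideal_diff[OF serre_ideal_0 serre_ideal_mult_right[OF serre_ideal_bad[of l], of x]] by (simp add: UE_bad lin_0[OF lin_subst] lin_0[OF lin_act_left])
  qed
  then show ?thesis
    by (rule lin_into_subspace[OF lin_minus_fun[OF lin_comp[OF lin_act_left lin_comp[OF lin_subst lin_UE]] lin_mult_right[OF lin_id]] serre_ideal_subspace])
qed

lemma acts_UE_Plus: "set b \<subseteq> I \<Longrightarrow> acts \<nu> (subst (valU \<pi>) (UE Plus (wd b))) x = foldr (Eop (lam \<nu>)) b x"
  by (induction b) (simp_all add: UE_1 wd_Cons UE_mult UE_gen subst_mult acts_mult)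

lemma acts_kk:
  assumes \<nu>: "\<nu> \<in> dominant D"
  shows "acts \<nu> (kk (below \<nu>) y) (scal e) = (vv powi pair D y \<nu> * e) *\<^sub>q 1"
proof -
  let ?W = "weyl_orbit D (below \<nu>)"
  have "1 \<in> hx \<nu> \<nu>" using hx_wd[of "[]" \<nu>] by (simp add: wtx_def)
  then have "acts \<nu> (idm (below \<nu>) \<mu>) 1 = (if \<mu> \<in> ?W \<and> \<nu> = \<mu> then 1 else 0)" for \<mu>
    by (rule acts_idm)
  moreover have "\<nu> \<in> ?W" by (rule weyl_orbit_self[OF below_self[OF \<nu>]])
  ultimately have "acts \<nu> (idm (below \<nu>) \<mu>) 1 = (if \<nu> = \<mu> then 1 else 0)" for \<mu> by auto
  then have "acts \<nu> (kk (below \<nu>) y) 1 = (\<Sum>\<mu>\<in>?W. if \<nu> = \<mu> then scal (vv powi pair D y \<mu>) else 0)"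
    unfolding kk_def by (simp add: lin_sum[OF lin_act_left] lin_scal[OF lin_act_left]) (intro sum.cong refl; simp)
  then have "acts \<nu> (kk (below \<nu>) y) 1 = scal (vv powi pair D y \<nu>)"
    using \<open>\<nu> \<in> ?W\<close> finite_weyl_orbit[OF finite_below[OF \<nu>]] by simp
  then have "acts \<nu> (kk (below \<nu>) y) (e *\<^sub>q 1) = (vv powi pair D y \<nu> * e) *\<^sub>q 1"
    unfolding lin_scal[OF lin_acts] by (simp add: mult.commute flip: scal_mult)
  then show ?thesis by simp
qed

text \<open>The E-word carries z to a multiple of the highest weight vector, on which K acts by a
  scalar, so that only the F-part remains.\<close>

lemma acts_tri_term:
  assumes \<nu>: "\<nu> \<in> dominant D" and b: "set (snd p) \<subseteq> I" and e: "foldr (Eop (lam \<nu>)) (snd p) z = scal e"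
  shows "acts \<nu> (subst (valU (below \<nu>)) (tri_term y p)) z - (vv powi pair D (fst p) \<nu> * e) *\<^sub>q y \<in> serre_ideal"
proof -
  have "acts \<nu> (subst (valU (below \<nu>)) (tri_term y p)) z
    = (vv powi pair D (fst p) \<nu> * e) *\<^sub>q acts \<nu> (subst (valU (below \<nu>)) (UE Minus y)) 1"
    unfolding tri_term_def subst_mult acts_mult acts_UE_Plus[OF b] e subst_gen ugen.case acts_kk[OF \<nu>] lin_scal[OF lin_acts] ..
  then have "acts \<nu> (subst (valU (below \<nu>)) (tri_term y p)) z - (vv powi pair D (fst p) \<nu> * e) *\<^sub>q y
    = (vv powi pair D (fst p) \<nu> * e) *\<^sub>q (acts \<nu> (subst (valU (below \<nu>)) (UE Minus y)) 1 - y * 1)"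
    by (simp add: right_diff_distrib)
  then show ?thesis using serre_ideal_smul[OF acts_UE_Minus[where x = 1]] by simp
qed

text \<open>
  If some \<open>u\<close> outside the ideal acted as zero everywhere, let \<open>n\<close> be the minimal length of the
  words in the \<open>E\<^sub>i\<close> occurring in its triangular form and act on words \<open>z\<close> of length \<open>n\<close> in the
  module with highest weight \<open>N \<xi>\<close>. Only \<open>E\<close>-words of the same weight as \<open>z\<close> contribute, through
  a scalar whose leading term as \<open>N\<close> grows is given by the non-degenerate pairing.
\<close>

theorem faithful:
  assumes u: "u \<in> fc (U_gens D)"
    and kill: "\<And>\<nu>. \<nu> \<in> dominant D \<Longrightarrow> subst (valU (below \<nu>)) u \<in> S.J (below \<nu>)"
  shows "u \<in> U.J"
proof -
  obtain \<phi> :: "'i list \<Rightarrow> 'i free_alg \<Rightarrow> qv" and Bs where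
    phi: "\<And>b x y. \<phi> b (x + y) = \<phi> b x + \<phi> b y" "\<And>b c x. \<phi> b (c *\<^sub>q x) = c * \<phi> b x"
    "\<And>b x. b \<in> Bs \<Longrightarrow> x \<in> serre_ideal \<Longrightarrow> \<phi> b x = 0"
    "\<And>b b'. b \<in> Bs \<Longrightarrow> b' \<in> Bs \<Longrightarrow> \<phi> b (wd b') = (if b = b' then 1 else 0)"
    "\<And>x. x \<in> fa.span (serre_ideal \<union> wd ` Bs)" "\<And>x. (\<And>b. b \<in> Bs \<Longrightarrow> \<phi> b x = 0) \<Longrightarrow> x \<in> serre_ideal"
  proof (rule complement_coordinates[OF serre_ideal_subspace], goal_cases)
    case prems: (1 \<phi> Bs)
    show ?case by (rule prems(1); fact prems)
  qed
  have phi0: "\<phi> b 0 = 0" for b using phi(2)[of b 0 0] by simp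
  have phisum: "\<phi> b (sum f A) = (\<Sum>i\<in>A. \<phi> b (f i))" for b A and f :: "'c \<Rightarrow> 'i free_alg"
    by (induction A rule: infinite_finite_induct) (simp_all add: phi(1) phi0)
  have BsI: "set b \<subseteq> I" if "b \<in> Bs" for b
  proof (rule ccontr)
    assume "\<not> set b \<subseteq> I"
    then have "\<phi> b (wd b) = 0" using that by (intro phi(3) serre_ideal_bad)
    then show False using phi(4)[OF that that] by simp
  qed
  obtain A Y where A: "finite A" "\<And>p. p \<in> A \<Longrightarrow> snd p \<in> Bs" "\<And>p. p \<in> A \<Longrightarrow> Y p \<notin> serre_ideal"
    "u - (\<Sum>p\<in>A. tri_term (Y p) p) \<in> U.J"
    using triangular_form[OF phi(5) u] by blast
  have "A = {}"
  proof (rule ccontr)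
    assume ne: "A \<noteq> {}"
    define n where "n = Min ((\<lambda>p. length (snd p)) ` A)"
    have n_le: "n \<le> length (snd p)" if "p \<in> A" for p unfolding n_def using A(1) that by simp
    have "n \<in> (\<lambda>p. length (snd p)) ` A" unfolding n_def using A(1) ne by (intro Min_in) auto
    then obtain pn where pn: "pn \<in> A" "length (snd pn) = n" by blast
    define A1 where "A1 = {p \<in> A. length (snd p) = n}"
    have A1: "finite A1" "pn \<in> A1" using A(1) pn by (auto simp: A1_def)
    \<comment> \<open>The non-zero differences of K-parts: a \<xi> on which none of them vanishes
      separates the K-parts.\<close>
    define Y0 where "Y0 = (\<lambda>(p, p'). fst p - fst p') ` (A \<times> A) - {0}"
    obtain \<xi> where \<xi>: "\<And>k. k \<in> I \<Longrightarrow> 1 \<le> pair D (h k) \<xi>" "\<And>y. y \<in> Y0 \<Longrightarrow> pair D y \<xi> \<noteq> 0"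
      using exists_generic[of Y0] A(1) by (auto simp: Y0_def)
    define y\<xi> where "y\<xi> p = pair D (fst p) \<xi>" for p :: "'y \<times> 'i list"
    have gen\<xi>: "fst p = fst p'" if "p \<in> A" "p' \<in> A" "y\<xi> p = y\<xi> p'" for p p'
    proof (rule ccontr)
      assume "fst p \<noteq> fst p'"
      then have "fst p - fst p' \<in> Y0" using that by (force simp: Y0_def)
      then show False using \<xi>(2) that(3) by (fastforce simp: y\<xi>_def pair_simps)
    qed
    \<comment> \<open>Among the summands with shortest E-words, the K-part growing fastest along N
      \<xi> is singled out; \<open>p0\<close> attains it and determines the multidegree \<mu> of the
      test words.\<close>
    define y0 where "y0 = Max (y\<xi> ` A1)"
    have y0_ge: "y\<xi> p \<le> y0" if "p \<in> A1" for p unfolding y0_def using A1 that by simp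
    have "y0 \<in> y\<xi> ` A1" unfolding y0_def using A1 by (intro Max_in) blast+
    then obtain p0 where p0: "p0 \<in> A1" "y\<xi> p0 = y0" by auto
    then have p0A: "p0 \<in> A" by (simp add: A1_def)
    define \<mu> where "\<mu> = mset (snd p0)"
    have \<mu>: "size \<mu> = n" "set_mset \<mu> \<subseteq> I" using p0 BsI[OF A(2)[OF p0A]] by (auto simp: \<mu>_def A1_def)
    define A2 where "A2 = {p \<in> A. mset (snd p) = \<mu>}"
    have A2: "finite A2" "A2 \<subseteq> A" "A2 \<subseteq> A1" using A(1) \<mu>(1) by (auto simp: A2_def A1_def dest: arg_cong[where f = size])
    \<comment> \<open>A coordinate in which the F-part of \<open>p0\<close> is non-zero; applying it
      turns an identity in U^- into a scalar one.\<close>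
    obtain b1 where b1: "b1 \<in> Bs" "\<phi> b1 (Y p0) \<noteq> 0" using phi(6)[of "Y p0"] A(3)[OF p0A] by blast
    define c where "c p = \<phi> b1 (Y p)" for p
    have "\<forall>p. \<exists>L. \<forall>m\<ge>L. Y p \<in> homog (\<lambda>l. length l \<le> m)" using length_bound by (rule allI)
    from choice[OF this] obtain Lp where Lp: "\<And>p m. m \<ge> Lp p \<Longrightarrow> Y p \<in> homog (\<lambda>l. length l \<le> m)" by auto
    define L where "L = (\<Sum>p\<in>A. Lp p)"
    have YL: "Y p \<in> homog (\<lambda>l. length l \<le> L)" if "p \<in> A" for p
      using Lp[of p L] member_le_sum[OF that, of Lp] A(1) by (simp add: L_def)
    define x where "x k = pair D (h k) \<xi>" for k
    have x1: "1 \<le> x k" if "k \<in> I" for k using \<xi>(1)[OF that] by (simp add: x_def)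
    \<comment> \<open>The combination of E-words that the leading coefficient pairs with z.
      Orthogonality to all z puts it into the Serre subspace, against its non-zero coordinate at the
      E-word of \<open>p0\<close>.\<close>
    define X where "X = (\<Sum>p | p \<in> A2 \<and> fst p = fst p0. c p *\<^sub>q wd (snd p))"
    have pairX: "const_coeff (ract X (wd z)) = 0" if z: "mset z = \<mu>" for z
    proof -
      have main: "(\<Sum>p\<in>A2. vv powi (int N * y\<xi> p) * c p * const_coeff (foldr (scaled_E x N) (snd p) (wd z))) = 0" if N: "N \<ge> L" for N
      proof -
        define \<nu> where "\<nu> = zscale (int N) \<xi>"
        have lam: "lam \<nu> = (\<lambda>k. int N * x k)" by (simp add: lam_def \<nu>_def pair_simps x_def fun_eq_iff)
        have lamL: "int L \<le> lam \<nu> k" if "k \<in> I" for k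
        proof -
          have "int N * 1 \<le> int N * x k" using x1[OF that] by (intro mult_left_mono) auto
          then show ?thesis using N by (simp add: lam)
        qed
        have dom: "\<nu> \<in> dominant D" using lamL by (force simp: dominant_def lam_def)
        define e where "e p = const_coeff (foldr (Eop (lam \<nu>)) (snd p) (wd z))" for p :: "'y \<times> 'i list"
        \<comment> \<open>No E-word is shorter than z, so the result is a scalar, and zero unless
          the E-word has the multidegree of z.\<close>
        have fo: "foldr (Eop (lam \<nu>)) (snd p) (wd z) \<in> homog (\<lambda>l. mset l = {#} \<and> mset (snd p) = \<mu>)" if "p \<in> A" for p
        proof (rule homog_mono[OF _ foldr_Eop_hm[OF hm_wd]])
          fix l assume l: "mset l + mset (snd p) = mset z"
          then have "length l + length (snd p) = n" using z \<mu>(1) by (metis size_mset size_union)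
          then have "length l = 0" using n_le[OF \<open>p \<in> A\<close>] by linarith
          then have "l = []" by simp
          then show "mset l = {#} \<and> mset (snd p) = \<mu>" using l z by simp
        qed
        have e: "foldr (Eop (lam \<nu>)) (snd p) (wd z) = scal (e p)" if "p \<in> A" for p
        proof -
          have "foldr (Eop (lam \<nu>)) (snd p) (wd z) \<in> hm {#}"
            unfolding hm_def using fo[OF that] by (rule homog_mono[rotated]) simp
          then show ?thesis using hm_empty unfolding e_def by (metis const_coeff_scal)
        qed
        have e0: "e p = 0" if "p \<in> A - A2" for p
        proof -
          have "foldr (Eop (lam \<nu>)) (snd p) (wd z) = 0"
            using fo[of p] that by (intro homog_nonempty_zero[of "\<lambda>l. mset l = {#} \<and> mset (snd p) = \<mu>"]) (auto simp: A2_def)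
          then show ?thesis by (simp add: e_def const_coeff_0)
        qed
        have eA2: "e p = prod_mset (image_mset (leading_factor x N) \<mu>) * const_coeff (foldr (scaled_E x N) (snd p) (wd z))" if "p \<in> A2" for p
        proof -
          have b: "set (snd p) \<subseteq> I" using that A2 A(2) BsI by blast
          have "mset (snd p) = \<mu>" using that by (simp add: A2_def)
          moreover have "foldr (Eop (\<lambda>k. int N * x k)) (snd p) (wd z)
              = prod_mset (image_mset (leading_factor x N) (mset (snd p))) *\<^sub>q foldr (scaled_E x N) (snd p) (wd z)"
            by (rule foldr_Eop_scaled_E[OF _ b]) (rule x1)
          ultimately show ?thesis unfolding e_def lam by (simp add: const_coeff_smul)
        qed
        let ?s = "subst (valU (below \<nu>))"
        define w where "w p = vv powi pair D (fst p) \<nu> * e p" for p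
        have "acts \<nu> (?s u) (wd z) \<in> NN \<nu>" by (rule acts_J[OF dom kill[OF dom]])
        moreover have "acts \<nu> (?s (u - (\<Sum>p\<in>A. tri_term (Y p) p))) (wd z) \<in> NN \<nu>"
          by (rule acts_J[OF dom presentation_hom.subst_J[OF U_to_S_hom[OF finite_below[OF dom]] A(4)]])
        ultimately have "acts \<nu> (?s u) (wd z) - acts \<nu> (?s (u - (\<Sum>p\<in>A. tri_term (Y p) p))) (wd z) \<in> NN \<nu>"
          by (rule NN_diff)
        then have 1: "(\<Sum>p\<in>A. acts \<nu> (?s (tri_term (Y p) p)) (wd z)) \<in> NN \<nu>"
          by (simp add: lin_diff[OF lin_subst] lin_diff[OF lin_act_left] lin_sum[OF lin_subst] lin_sum[OF lin_act_left])
        have "(\<Sum>p\<in>A. acts \<nu> (?s (tri_term (Y p) p)) (wd z) - w p *\<^sub>q Y p) \<in> NN \<nu>"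
          unfolding w_def by (intro NN_sum NN_serre_ideal acts_tri_term dom BsI A(2) e)
        from NN_diff[OF 1 this] have "(\<Sum>p\<in>A. w p *\<^sub>q Y p) \<in> NN \<nu>" by (simp add: sum_subtractf)
        \<comment> \<open>Here the vanishing in the integrable quotient is lifted to U^-: all
          F-parts have length at most L, and the highest weight is at least L on every
          coroot.\<close>
        then have "(\<Sum>p\<in>A. w p *\<^sub>q Y p) \<in> serre_ideal"
          unfolding NN_def by (rule NL_short[where L = L]) (auto intro!: fa.subspace_sum[OF homog_subspace] homog_smul YL lamL)
        from phi(3)[OF b1(1) this] have "0 = (\<Sum>p\<in>A. w p * c p)" by (simp add: phisum phi(2) c_def)
        also have "\<dots> = (\<Sum>p\<in>A2. w p * c p)"
          by (rule sum.mono_neutral_right) (use A(1) A2 e0 in \<open>auto simp: w_def\<close>)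
        also have "\<dots> = prod_mset (image_mset (leading_factor x N) \<mu>) * (\<Sum>p\<in>A2. vv powi (int N * y\<xi> p) * c p * const_coeff (foldr (scaled_E x N) (snd p) (wd z)))"
          unfolding sum_distrib_left by (intro sum.cong refl) (simp add: w_def eA2 \<nu>_def pair_simps y\<xi>_def mult_ac)
        finally show ?thesis using leading_factor_nz[OF \<mu>(2)] by simp
      qed
      have "\<exists>P. (\<forall>N. const_coeff (foldr (scaled_E x N) (snd p) (wd z)) = poly P (sN N)) \<and> poly P 0 = const_coeff (ract (wd (snd p)) (wd z))" if "p \<in> A2" for p
      proof -
        have "set (snd p) \<subseteq> I" using that A2 A(2) BsI by blast
        then have "poly_family (\<lambda>N. foldr (scaled_E x N) (snd p) (wd z)) (ract (wd (snd p)) (wd z))"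
          by (rule poly_family_foldr_scaled_E[rotated]) (rule x1)
        then show ?thesis by (rule poly_family_const_coeff) blast
      qed
      then obtain P where P: "\<And>p N. p \<in> A2 \<Longrightarrow> const_coeff (foldr (scaled_E x N) (snd p) (wd z)) = poly (P p) (sN N)"
        "\<And>p. p \<in> A2 \<Longrightarrow> poly (P p) 0 = const_coeff (ract (wd (snd p)) (wd z))" by metis
      \<comment> \<open>Dividing by v^(N y0) turns the Laurent polynomial into a polynomial in
        v^(-N); at 0 only the summands with the K-part of \<open>p0\<close> survive.\<close>
      define F where "F = (\<Sum>p\<in>A2. Polynomial.smult (c p) (Polynomial.monom 1 (nat (y0 - y\<xi> p)) * P p))"
      have "poly F (sN N) = 0" if "N \<ge> L" for N
      proof -
        have "poly F (sN N) = (\<Sum>p\<in>A2. vv powi (- (int N * y0)) * (vv powi (int N * y\<xi> p) * c p * const_coeff (foldr (scaled_E x N) (snd p) (wd z))))"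
          unfolding F_def poly_sum
        proof (intro sum.cong refl)
          fix p assume p: "p \<in> A2"
          have "y0 - y\<xi> p \<ge> 0" using y0_ge[of p] p A2(3) by (auto dest: subsetD)
          then have "sN N ^ nat (y0 - y\<xi> p) = vv powi (- (int N * y0)) * vv powi (int N * y\<xi> p)"
            using vv_nz by (simp add: sN_powi[symmetric] right_diff_distrib flip: power_int_add)
          then show "poly (Polynomial.smult (c p) (Polynomial.monom 1 (nat (y0 - y\<xi> p)) * P p)) (sN N)
            = vv powi (- (int N * y0)) * (vv powi (int N * y\<xi> p) * c p * const_coeff (foldr (scaled_E x N) (snd p) (wd z)))"
            by (simp add: poly_monom P(1)[OF p])
        qed
        then show ?thesis using main[OF that] by (simp flip: sum_distrib_left)
      qed
      then have "F = 0" by (rule poly_sN_zero)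
      then have "0 = poly F 0" by simp
      also have "\<dots> = (\<Sum>p\<in>A2. if fst p = fst p0 then c p * const_coeff (ract (wd (snd p)) (wd z)) else 0)"
        unfolding F_def poly_sum
      proof (intro sum.cong refl)
        fix p assume p: "p \<in> A2"
        have "fst p = fst p0 \<longleftrightarrow> y0 - y\<xi> p \<le> 0"
        proof
          assume "fst p = fst p0"
          then show "y0 - y\<xi> p \<le> 0" using p0(2) by (simp add: y\<xi>_def)
        next
          assume "y0 - y\<xi> p \<le> 0"
          then have "y\<xi> p = y\<xi> p0" using y0_ge[of p] p A2(3) p0(2) by (auto dest: subsetD)
          then show "fst p = fst p0" using gen\<xi>[of p p0] p A2(2) p0A by blast
        qed
        then show "poly (Polynomial.smult (c p) (Polynomial.monom 1 (nat (y0 - y\<xi> p)) * P p)) 0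
          = (if fst p = fst p0 then c p * const_coeff (ract (wd (snd p)) (wd z)) else 0)"
          by (auto simp: poly_monom P(2)[OF p] power_0_left)
      qed
      also have "\<dots> = const_coeff (ract X (wd z))"
        unfolding X_def lin_sum[OF lin_act_left] lin_scal[OF lin_act_left] const_coeff_sum const_coeff_smul
        using A2(1) by (simp add: sum.inter_filter)
      finally show ?thesis by simp
    qed
    have Xh: "X \<in> hm \<mu>" unfolding X_def
      by (intro fa.subspace_sum[OF hm_subspace] hm_smul) (metis (mono_tags, lifting) A2_def hm_wd mem_Collect_eq)
    have "X \<in> serre_ideal"
    proof (rule ccontr)
      assume "X \<notin> serre_ideal"
      then obtain z where "mset z = \<mu>" "e0 (ract X (wd z)) \<noteq> 0" using pairing_nondegenerate[OF Xh] by blast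
      then show False using pairX by (simp add: e0_const_coeff)
    qed
    then have "0 = \<phi> (snd p0) X" using phi(3) A(2)[OF p0A] by simp
    also have "\<dots> = (\<Sum>p | p \<in> A2 \<and> fst p = fst p0. if p = p0 then c p else 0)"
      unfolding X_def phisum phi(2)
    proof (intro sum.cong refl)
      fix p assume p: "p \<in> {p. p \<in> A2 \<and> fst p = fst p0}"
      then have "\<phi> (snd p0) (wd (snd p)) = (if snd p0 = snd p then 1 else 0)"
        using A(2)[of p] A(2)[OF p0A] A2(2) by (intro phi(4)) (auto dest: subsetD)
      then show "c p * \<phi> (snd p0) (wd (snd p)) = (if p = p0 then c p else 0)"
        using p by (auto simp: prod_eq_iff)
    qed
    also have "\<dots> = c p0"
    proof -
      have "p0 \<in> A2" using p0A by (simp add: A2_def \<mu>_def)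
      then show ?thesis using A2(1) by (subst sum.delta) auto
    qed
    finally show False using b1(2) by (simp add: c_def)
  qed
  then show ?thesis using A(4) by simp
qed

end

section \<open>Algebras over a ring of scalars\<close>

text \<open>The scalar -1 lies in \<open>L\<close> and acts as negation, so that closure under
  scalars brings closure under negatives, as subrings demand.\<close>

definition algebra_over :: "qv set \<Rightarrow> (qv, 'a) module \<Rightarrow> bool" where
  "algebra_over L A \<longleftrightarrow> ring A \<and> - 1 \<in> L \<and> (\<forall>c\<in>L. \<forall>x\<in>carrier A. c \<odot>\<^bsub>A\<^esub> x \<in> carrier A)
     \<and> (\<forall>x\<in>carrier A. ((- 1) \<odot>\<^bsub>A\<^esub> x) \<oplus>\<^bsub>A\<^esub> x = \<zero>\<^bsub>A\<^esub>)"

lemma algebra_over_mono: "algebra_over UNIV A \<Longrightarrow> - 1 \<in> L \<Longrightarrow> algebra_over L A"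
  by (auto simp: algebra_over_def)

lemma subalgebra_overI:
  assumes A: "algebra_over L A" and "t \<subseteq> carrier A" "\<one>\<^bsub>A\<^esub> \<in> t"
    "\<And>x y. x \<in> t \<Longrightarrow> y \<in> t \<Longrightarrow> x \<otimes>\<^bsub>A\<^esub> y \<in> t" "\<And>x y. x \<in> t \<Longrightarrow> y \<in> t \<Longrightarrow> x \<oplus>\<^bsub>A\<^esub> y \<in> t"
    "\<And>c x. c \<in> L \<Longrightarrow> x \<in> t \<Longrightarrow> c \<odot>\<^bsub>A\<^esub> x \<in> t"
  shows "subalgebra_over L A t"
proof -
  interpret ring A using A by (simp add: algebra_over_def)
  have "\<ominus>\<^bsub>A\<^esub> x \<in> t" if "x \<in> t" for x
  proof -
    have "\<ominus>\<^bsub>A\<^esub> x = (- 1) \<odot>\<^bsub>A\<^esub> x"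
      by (rule minus_equality) (use A assms(2) that in \<open>auto simp: algebra_over_def\<close>)
    then show ?thesis using A assms(6) that by (auto simp: algebra_over_def)
  qed
  then show ?thesis unfolding subalgebra_over_def using assms by (auto intro!: subringI)
qed

lemma subalgebra_overD:
  assumes "subalgebra_over L A t"
  shows "t \<subseteq> carrier A" "\<one>\<^bsub>A\<^esub> \<in> t" "\<zero>\<^bsub>A\<^esub> \<in> t" "x \<in> t \<Longrightarrow> y \<in> t \<Longrightarrow> x \<otimes>\<^bsub>A\<^esub> y \<in> t"
    "x \<in> t \<Longrightarrow> y \<in> t \<Longrightarrow> x \<oplus>\<^bsub>A\<^esub> y \<in> t" "c \<in> L \<Longrightarrow> x \<in> t \<Longrightarrow> c \<odot>\<^bsub>A\<^esub> x \<in> t"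
  using assms subringE[of t A] unfolding subalgebra_over_def by auto

lemma carrier_subalgebra: "algebra_over L A \<Longrightarrow> subalgebra_over L A (carrier A)"
proof -
  assume A: "algebra_over L A"
  then interpret ring A by (simp add: algebra_over_def)
  show ?thesis by (rule subalgebra_overI[OF A]) (use A in \<open>auto simp: algebra_over_def\<close>)
qed

lemma subalgebra_algebra:
  assumes A: "algebra_over L A" and t: "subalgebra_over L A t"
  shows "algebra_over L (A\<lparr>carrier := t\<rparr>)"
proof -
  interpret ring A using A by (simp add: algebra_over_def)
  have "ring (A\<lparr>carrier := t\<rparr>)" using t by (intro subring_is_ring) (simp add: subalgebra_over_def)
  then show ?thesis using A t subalgebra_overD(1)[OF t] by (auto simp: algebra_over_def subalgebra_over_def)
qed

lemma subalgebra_trans: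
  assumes A: "algebra_over L A" and t: "subalgebra_over L A t" and s: "subalgebra_over L (A\<lparr>carrier := t\<rparr>) s"
  shows "subalgebra_over L A s"
  by (rule subalgebra_overI[OF A]) (use subalgebra_overD[OF t] subalgebra_overD[OF s] in auto)

lemma subalgebra_gen_subalgebra:
  assumes A: "algebra_over L A" and S: "S \<subseteq> carrier A"
  shows "subalgebra_over L A (subalgebra_gen L A S)"
proof (rule subalgebra_overI[OF A])
  show "subalgebra_gen L A S \<subseteq> carrier A"
    unfolding subalgebra_gen_def by (rule hull_minimal[OF S]) (rule carrier_subalgebra[OF A])
qed (auto simp: subalgebra_gen_def hull_def intro: subalgebra_overD)

lemma subalgebra_gen_superset: "S \<subseteq> subalgebra_gen L A S"
  unfolding subalgebra_gen_def by (rule hull_subset)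

lemma subalgebra_gen_minimal: "S \<subseteq> t \<Longrightarrow> subalgebra_over L A t \<Longrightarrow> subalgebra_gen L A S \<subseteq> t"
  unfolding subalgebra_gen_def by (rule hull_minimal)

lemma alg_homD:
  assumes "f \<in> alg_hom L A B"
  shows "x \<in> carrier A \<Longrightarrow> f x \<in> carrier B" "f \<one>\<^bsub>A\<^esub> = \<one>\<^bsub>B\<^esub>"
    "x \<in> carrier A \<Longrightarrow> y \<in> carrier A \<Longrightarrow> f (x \<otimes>\<^bsub>A\<^esub> y) = f x \<otimes>\<^bsub>B\<^esub> f y"
    "x \<in> carrier A \<Longrightarrow> y \<in> carrier A \<Longrightarrow> f (x \<oplus>\<^bsub>A\<^esub> y) = f x \<oplus>\<^bsub>B\<^esub> f y"
    "c \<in> L \<Longrightarrow> x \<in> carrier A \<Longrightarrow> f (c \<odot>\<^bsub>A\<^esub> x) = c \<odot>\<^bsub>B\<^esub> f x"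
  using assms by (auto simp: alg_hom_def ring_hom_def)

lemma alg_homI:
  assumes "\<And>x. x \<in> carrier A \<Longrightarrow> f x \<in> carrier B" "f \<one>\<^bsub>A\<^esub> = \<one>\<^bsub>B\<^esub>"
    "\<And>x y. x \<in> carrier A \<Longrightarrow> y \<in> carrier A \<Longrightarrow> f (x \<otimes>\<^bsub>A\<^esub> y) = f x \<otimes>\<^bsub>B\<^esub> f y"
    "\<And>x y. x \<in> carrier A \<Longrightarrow> y \<in> carrier A \<Longrightarrow> f (x \<oplus>\<^bsub>A\<^esub> y) = f x \<oplus>\<^bsub>B\<^esub> f y"
    "\<And>c x. c \<in> L \<Longrightarrow> x \<in> carrier A \<Longrightarrow> f (c \<odot>\<^bsub>A\<^esub> x) = c \<odot>\<^bsub>B\<^esub> f x"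
  shows "f \<in> alg_hom L A B"
  using assms by (auto simp: alg_hom_def ring_hom_def)

lemma subalgebra_vimage:
  assumes A: "algebra_over L A" and f: "f \<in> alg_hom L A B" and s: "subalgebra_over L B s"
  shows "subalgebra_over L A {x \<in> carrier A. f x \<in> s}"
proof -
  interpret ring A using A by (simp add: algebra_over_def)
  show ?thesis
    by (rule subalgebra_overI[OF A])
      (use A in \<open>auto simp: alg_homD[OF f] subalgebra_overD[OF s] algebra_over_def\<close>)
qed

lemma subalgebra_image:
  assumes A: "algebra_over L A" and B: "algebra_over L B" and f: "f \<in> alg_hom L A B"
  shows "subalgebra_over L B (f ` carrier A)"
proof -
  interpret ring A using A by (simp add: algebra_over_def)
  have c: "c \<odot>\<^bsub>A\<^esub> x \<in> carrier A" if "c \<in> L" "x \<in> carrier A" for c x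
    using A that by (auto simp: algebra_over_def)
  show ?thesis
  proof (rule subalgebra_overI[OF B])
    show "\<one>\<^bsub>B\<^esub> \<in> f ` carrier A" using alg_homD(2)[OF f] by (metis image_eqI one_closed)
  qed (auto simp: alg_homD(1)[OF f] c alg_homD(3-5)[OF f, symmetric])
qed

lemma alg_hom_divpow:
  assumes A: "ring A" and B: "ring B" and f: "f \<in> alg_hom UNIV A B" and x: "x \<in> carrier A"
  shows "f (divpow A q x m) = divpow B q (f x) m"
proof -
  interpret A: ring A by (rule A)
  interpret B: ring B by (rule B)
  have "f (x [^]\<^bsub>A\<^esub> m) = f x [^]\<^bsub>B\<^esub> m"
    by (induction m) (simp_all add: alg_homD(2)[OF f] alg_homD(3)[OF f] x)
  then show ?thesis by (simp add: divpow_def alg_homD(5)[OF f] x)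
qed

lemma powi_laurent: "vv powi k \<in> laurent"
  unfolding laurent_def by (intro CollectI exI[of _ "{k}"] exI[of _ "\<lambda>_. 1"]) simp

lemma minus1_laurent: "- 1 \<in> laurent"
  unfolding laurent_def by (intro CollectI exI[of _ "{0}"] exI[of _ "\<lambda>_. -1"]) simp

lemma alg_hom_laurent: "f \<in> alg_hom UNIV A B \<Longrightarrow> f \<in> alg_hom laurent A B"
  by (auto simp: alg_hom_def)

lemma (in presentation) P_algebra: "algebra_over UNIV P"
  unfolding algebra_over_def
  by (auto simp: P_ring P_carrier P_smult P_add P_zero fc_smul fc_minus scal_uminus)

section \<open>The inverse limit and the map \<open>\<theta>\<close>\<close>

lemma subst_subst: "subst f (subst g a) = subst (\<lambda>x. subst f (g x)) a"
proof (rule lin_eqI[OF lin_comp[OF lin_subst lin_subst] lin_subst])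
  show "subst f (subst g (wd l)) = subst (\<lambda>x. subst f (g x)) (wd l)" for l
    by (induction l) (simp_all add: wd_Cons subst_mult)
qed

context rdatum
begin

abbreviation "FS \<equiv> finite_saturated D"

lemma FS_finite: "\<pi> \<in> FS \<Longrightarrow> finite \<pi>"
  by (simp add: finite_saturated_def)

lemma QS_algebra: "algebra_over UNIV (QS D \<pi>)"
  unfolding QS_def by (rule S.P_algebra)

lemma QU_algebra: "algebra_over UNIV (QU D)"
  unfolding QU_def by (rule U.P_algebra)

lemma QS_ring: "ring (QS D \<pi>)" and QU_ring: "ring (QU D)"
  using QS_algebra QU_algebra by (auto simp: algebra_over_def)

lemma Uhat_carrier:
  "a \<in> carrier (Uhat D) \<longleftrightarrow> a \<in> extensional FS \<and> (\<forall>\<pi>\<in>FS. a \<pi> \<in> carrier (QS D \<pi>))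
     \<and> (\<forall>\<pi>\<in>FS. \<forall>\<pi>'\<in>FS. \<pi> \<subseteq> \<pi>' \<longrightarrow> a \<pi> = S_map D \<pi> \<pi>' (a \<pi>'))"
  by (auto simp: Uhat_def PiE_def)

lemma UhatD:
  assumes "a \<in> carrier (Uhat D)"
  shows "a \<in> extensional FS" "\<pi> \<in> FS \<Longrightarrow> a \<pi> \<in> carrier (QS D \<pi>)"
    "\<pi> \<in> FS \<Longrightarrow> \<pi>' \<in> FS \<Longrightarrow> \<pi> \<subseteq> \<pi>' \<Longrightarrow> S_map D \<pi> \<pi>' (a \<pi>') = a \<pi>"
proof -
  show "a \<in> extensional FS" "\<pi> \<in> FS \<Longrightarrow> a \<pi> \<in> carrier (QS D \<pi>)"
    using assms[unfolded Uhat_carrier] by blast+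
  assume "\<pi> \<in> FS" "\<pi>' \<in> FS" "\<pi> \<subseteq> \<pi>'"
  then have "a \<pi> = S_map D \<pi> \<pi>' (a \<pi>')" using assms[unfolded Uhat_carrier] by blast
  then show "S_map D \<pi> \<pi>' (a \<pi>') = a \<pi>" by (rule sym)
qed

lemma Uhat_simps:
  "a \<otimes>\<^bsub>Uhat D\<^esub> b = (\<lambda>\<pi>\<in>FS. a \<pi> \<otimes>\<^bsub>QS D \<pi>\<^esub> b \<pi>)" "a \<oplus>\<^bsub>Uhat D\<^esub> b = (\<lambda>\<pi>\<in>FS. a \<pi> \<oplus>\<^bsub>QS D \<pi>\<^esub> b \<pi>)"
  "\<one>\<^bsub>Uhat D\<^esub> = (\<lambda>\<pi>\<in>FS. \<one>\<^bsub>QS D \<pi>\<^esub>)" "\<zero>\<^bsub>Uhat D\<^esub> = (\<lambda>\<pi>\<in>FS. \<zero>\<^bsub>QS D \<pi>\<^esub>)"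
  "c \<odot>\<^bsub>Uhat D\<^esub> a = (\<lambda>\<pi>\<in>FS. c \<odot>\<^bsub>QS D \<pi>\<^esub> a \<pi>)"
  by (simp_all add: Uhat_def)

lemma Uhat_eqI: "a \<in> extensional FS \<Longrightarrow> b \<in> extensional FS \<Longrightarrow> (\<And>\<pi>. \<pi> \<in> FS \<Longrightarrow> a \<pi> = b \<pi>) \<Longrightarrow> a = b"
  by (rule extensionalityI)

lemma QS_smult_closed: "x \<in> carrier (QS D \<pi>) \<Longrightarrow> c \<odot>\<^bsub>QS D \<pi>\<^esub> x \<in> carrier (QS D \<pi>)"
  using QS_algebra by (simp add: algebra_over_def)

lemma QS_closed: "x \<in> carrier (QS D \<pi>) \<Longrightarrow> y \<in> carrier (QS D \<pi>) \<Longrightarrow> x \<otimes>\<^bsub>QS D \<pi>\<^esub> y \<in> carrier (QS D \<pi>)"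
  "x \<in> carrier (QS D \<pi>) \<Longrightarrow> y \<in> carrier (QS D \<pi>) \<Longrightarrow> x \<oplus>\<^bsub>QS D \<pi>\<^esub> y \<in> carrier (QS D \<pi>)"
  "\<one>\<^bsub>QS D \<pi>\<^esub> \<in> carrier (QS D \<pi>)" "\<zero>\<^bsub>QS D \<pi>\<^esub> \<in> carrier (QS D \<pi>)"
proof -
  interpret ring "QS D \<pi>" by (rule QS_ring)
  show "x \<in> carrier (QS D \<pi>) \<Longrightarrow> y \<in> carrier (QS D \<pi>) \<Longrightarrow> x \<otimes>\<^bsub>QS D \<pi>\<^esub> y \<in> carrier (QS D \<pi>)"
    "x \<in> carrier (QS D \<pi>) \<Longrightarrow> y \<in> carrier (QS D \<pi>) \<Longrightarrow> x \<oplus>\<^bsub>QS D \<pi>\<^esub> y \<in> carrier (QS D \<pi>)"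
    "\<one>\<^bsub>QS D \<pi>\<^esub> \<in> carrier (QS D \<pi>)" "\<zero>\<^bsub>QS D \<pi>\<^esub> \<in> carrier (QS D \<pi>)"
    by simp_all
qed

lemma Uhat_restrictI:
  assumes "\<And>\<pi>. \<pi> \<in> FS \<Longrightarrow> f \<pi> \<in> carrier (QS D \<pi>)"
    "\<And>\<pi> \<pi>'. \<pi> \<in> FS \<Longrightarrow> \<pi>' \<in> FS \<Longrightarrow> \<pi> \<subseteq> \<pi>' \<Longrightarrow> f \<pi> = S_map D \<pi> \<pi>' (f \<pi>')"
  shows "restrict f FS \<in> carrier (Uhat D)"
  unfolding Uhat_carrier
proof (intro conjI ballI impI)
  fix \<pi> \<pi>' assume p: "\<pi> \<in> FS" "\<pi>' \<in> FS" "\<pi> \<subseteq> \<pi>'"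
  show "restrict f FS \<pi> = S_map D \<pi> \<pi>' (restrict f FS \<pi>')"
    using p(1,2) by (simp add: assms(2)[OF p, symmetric])
qed (simp_all add: assms(1))

lemma Uhat_closed:
  assumes a: "a \<in> carrier (Uhat D)" and b: "b \<in> carrier (Uhat D)"
  shows "a \<otimes>\<^bsub>Uhat D\<^esub> b \<in> carrier (Uhat D)" "a \<oplus>\<^bsub>Uhat D\<^esub> b \<in> carrier (Uhat D)"
    "c \<odot>\<^bsub>Uhat D\<^esub> a \<in> carrier (Uhat D)"
proof -
  note ab = UhatD(2)[OF a] UhatD(2)[OF b] and c = UhatD(3)[OF a] UhatD(3)[OF b]
  note hom = alg_homD[OF S_map(1)[OF _ FS_finite]]
  show "a \<otimes>\<^bsub>Uhat D\<^esub> b \<in> carrier (Uhat D)" unfolding Uhat_simps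
    by (rule Uhat_restrictI) (simp_all add: QS_closed ab hom(3) c)
  show "a \<oplus>\<^bsub>Uhat D\<^esub> b \<in> carrier (Uhat D)" unfolding Uhat_simps
    by (rule Uhat_restrictI) (simp_all add: QS_closed ab hom(4) c)
  show "c \<odot>\<^bsub>Uhat D\<^esub> a \<in> carrier (Uhat D)" unfolding Uhat_simps
    by (rule Uhat_restrictI) (simp_all add: QS_smult_closed ab hom(5) c)
qed

lemma Uhat_one: "\<one>\<^bsub>Uhat D\<^esub> \<in> carrier (Uhat D)"
  unfolding Uhat_simps
  by (rule Uhat_restrictI) (simp_all add: QS_closed alg_homD(2)[OF S_map(1)[OF _ FS_finite]])

lemma Uhat_zero: "\<zero>\<^bsub>Uhat D\<^esub> \<in> carrier (Uhat D)"
  unfolding Uhat_simps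
proof (rule Uhat_restrictI)
  fix \<pi> \<pi>' assume "\<pi>' \<in> FS" "\<pi> \<subseteq> \<pi>'"
  then show "\<zero>\<^bsub>QS D \<pi>\<^esub> = S_map D \<pi> \<pi>' \<zero>\<^bsub>QS D \<pi>'\<^esub>"
    using S_map(2)[OF _ FS_finite fc_0, of \<pi> \<pi>'] by (simp add: QS_def S.P_zero lin_0[OF lin_subst])
qed (rule QS_closed)

lemma Uhat_algebra: "algebra_over UNIV (Uhat D)"
proof -
  note e = UhatD(1) and q = UhatD(2)
  note rs = ring.ring_simprules[OF QS_ring]
  have minus: "((- 1) \<odot>\<^bsub>Uhat D\<^esub> a) \<oplus>\<^bsub>Uhat D\<^esub> a = \<zero>\<^bsub>Uhat D\<^esub>" if a: "a \<in> carrier (Uhat D)" for a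
    using QS_algebra q[OF a] by (auto simp: Uhat_simps algebra_over_def intro!: Uhat_eqI[of "restrict _ _"])
  have "ring (Uhat D)"
  proof (rule ringI)
    show "abelian_group (Uhat D)"
    proof (rule abelian_groupI)
      fix x y z assume xyz: "x \<in> carrier (Uhat D)" "y \<in> carrier (Uhat D)" "z \<in> carrier (Uhat D)"
      note qs = q[OF xyz(1)] q[OF xyz(2)] q[OF xyz(3)]
      show "(x \<oplus>\<^bsub>Uhat D\<^esub> y) \<oplus>\<^bsub>Uhat D\<^esub> z = x \<oplus>\<^bsub>Uhat D\<^esub> (y \<oplus>\<^bsub>Uhat D\<^esub> z)"
        by (rule Uhat_eqI) (auto simp: Uhat_simps rs(7) qs)
      show "x \<oplus>\<^bsub>Uhat D\<^esub> y = y \<oplus>\<^bsub>Uhat D\<^esub> x"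
      proof -
        have "u \<oplus>\<^bsub>QS D \<pi>\<^esub> v = v \<oplus>\<^bsub>QS D \<pi>\<^esub> u" if "u \<in> carrier (QS D \<pi>)" "v \<in> carrier (QS D \<pi>)" for \<pi> u v
        proof -
          interpret ring "QS D \<pi>" by (rule QS_ring)
          show ?thesis using that by (rule a_comm)
        qed
        then show ?thesis unfolding Uhat_simps by (intro restrict_ext) (simp add: qs)
      qed
      show "\<zero>\<^bsub>Uhat D\<^esub> \<oplus>\<^bsub>Uhat D\<^esub> x = x"
        by (rule Uhat_eqI[OF _ e[OF xyz(1)]]) (auto simp: Uhat_simps rs qs)
    next
      fix x assume x: "x \<in> carrier (Uhat D)"
      show "\<exists>y\<in>carrier (Uhat D). y \<oplus>\<^bsub>Uhat D\<^esub> x = \<zero>\<^bsub>Uhat D\<^esub>"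
        by (rule bexI[of _ "(- 1) \<odot>\<^bsub>Uhat D\<^esub> x"]) (rule minus[OF x], rule Uhat_closed(3)[OF x x])
    qed (simp_all add: Uhat_closed Uhat_zero)
    show "monoid (Uhat D)"
    proof (rule monoidI)
      fix x y z assume xyz: "x \<in> carrier (Uhat D)" "y \<in> carrier (Uhat D)" "z \<in> carrier (Uhat D)"
      note qs = q[OF xyz(1)] q[OF xyz(2)] q[OF xyz(3)]
      show "(x \<otimes>\<^bsub>Uhat D\<^esub> y) \<otimes>\<^bsub>Uhat D\<^esub> z = x \<otimes>\<^bsub>Uhat D\<^esub> (y \<otimes>\<^bsub>Uhat D\<^esub> z)"
        unfolding Uhat_simps by (intro restrict_ext) (simp add: qs monoid.m_assoc[OF ring.axioms(2)[OF QS_ring]])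
    next
      fix x assume x: "x \<in> carrier (Uhat D)"
      note qs = q[OF x]
      show "\<one>\<^bsub>Uhat D\<^esub> \<otimes>\<^bsub>Uhat D\<^esub> x = x" "x \<otimes>\<^bsub>Uhat D\<^esub> \<one>\<^bsub>Uhat D\<^esub> = x"
        by (rule Uhat_eqI[OF _ e[OF x]]; auto simp: Uhat_simps qs monoid.l_one monoid.r_one ring.axioms(2) QS_ring)+
    qed (simp_all add: Uhat_closed Uhat_one)
  next
    fix x y z assume xyz: "x \<in> carrier (Uhat D)" "y \<in> carrier (Uhat D)" "z \<in> carrier (Uhat D)"
    note qs = q[OF xyz(1)] q[OF xyz(2)] q[OF xyz(3)]
    show "(x \<oplus>\<^bsub>Uhat D\<^esub> y) \<otimes>\<^bsub>Uhat D\<^esub> z = x \<otimes>\<^bsub>Uhat D\<^esub> z \<oplus>\<^bsub>Uhat D\<^esub> y \<otimes>\<^bsub>Uhat D\<^esub> z"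
      "z \<otimes>\<^bsub>Uhat D\<^esub> (x \<oplus>\<^bsub>Uhat D\<^esub> y) = z \<otimes>\<^bsub>Uhat D\<^esub> x \<oplus>\<^bsub>Uhat D\<^esub> z \<otimes>\<^bsub>Uhat D\<^esub> y"
      by (rule Uhat_eqI; auto simp: Uhat_simps qs rs)+
  qed
  then show ?thesis unfolding algebra_over_def using minus by (auto intro: Uhat_closed(3))
qed

lemma valS_idm: "\<pi> \<subseteq> \<pi>' \<Longrightarrow> subst (valS \<pi>) (idm \<pi>' \<nu>) = idm \<pi> \<nu>"
  using weyl_orbit_mono[of \<pi> \<pi>'] by (auto simp: idm_def lin_0[OF lin_subst])

lemma valS_kk: assumes "\<pi> \<subseteq> \<pi>'" "finite \<pi>'" shows "subst (valS \<pi>) (kk \<pi>' y) = kk \<pi> y"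
proof -
  have "subst (valS \<pi>) (kk \<pi>' y) = (\<Sum>\<nu>\<in>weyl_orbit D \<pi>'. vv powi pair D y \<nu> *\<^sub>q idm \<pi> \<nu>)"
    unfolding kk_def[of \<pi>'] lin_sum[OF lin_subst] lin_scal[OF lin_subst] valS_idm[OF assms(1)] ..
  also have "\<dots> = kk \<pi> y"
    by (rule kk_superset[symmetric, OF finite_weyl_orbit[OF assms(2)] weyl_orbit_mono[OF assms(1)]])
  finally show ?thesis .
qed

text \<open>Both sides are substitutions that agree on generators: E goes to E, and
  \<open>kk \<pi>'\<close> to \<open>kk \<pi>\<close> because idempotents off the smaller orbit go
  to 0. This compatibility is what produces the map into the limit.\<close>

lemma S_map_U_to_S:
  assumes "\<pi> \<subseteq> \<pi>'" "finite \<pi>'" "u \<in> carrier (QU D)"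
  shows "S_map D \<pi> \<pi>' (U_to_S D \<pi>' u) = U_to_S D \<pi> u"
proof -
  obtain a where a: "a \<in> fc (U_gens D)" "u = U.cl a" using assms(3) by (auto simp: QU_def U.P_carrier)
  have "subst (valU \<pi>') a \<in> fc (S_gens D \<pi>')"
    by (rule subst_fc[OF presentation_hom.val_fc[OF U_to_S_hom[OF assms(2)]] a(1)])
  moreover have "(\<lambda>g. subst (valS \<pi>) (valU \<pi>' g)) = valU \<pi>"
    by (rule ext) (auto split: ugen.split simp: valS_kk[OF assms(1,2)])
  ultimately show ?thesis
    unfolding a(2) using a(1) finite_subset[OF assms(1,2)]
    by (simp add: U_to_S(2) assms(2) S_map(2)[OF assms(1,2)] subst_subst)
qed

definition \<theta>0 :: "('i, 'y) ugen free_alg set \<Rightarrow> ('i, 'x) hat" where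
  "\<theta>0 = (\<lambda>u\<in>carrier (QU D). \<lambda>\<pi>\<in>FS. U_to_S D \<pi> u)"

lemma \<theta>0_alg_hom: "\<theta>0 \<in> alg_hom UNIV (QU D) (Uhat D)"
proof (rule alg_homI)
  interpret ring "QU D" by (rule QU_ring)
  note hom = alg_homD[OF U_to_S(1)[OF FS_finite]]
  fix x assume x: "x \<in> carrier (QU D)"
  have "(\<lambda>\<pi>\<in>FS. U_to_S D \<pi> x) \<in> carrier (Uhat D)"
    by (rule Uhat_restrictI) (simp_all add: hom(1) x S_map_U_to_S[OF _ FS_finite])
  then show "\<theta>0 x \<in> carrier (Uhat D)" using x by (simp add: \<theta>0_def)
  have "c \<odot>\<^bsub>QU D\<^esub> x \<in> carrier (QU D)" for c using QU_algebra x by (simp add: algebra_over_def)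
  then show "\<theta>0 (c \<odot>\<^bsub>QU D\<^esub> x) = c \<odot>\<^bsub>Uhat D\<^esub> \<theta>0 x" for c
    using x by (auto simp: \<theta>0_def Uhat_simps hom(5) intro!: restrict_ext)
  fix y assume y: "y \<in> carrier (QU D)"
  show "\<theta>0 (x \<otimes>\<^bsub>QU D\<^esub> y) = \<theta>0 x \<otimes>\<^bsub>Uhat D\<^esub> \<theta>0 y" "\<theta>0 (x \<oplus>\<^bsub>QU D\<^esub> y) = \<theta>0 x \<oplus>\<^bsub>Uhat D\<^esub> \<theta>0 y"
    using x y by (auto simp: \<theta>0_def Uhat_simps hom(3,4) intro!: restrict_ext)
next
  interpret ring "QU D" by (rule QU_ring)
  show "\<theta>0 \<one>\<^bsub>QU D\<^esub> = \<one>\<^bsub>Uhat D\<^esub>"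
    by (auto simp: \<theta>0_def Uhat_simps alg_homD(2)[OF U_to_S(1)[OF FS_finite]] intro!: restrict_ext)
qed

text \<open>The components at all \<pi> determine an element of the limit, and extensionality fixes
  the function off the carrier.\<close>

lemma is_theta_iff: "is_theta D \<theta> \<longleftrightarrow> \<theta> = \<theta>0"
proof
  assume t: "is_theta D \<theta>"
  show "\<theta> = \<theta>0"
  proof (rule extensionalityI)
    show "\<theta> \<in> extensional (carrier (QU D))" using t by (simp add: is_theta_def)
    show "\<theta>0 \<in> extensional (carrier (QU D))" by (simp add: \<theta>0_def)
    fix u assume u: "u \<in> carrier (QU D)"
    have "\<theta> u \<in> carrier (Uhat D)" using t u alg_homD(1)[of \<theta>] by (auto simp: is_theta_def)
    then show "\<theta> u = \<theta>0 u"
    proof (rule Uhat_eqI[OF UhatD(1)])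
      show "\<theta>0 u \<in> extensional FS" using u by (simp add: \<theta>0_def)
      fix \<pi> assume "\<pi> \<in> FS"
      then show "\<theta> u \<pi> = \<theta>0 u \<pi>" using t u by (simp add: \<theta>0_def is_theta_def phat_def)
    qed
  qed
qed (auto simp: is_theta_def \<theta>0_alg_hom phat_def, auto simp: \<theta>0_def)

text \<open>Equality in the limit is evaluated at the saturated sets \<open>below \<nu>\<close>,
  which is exactly what \<open>faithful\<close> asks for.\<close>

lemma \<theta>0_inj: "inj_on \<theta>0 (carrier (QU D))"
proof (rule inj_onI)
  fix u u' assume u: "u \<in> carrier (QU D)" "u' \<in> carrier (QU D)" and eq: "\<theta>0 u = \<theta>0 u'"
  obtain a a' where a: "a \<in> fc (U_gens D)" "u = U.cl a" "a' \<in> fc (U_gens D)" "u' = U.cl a'"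
    using u by (auto simp: QU_def U.P_carrier)
  have "a - a' \<in> U.J"
  proof (rule faithful)
    show "a - a' \<in> fc (U_gens D)" using a by (intro fc_diff)
    fix \<nu> assume \<nu>: "\<nu> \<in> dominant D"
    let ?\<pi> = "below \<nu>"
    have \<pi>: "?\<pi> \<in> FS" by (rule below_finite_saturated[OF \<nu>])
    have "U_to_S D ?\<pi> u = U_to_S D ?\<pi> u'"
      using fun_cong[OF eq, of ?\<pi>] u \<pi> by (simp add: \<theta>0_def)
    then have "S.cl ?\<pi> (subst (valU ?\<pi>) a) = S.cl ?\<pi> (subst (valU ?\<pi>) a')"
      using a by (simp add: U_to_S(2)[OF FS_finite[OF \<pi>]])
    moreover have "subst (valU ?\<pi>) b \<in> fc (S_gens D ?\<pi>)" if "b \<in> fc (U_gens D)" for b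
      by (rule subst_fc[OF presentation_hom.val_fc[OF U_to_S_hom[OF FS_finite[OF \<pi>]]] that])
    ultimately show "subst (valU ?\<pi>) (a - a') \<in> S.J ?\<pi>"
      using a by (simp add: S.cl_eq lin_diff[OF lin_subst])
  qed
  then show "u = u'" using a by (simp add: U.cl_eq)
qed

lemma U_E_closed: "i \<in> I \<Longrightarrow> U_E D \<epsilon> i \<in> carrier (QU D)"
  unfolding U_E_def QU_def by (intro U.cl_closed uE_fc)

lemma U_K_closed: "U_K D y \<in> carrier (QU D)"
  unfolding U_K_def QU_def by (intro U.cl_closed uK_fc)

lemma U_to_S_E: "finite \<pi> \<Longrightarrow> i \<in> I \<Longrightarrow> U_to_S D \<pi> (U_E D \<epsilon> i) = S_E D \<pi> \<epsilon> i"
  by (simp add: U_E_def U_to_S(2) uE_fc S_E_cl)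

lemma U_to_S_K: "finite \<pi> \<Longrightarrow> U_to_S D \<pi> (U_K D y) = S_K D \<pi> y"
  by (simp add: U_K_def U_to_S(2) uK_fc S_K_cl)

lemma \<theta>0_E: "i \<in> I \<Longrightarrow> \<theta>0 (U_E D \<epsilon> i) = Ehat D \<epsilon> i"
  by (auto simp: \<theta>0_def U_E_closed Ehat_def U_to_S_E[OF FS_finite] intro!: restrict_ext)

lemma \<theta>0_K: "\<theta>0 (U_K D y) = Khat D y"
  by (auto simp: \<theta>0_def U_K_closed Khat_def U_to_S_K[OF FS_finite] intro!: restrict_ext)

lemma \<theta>0_divpow:
  "i \<in> I \<Longrightarrow> \<theta>0 (divpow (QU D) (v_at D i) (U_E D \<epsilon> i) m) = divpow (Uhat D) (v_at D i) (Ehat D \<epsilon> i) m"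
  using alg_hom_divpow[OF QU_ring _ \<theta>0_alg_hom U_E_closed] Uhat_algebra
  by (simp add: \<theta>0_E algebra_over_def)

section \<open>Integral forms\<close>

definition GU :: "('i, 'y) ugen free_alg set set" where
  "GU = {divpow (QU D) (v_at D i) (U_E D \<epsilon> i) m | \<epsilon> i m. i \<in> I} \<union> range (U_K D)"

definition GS :: "'x set \<Rightarrow> ('i, 'x) sgen free_alg set set" where
  "GS \<pi> = {divpow (QS D \<pi>) (v_at D i) (S_E D \<pi> \<epsilon> i) m | \<epsilon> i m. i \<in> I} \<union> S_id D \<pi> ` weyl_orbit D \<pi>"

lemma GU_closed: "GU \<subseteq> carrier (QU D)"
  unfolding GU_def U_E_def U_K_def QU_def
  by (auto simp: U.P_divpow uE_fc uK_fc fc_free_divpow intro!: U.cl_closed)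

lemma GS_closed: "GS \<pi> \<subseteq> carrier (QS D \<pi>)"
  unfolding GS_def S_E_cl S_id_cl QS_def
  by (auto simp: S.P_divpow sE_fc idm_fc fc_free_divpow intro!: S.cl_closed)

lemma QU_laurent: "algebra_over laurent (QU D)" and QS_laurent: "algebra_over laurent (QS D \<pi>)"
  and Uhat_laurent: "algebra_over laurent (Uhat D)"
  using QU_algebra QS_algebra Uhat_algebra by (auto intro: algebra_over_mono minus1_laurent)

lemma AU_eq: "AU D = (QU D)\<lparr>carrier := subalgebra_gen laurent (QU D) GU\<rparr>"
  by (simp add: AU_def GU_def)

lemma AU_ops: "x \<otimes>\<^bsub>AU D\<^esub> y = x \<otimes>\<^bsub>QU D\<^esub> y" "x \<oplus>\<^bsub>AU D\<^esub> y = x \<oplus>\<^bsub>QU D\<^esub> y"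
  "\<one>\<^bsub>AU D\<^esub> = \<one>\<^bsub>QU D\<^esub>" "c \<odot>\<^bsub>AU D\<^esub> x = c \<odot>\<^bsub>QU D\<^esub> x"
  by (simp_all add: AU_eq)

lemma AUhat_ops: "a \<otimes>\<^bsub>AUhat D\<^esub> b = a \<otimes>\<^bsub>Uhat D\<^esub> b" "a \<oplus>\<^bsub>AUhat D\<^esub> b = a \<oplus>\<^bsub>Uhat D\<^esub> b"
  "\<one>\<^bsub>AUhat D\<^esub> = \<one>\<^bsub>Uhat D\<^esub>" "c \<odot>\<^bsub>AUhat D\<^esub> a = c \<odot>\<^bsub>Uhat D\<^esub> a"
  by (simp_all add: AUhat_def)

lemma AS_carrier: "carrier (AS D \<pi>) = subalgebra_gen laurent (QS D \<pi>) (GS \<pi>)"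
  by (simp add: AS_def GS_def)

lemma AU_subalgebra: "subalgebra_over laurent (QU D) (carrier (AU D))"
  using subalgebra_gen_subalgebra[OF QU_laurent GU_closed] by (simp add: AU_eq)

lemma AU_algebra: "algebra_over laurent (AU D)"
  using subalgebra_algebra[OF QU_laurent AU_subalgebra] by (simp add: AU_eq)

lemma AS_subalgebra: "subalgebra_over laurent (QS D \<pi>) (carrier (AS D \<pi>))"
  unfolding AS_carrier by (rule subalgebra_gen_subalgebra[OF QS_laurent GS_closed])

text \<open>K_h is a combination of the idempotents with powers of v as coefficients, hence
  integral.\<close>

lemma S_K_AS: assumes "finite \<pi>" shows "S_K D \<pi> y \<in> carrier (AS D \<pi>)"
proof -
  note AS = subalgebra_overD[OF AS_subalgebra]
  have "S.cl \<pi> (\<Sum>\<nu>\<in>T. vv powi pair D y \<nu> *\<^sub>q idm \<pi> \<nu>) \<in> carrier (AS D \<pi>)" if "finite T" "T \<subseteq> weyl_orbit D \<pi>" for T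
    using that
  proof (induction T)
    case empty
    then show ?case using AS(3)[of \<pi>] by (simp add: QS_def S.P_zero)
  next
    case (insert \<nu> T)
    have "S_id D \<pi> \<nu> \<in> GS \<pi>" using insert.prems by (simp add: GS_def)
    then have "S_id D \<pi> \<nu> \<in> carrier (AS D \<pi>)"
      unfolding AS_carrier by (rule subsetD[OF subalgebra_gen_superset])
    from AS(5)[OF AS(6)[OF powi_laurent this]] insert
    have "((vv powi pair D y \<nu>) \<odot>\<^bsub>QS D \<pi>\<^esub> S_id D \<pi> \<nu>) \<oplus>\<^bsub>QS D \<pi>\<^esub> S.cl \<pi> (\<Sum>\<nu>\<in>T. vv powi pair D y \<nu> *\<^sub>q idm \<pi> \<nu>) \<in> carrier (AS D \<pi>)"
      by simp
    then show ?case
      using insert.hyps by (simp add: S_id_cl QS_def S.P_smult S.P_add idm_fc fc_smul fc_sum)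
  qed
  then show ?thesis unfolding S_K_cl[OF assms] kk_def using finite_weyl_orbit[OF assms] by blast
qed

text \<open>The preimage of the integral form of S(\<pi>) is a subalgebra over
  \<open>laurent\<close> and contains the generators of the integral form of U.\<close>

lemma U_to_S_AU:
  assumes "finite \<pi>" "u \<in> carrier (AU D)" shows "U_to_S D \<pi> u \<in> carrier (AS D \<pi>)"
proof -
  let ?V = "{u \<in> carrier (QU D). U_to_S D \<pi> u \<in> carrier (AS D \<pi>)}"
  have "subalgebra_over laurent (QU D) ?V"
    by (rule subalgebra_vimage[OF QU_laurent alg_hom_laurent[OF U_to_S(1)[OF assms(1)]] AS_subalgebra])
  moreover have "GU \<subseteq> ?V"
  proof
    fix g assume g: "g \<in> GU"
    then consider \<epsilon> i m where "i \<in> I" "g = divpow (QU D) (v_at D i) (U_E D \<epsilon> i) m" | y where "g = U_K D y"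
      unfolding GU_def by blast
    then have "U_to_S D \<pi> g \<in> carrier (AS D \<pi>)"
    proof cases
      case 1
      have "U_to_S D \<pi> g = divpow (QS D \<pi>) (v_at D i) (S_E D \<pi> \<epsilon> i) m"
        unfolding 1 alg_hom_divpow[OF QU_ring QS_ring U_to_S(1)[OF assms(1)] U_E_closed[OF 1(1)]]
        by (simp add: U_to_S_E[OF assms(1) 1(1)])
      also have "\<dots> \<in> GS \<pi>" unfolding GS_def using 1(1) by blast
      finally show ?thesis unfolding AS_carrier by (rule subsetD[OF subalgebra_gen_superset])
    qed (simp add: U_to_S_K assms(1) S_K_AS)
    then show "g \<in> ?V" using g GU_closed by blast
  qed
  ultimately have "subalgebra_gen laurent (QU D) GU \<subseteq> ?V" by (rule subalgebra_gen_minimal[rotated])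
  then show ?thesis using assms(2) by (auto simp: AU_eq)
qed

lemma AUhat_subalgebra: "subalgebra_over laurent (Uhat D) (carrier (AUhat D))"
proof (rule subalgebra_overI[OF Uhat_laurent])
  note AS = subalgebra_overD[OF AS_subalgebra]
  show "\<one>\<^bsub>Uhat D\<^esub> \<in> carrier (AUhat D)"
    using Uhat_one by (simp add: AUhat_def Uhat_simps AS)
qed (auto simp: AUhat_def Uhat_closed, auto simp: Uhat_simps subalgebra_overD[OF AS_subalgebra])

lemma AUhat_algebra: "algebra_over laurent (AUhat D)"
  using subalgebra_algebra[OF Uhat_laurent AUhat_subalgebra] by (simp add: AUhat_def)

lemma \<theta>0_AU: "\<theta>0 \<in> alg_hom laurent (AU D) (AUhat D)"
proof -
  note hom = alg_homD[OF \<theta>0_alg_hom]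
  have sub: "x \<in> carrier (QU D)" if "x \<in> carrier (AU D)" for x
    using that subalgebra_overD(1)[OF AU_subalgebra] by blast
  show ?thesis
  proof (rule alg_homI)
  show "\<theta>0 x \<in> carrier (AUhat D)" if x: "x \<in> carrier (AU D)" for x
    using hom(1)[OF sub[OF x]] U_to_S_AU[OF FS_finite x] sub[OF x] by (simp add: AUhat_def \<theta>0_def)
  qed (simp_all add: AU_ops AUhat_ops hom sub)
qed

text \<open>Both inclusions come from minimality of generated subalgebras, applied to the image of
  \<open>AU D\<close> and to the preimage of the target. That preimage is a subalgebra of
  \<open>AU D\<close>, and transitivity makes it one of \<open>QU D\<close>, where the hull defining
  \<open>AU D\<close> is taken.\<close>

lemma \<theta>0_image: "\<theta>0 ` carrier (AU D) = carrier (AUhat_sub D)"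
proof -
  let ?G = "{divpow (Uhat D) (v_at D i) (Ehat D \<epsilon> i) m | \<epsilon> i m. i \<in> I} \<union> range (Khat D)"
  let ?H = "subalgebra_gen laurent (AUhat D) ?G"
  have G: "?G = \<theta>0 ` GU"
  proof -
    have "\<theta>0 ` {divpow (QU D) (v_at D i) (U_E D \<epsilon> i) m | \<epsilon> i m. i \<in> I} = {divpow (Uhat D) (v_at D i) (Ehat D \<epsilon> i) m | \<epsilon> i m. i \<in> I}"
      by (force simp: \<theta>0_divpow[symmetric] image_iff)
    then show ?thesis unfolding GU_def image_Un by (simp add: image_image \<theta>0_K)
  qed
  have GU: "GU \<subseteq> carrier (AU D)" using subalgebra_gen_superset by (simp add: AU_eq)
  have im: "subalgebra_over laurent (AUhat D) (\<theta>0 ` carrier (AU D))"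
    by (rule subalgebra_image[OF AU_algebra AUhat_algebra \<theta>0_AU])
  have "?H \<subseteq> \<theta>0 ` carrier (AU D)"
    unfolding G by (rule subalgebra_gen_minimal[OF image_mono[OF GU] im])
  moreover have "\<theta>0 ` carrier (AU D) \<subseteq> ?H"
  proof -
    let ?V = "{u \<in> carrier (AU D). \<theta>0 u \<in> ?H}"
    have "?G \<subseteq> carrier (AUhat D)" unfolding G using GU alg_homD(1)[OF \<theta>0_AU] by blast
    note V = subalgebra_vimage[OF AU_algebra \<theta>0_AU subalgebra_gen_subalgebra[OF AUhat_algebra this]]
    have eq: "(QU D)\<lparr>carrier := carrier (AU D)\<rparr> = AU D" by (simp add: AU_eq)
    have "subalgebra_over laurent (QU D) ?V"
      by (rule subalgebra_trans[OF QU_laurent AU_subalgebra, unfolded eq, OF V])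
    moreover have "GU \<subseteq> ?V"
    proof
      fix g assume g: "g \<in> GU"
      then have "\<theta>0 g \<in> ?G" unfolding G by (rule imageI)
      then have "\<theta>0 g \<in> ?H" by (rule subsetD[OF subalgebra_gen_superset])
      then show "g \<in> ?V" using g GU by blast
    qed
    ultimately have "subalgebra_gen laurent (QU D) GU \<subseteq> ?V" by (intro subalgebra_gen_minimal)
    then show ?thesis by (auto simp: AU_eq)
  qed
  ultimately show ?thesis by (simp add: AUhat_sub_def)
qed

lemma \<theta>0_alg_iso: "\<theta>0 \<in> alg_iso laurent (AU D) (AUhat_sub D)"
proof -
  have "inj_on \<theta>0 (carrier (AU D))"
    using \<theta>0_inj subalgebra_overD(1)[OF AU_subalgebra] by (rule inj_on_subset)
  moreover have "\<theta>0 \<in> alg_hom laurent (AU D) (AUhat_sub D)"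
  proof (rule alg_homI)
    show "\<theta>0 x \<in> carrier (AUhat_sub D)" if "x \<in> carrier (AU D)" for x
      using that \<theta>0_image by blast
  qed (use alg_homD[OF \<theta>0_AU] in \<open>auto simp: AUhat_sub_def\<close>)
  ultimately show ?thesis by (simp add: alg_iso_def bij_betw_def \<theta>0_image)
qed

end

theorem theorem4p2:
  fixes D :: "('i, 'x::ab_group_add, 'y::ab_group_add) root_datum"
  assumes "root_datum_finite_type D"
  shows "(\<exists>!\<theta>. is_theta D \<theta>)
    \<and> (\<forall>\<theta>. is_theta D \<theta> \<longrightarrow>
          \<theta> \<in> alg_hom laurent (AU D) (AUhat D)
        \<and> inj_on \<theta> (carrier (AU D))
        \<and> (\<forall>\<epsilon>. \<forall>i\<in>index D. \<forall>m.
             \<theta> (divpow (QU D) (v_at D i) (U_E D \<epsilon> i) m)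
               = divpow (Uhat D) (v_at D i) (Ehat D \<epsilon> i) m)
        \<and> (\<forall>h. \<theta> (U_K D h) = Khat D h))
    \<and> (\<exists>\<phi>. \<phi> \<in> alg_iso laurent (AU D) (AUhat_sub D))"
proof -
  interpret rdatum D by unfold_locales (rule assms)
  have "inj_on \<theta>0 (carrier (AU D))"
    using \<theta>0_inj subalgebra_overD(1)[OF AU_subalgebra] by (rule inj_on_subset)
  then show ?thesis
    using \<theta>0_AU \<theta>0_divpow \<theta>0_K \<theta>0_alg_iso by (auto simp: is_theta_iff)
qed

end
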